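(* There exists an absolute constant $c > 0$ such that the following holds. Let $n, m, k \in \mathbb{N}$ be arbitrary, let $A = (a_{ij}) \in \mathbb{R}_{\ge 0}^{m \times n}$, let $\mathbf{p} = (p_1,\dots,p_n) \in [0,1]^n$ and let $\mathbf{\Delta} = (\Delta_1,\dots,\Delta_m) \in \mathbb{R}_{>0}^m$. For each $i \in [m]$ let \[ \alpha_i := \left( c \cdot \log\!\left( \frac{\sum_{j \in [n]} p_j a_{ij}}{\Delta_i} + 2 \right) \right)^{-1} \] and \[ \mathrm{prob}^{bad}_i := \frac{1}{\alpha_i} \exp\!\left( -\alpha_i \cdot \min\!\left( \frac{\Delta_i^2}{\sum_{j \in [n]} p_j a_{ij}^2},\; \frac{\Delta_i}{\max_{j \in [n]} a_{ij}},\; \frac{\Delta_i k}{\sum_{j \in [n]} p_j a_{ij}} \right) \right). \] Then there exists a deterministic parallel algorithm with $\tilde{O}(\max(\mathrm{nnz}(A), n, m)\operatorname{poly}(k))$ work and $\operatorname{poly}(\log(nm), k)$ depth that outputs a vector $\mathbf{q} \in \{0,1\}^n$ and a set $I^{bad} \subseteq [m]$ with $|I^{bad}| \le \sum_{i \in [m]} \mathrm{prob}^{bad}_i$ such that for every $i \in [m] \setminus I^{bad}$, \[ \Big| \sum_{j \in [n]} a_{ij}(p_j - q_j) \Big| \le \Delta_i. \]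
   Context: $[n] = \{1,\dots,n\}$. $\mathrm{nnz}(A)$ denotes the number of nonzero entries of the matrix $A$. Parallel algorithms are measured in the work/depth (PRAM) model: work is the total number of operations and depth is the length of the longest chain of sequentially dependent operations. $\tilde{O}(\cdot)$ hides factors polylogarithmic in the input size (in $n$ and $m$). *)

theory Defs
  imports "HOL-Library.Extended_Real" "Jordan_Normal_Form.Matrix"
begin

section \<open>A work/depth model\<close>

text \<open>
  Parallel algorithms are closed programs of a first-order nested data-parallel language with the
  usual work/depth cost semantics. All values are immutable and passed by reference; every
  primitive operation takes unit time. Parallelism comes from \<open>Tabulate\<close> (a parallel for-loop in
  which iteration \<open>i\<close> produces entry \<open>i\<close> of a fresh array) and from the independent arguments of
  binary operations. As there is no shared mutable state, there are no races, and a CREW PRAM runs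
  every program with only a logarithmic overhead for spawning and joining iterations.

  The primitives are chosen so that unit costs cannot be abused. Naturals (used for indices and
  counters) only admit addition, truncated subtraction, halving and comparison, so bit lengths grow
  by at most one per sequential step. Reals follow the real-RAM convention: exact field operations
  and comparisons, but no rounding and no conversion back to naturals. The only literals are
  naturals, so a program contains a finite amount of information.
\<close>

datatype val = VNat nat | VReal real | VVec "val list"

datatype unop = Half | ToReal | Length

datatype binop =
    NAdd | NSub | NLess
  | RAdd | RSub | RMul | RDiv | RLess
  | Index
  | Pair_of

text \<open>
  Variables are de Bruijn indices into the environment. \<open>Bind e1 e2\<close> and \<open>Tabulate e b\<close> bind
  index 0 in \<open>e2\<close> and \<open>b\<close>, respectively. \<open>While b e\<close> does not bind anything: it repeatedly replaces
  the value of variable 0 by the value of \<open>e\<close> for as long as \<open>b\<close> is nonzero, and returns the final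
  value of variable 0.
\<close>

datatype expr =
    Var nat
  | Lit nat
  | Op1 unop expr
  | Op2 binop expr expr
  | Bind expr expr
  | Cond expr expr expr
  | Tabulate expr expr
  | While expr expr

fun apply1 :: "unop \<Rightarrow> val \<Rightarrow> val option" where
  "apply1 Half (VNat a) = Some (VNat (a div 2))"
| "apply1 ToReal (VNat a) = Some (VReal (real a))"
| "apply1 Length (VVec xs) = Some (VNat (length xs))"
| "apply1 _ _ = None"

fun apply2 :: "binop \<Rightarrow> val \<Rightarrow> val \<Rightarrow> val option" where
  "apply2 NAdd (VNat a) (VNat b) = Some (VNat (a + b))"
| "apply2 NSub (VNat a) (VNat b) = Some (VNat (a - b))"
| "apply2 NLess (VNat a) (VNat b) = Some (VNat (of_bool (a < b)))"
| "apply2 RAdd (VReal x) (VReal y) = Some (VReal (x + y))"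
| "apply2 RSub (VReal x) (VReal y) = Some (VReal (x - y))"
| "apply2 RMul (VReal x) (VReal y) = Some (VReal (x * y))"
| "apply2 RDiv (VReal x) (VReal y) = (if y = 0 then None else Some (VReal (x / y)))"
| "apply2 RLess (VReal x) (VReal y) = Some (VNat (of_bool (x < y)))"
| "apply2 Index (VVec xs) (VNat i) = (if i < length xs then Some (xs ! i) else None)"
| "apply2 Pair_of v w = Some (VVec [v, w])"
| "apply2 _ _ _ = None"

text \<open>
  \<open>evals env e v w d\<close>: in the environment \<open>env\<close>, the expression \<open>e\<close> terminates without a run-time
  error and returns \<open>v\<close>; in total \<open>w\<close> operations are performed, and the longest chain of
  sequentially dependent operations has length \<open>d\<close>.
\<close>

inductive evals :: "val list \<Rightarrow> expr \<Rightarrow> val \<Rightarrow> nat \<Rightarrow> nat \<Rightarrow> bool" where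
  Var: "i < length env \<Longrightarrow> evals env (Var i) (env ! i) 1 1"
| Lit: "evals env (Lit a) (VNat a) 1 1"
| Op1: "evals env e v w d \<Longrightarrow> apply1 f v = Some r \<Longrightarrow>
    evals env (Op1 f e) r (w + 1) (d + 1)"
| Op2: "evals env e1 v1 w1 d1 \<Longrightarrow> evals env e2 v2 w2 d2 \<Longrightarrow> apply2 f v1 v2 = Some r \<Longrightarrow>
    evals env (Op2 f e1 e2) r (w1 + w2 + 1) (max d1 d2 + 1)"
| Bind: "evals env e1 v1 w1 d1 \<Longrightarrow> evals (v1 # env) e2 v2 w2 d2 \<Longrightarrow>
    evals env (Bind e1 e2) v2 (w1 + w2 + 1) (d1 + d2 + 1)"
| Cond: "evals env b (VNat t) w1 d1 \<Longrightarrow>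
    evals env (if t \<noteq> 0 then e1 else e2) v w2 d2 \<Longrightarrow>
    evals env (Cond b e1 e2) v (w1 + w2 + 1) (d1 + d2 + 1)"
| Tabulate: "evals env e (VNat n) w d \<Longrightarrow>
    (\<And>i. i < n \<Longrightarrow> evals (VNat i # env) b (vs i) (ws i) (ds i)) \<Longrightarrow>
    evals env (Tabulate e b) (VVec (map vs [0..<n]))
      (w + (\<Sum>i<n. ws i) + 1) (d + Max (insert 0 (ds ` {..<n})) + 1)"
| While_end: "evals (v # env) b (VNat 0) w d \<Longrightarrow>
    evals (v # env) (While b e) v (w + 1) (d + 1)"
| While_step: "evals (v # env) b (VNat t) w1 d1 \<Longrightarrow> t \<noteq> 0 \<Longrightarrow>
    evals (v # env) e v' w2 d2 \<Longrightarrow> evals (v' # env) (While b e) v'' w3 d3 \<Longrightarrow>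
    evals (v # env) (While b e) v'' (w1 + w2 + w3 + 1) (d1 + d2 + d3 + 1)"

lemma evals_deterministic:
  assumes "evals env e v w d" and "evals env e v' w' d'"
  shows "v' = v \<and> w' = w \<and> d' = d"
  using assms
proof (induction arbitrary: v' w' d' rule: evals.induct)
  case (Var i env)
  from Var.prems show ?case by (cases rule: evals.cases) auto
next
  case (Lit env a)
  from Lit.prems show ?case by (cases rule: evals.cases) auto
next
  case (Op1 env e v w d f r)
  from Op1.prems show ?case
    by (cases rule: evals.cases) (use Op1.IH Op1.hyps in fastforce)
next
  case (Op2 env e1 v1 w1 d1 e2 v2 w2 d2 f r)
  from Op2.prems show ?case
    by (cases rule: evals.cases) (use Op2.IH Op2.hyps in fastforce)
next
  case (Bind env e1 v1 w1 d1 e2 v2 w2 d2)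
  from Bind.prems show ?case
    by (cases rule: evals.cases) (use Bind.IH in fastforce)
next
  case (Cond env b t w1 d1 e1 e2 v w2 d2)
  from Cond.prems show ?case
    by (cases rule: evals.cases) (use Cond.IH in fastforce)
next
  case (Tabulate env e n w d b vs ws ds)
  note IH = Tabulate.IH
  from Tabulate.prems show ?case
  proof (cases rule: evals.cases)
    case (Tabulate n' w1 d1 vs' ws' ds')
    have n: "n' = n" "w1 = w" "d1 = d"
      using IH(1)[OF Tabulate(4)] by auto
    have *: "vs' i = vs i \<and> ws' i = ws i \<and> ds' i = ds i" if "i < n" for i
      using IH(2)[OF that Tabulate(5)] that n by auto
    have "map vs' [0..<n] = map vs [0..<n]" using * by simp
    moreover have "sum ws' {..<n} = sum ws {..<n}" using * by simp
    moreover have "ds' ` {..<n} = ds ` {..<n}" using * by (intro image_cong) auto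
    ultimately show ?thesis using Tabulate(1-3) n by simp
  qed
next
  case (While_end v env b w d e)
  note IH = While_end.IH
  from While_end.prems show ?case
  proof (cases rule: evals.cases)
    case (While_end w1 d1)
    then show ?thesis using IH by blast
  next
    case (While_step t w1 d1 v1 w2 d2 w3 d3)
    then show ?thesis using IH by blast
  qed
next
  case (While_step v env b t w1 d1 e v1 w2 d2 v2 w3 d3)
  note IH = While_step.IH and t = While_step.hyps
  from While_step.prems show ?case
  proof (cases rule: evals.cases)
    case (While_end w1 d1)
    then show ?thesis using IH(1) t by blast
  next
    case (While_step t' w1' d1' v1' w2' d2' w3' d3')
    then show ?thesis using IH by metis
  qed
qed


section \<open>Encoding of inputs and outputs\<close>

definition enc_vec :: "real vec \<Rightarrow> val" where
  "enc_vec x = VVec (map VReal (list_of_vec x))"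

text \<open>
  Work proportional to the number of nonzero entries presupposes a sparse representation: a matrix
  is given by its rows, each being the array of pairs of column index and value of its nonzero
  entries.
\<close>

definition enc_sparse_mat :: "real mat \<Rightarrow> val" where
  "enc_sparse_mat A = VVec (map (\<lambda>i. VVec
     (map (\<lambda>j. VVec [VNat j, VReal (A $$ (i, j))]) (filter (\<lambda>j. A $$ (i, j) \<noteq> 0) [0..<dim_col A])))
     [0..<dim_row A])"

text \<open>A subset of \<open>{..<m}\<close> is output as the array of its \<open>m\<close> membership bits.\<close>

definition enc_set :: "nat \<Rightarrow> nat set \<Rightarrow> val" where
  "enc_set m I = VVec (map (\<lambda>i. VNat (of_bool (i \<in> I))) [0..<m])"

definition nnz :: "real mat \<Rightarrow> nat" where
  "nnz A = card {(i, j). i < dim_row A \<and> j < dim_col A \<and> A $$ (i, j) \<noteq> 0}"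


section \<open>Concentration bounds\<close>

definition alpha :: "real \<Rightarrow> real mat \<Rightarrow> real vec \<Rightarrow> real vec \<Rightarrow> nat \<Rightarrow> real" where
  "alpha c A p \<Delta> i =
     inverse (c * ln ((\<Sum>j<dim_col A. p $ j * A $$ (i, j)) / \<Delta> $ i + 2))"

text \<open>The function \<open>exp (- x)\<close> on \<open>[0, \<infinity>]\<close>.\<close>

definition exp_neg :: "ereal \<Rightarrow> real" where
  "exp_neg x = (if x = \<infinity> then 0 else exp (- real_of_ereal x))"

text \<open>
  The quotients are taken in the extended reals because their denominators may vanish: there,
  a positive number divided by 0 is \<open>\<infinity>\<close> (whereas on type \<^typ>\<open>real\<close> it would be 0). The row maximum is
  over nonnegative entries, so inserting 0 matters only when there are no columns.
\<close>

definition prob_bad :: "real \<Rightarrow> nat \<Rightarrow> real mat \<Rightarrow> real vec \<Rightarrow> real vec \<Rightarrow> nat \<Rightarrow> real" where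
  "prob_bad c k A p \<Delta> i =
     1 / alpha c A p \<Delta> i *
     exp_neg (ereal (alpha c A p \<Delta> i) *
       Min {ereal ((\<Delta> $ i)\<^sup>2) / ereal (\<Sum>j<dim_col A. p $ j * (A $$ (i, j))\<^sup>2),
            ereal (\<Delta> $ i) / ereal (Max (insert 0 ((\<lambda>j. A $$ (i, j)) ` {..<dim_col A}))),
            ereal (\<Delta> $ i * real k) / ereal (\<Sum>j<dim_col A. p $ j * A $$ (i, j))})"

end

theory Submission
  imports Defs
begin

text \<open>
  The vector \<open>p\<close> is rounded by a derandomised random walk in \<open>[0,1]\<^sup>n\<close>. In one step every \<open>p\<^sub>j\<close> moves by
  \<open>\<plusminus>\<delta>\<^sub>j\<close> with \<open>\<delta>\<^sub>j = min (\<epsilon> p\<^sub>j) (1 - p\<^sub>j)\<close>, where \<open>1/\<epsilon>\<close> is of order \<open>k + log (n + m)\<close>. As the steps are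
  multiplicative, one step moves the sum of a row by at most \<open>\<epsilon>\<close> times its current mean, which is
  small compared with \<open>1/\<lambda>\<close> for the relevant exponents \<open>\<lambda> \<le> k / mean\<close>. Hence the exponential moments
  \<open>exp (\<plusminus>\<lambda> X + 2 \<lambda>\<^sup>2 V)\<close> of the deviation \<open>X\<close>, where \<open>V = \<Sum>a\<^sub>j\<^sup>2 p\<^sub>j (1 - p\<^sub>j)\<close> pays for the variance still
  to come, may be replaced by quadratic polynomials of the signs of the step, and for quadratic
  polynomials pairwise independent signs are as good as independent ones. Such signs are fixed one
  bit of the seed at a time by conditional expectations, with almost linear work.

  A row whose weight reaches 1 is declared bad and frozen. The sum of all weights never increases,
  so it bounds the number of bad rows by the initial weights, which are Bernstein bounds. After
  about \<open>\<epsilon>\<inverse>\<^sup>2 log (n m)\<close> steps every \<open>p\<^sub>j\<close> is either 1 or negligibly small, because a potential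
  dominating \<open>\<surd>p\<^sub>j\<close> decays exponentially; the latter are rounded to 0.
\<close>

section \<open>Cost bounds for programs\<close>

text \<open>The model computes with reals by field operations and comparisons only, so neither
  exponentials nor logarithms are available. Every exponential of the analysis is replaced by a
  rational upper bound that the program can carry: a weight is multiplied by
  \<open>(1 + z + z * z) / (1 + D)\<close>, which dominates \<open>exp (z - D)\<close> for
  \<open>z \<le> 1\<close>, and the initial weights are powers \<open>(1 - h / (8 L)) ^ L\<close>,
  which lie between \<open>exp (- h / 4)\<close> and \<open>exp (- h / 8)\<close>. Logarithms become
  bit lengths.

  Row weights and column potentials share a single sum because one choice of signs has to serve
  both. The potentials enter linearly, so the sign selection must control a quadratic form plus an
  arbitrary linear form; a last global sign handles the linear part, since it leaves the squares
  alone.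

  The tolerance \<open>\<Delta>\<close> is spent in two halves, one for the walk and one for
  rounding the leftovers to 0. The half of the walk splits into a quarter for the initial weight and
  a quarter for the initial variance.\<close>

definition cost :: "val list \<Rightarrow> expr \<Rightarrow> val \<Rightarrow> nat \<Rightarrow> nat \<Rightarrow> bool" where
  "cost env e v w d \<longleftrightarrow> (\<exists>w' d'. evals env e v w' d' \<and> w' \<le> w \<and> d' \<le> d)"

lemma cost_mono: "cost env e v w d \<Longrightarrow> w \<le> w' \<Longrightarrow> d \<le> d' \<Longrightarrow> cost env e v w' d'"
  unfolding cost_def by (meson le_trans)

lemma cost_Op1:
  "cost env e v w d \<Longrightarrow> apply1 f v = Some r \<Longrightarrow> cost env (Op1 f e) r (w + 1) (d + 1)"
  unfolding cost_def by (meson add_le_mono1 evals.Op1)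

text \<open>Depths are added instead of taking the maximum over the two arguments. For a fixed
  program this loses only a constant factor, and all bounds remain linear sums.\<close>

lemma cost_Op2:
  assumes "cost env e1 va w1 d1" "cost env e2 vb w2 d2" "apply2 f va vb = Some r"
  shows "cost env (Op2 f e1 e2) r (w1 + w2 + 1) (d1 + d2 + 1)"
proof -
  obtain a1 b1 a2 b2 where "evals env e1 va a1 b1" "a1 \<le> w1" "b1 \<le> d1"
    "evals env e2 vb a2 b2" "a2 \<le> w2" "b2 \<le> d2"
    using assms(1,2) unfolding cost_def by blast
  then show ?thesis unfolding cost_def
    by (intro exI[of _ "a1 + a2 + 1"] exI[of _ "max b1 b2 + 1"] conjI evals.Op2[OF _ _ assms(3)])
      auto
qed

lemma cost_Bind:
  assumes "cost env e1 va w1 d1" "cost (va # env) e2 vb w2 d2"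
  shows "cost env (Bind e1 e2) vb (w1 + w2 + 1) (d1 + d2 + 1)"
proof -
  obtain a1 b1 a2 b2 where "evals env e1 va a1 b1" "a1 \<le> w1" "b1 \<le> d1"
    "evals (va # env) e2 vb a2 b2" "a2 \<le> w2" "b2 \<le> d2"
    using assms unfolding cost_def by blast
  then show ?thesis unfolding cost_def
    by (intro exI[of _ "a1 + a2 + 1"] exI[of _ "b1 + b2 + 1"] conjI evals.Bind) auto
qed

lemma cost_Cond:
  assumes "cost env b (VNat t) w1 d1" "cost env (if t \<noteq> 0 then e1 else e2) v w2 d2"
  shows "cost env (Cond b e1 e2) v (w1 + w2 + 1) (d1 + d2 + 1)"
proof -
  obtain a1 b1 a2 b2 where "evals env b (VNat t) a1 b1" "a1 \<le> w1" "b1 \<le> d1"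
    "evals env (if t \<noteq> 0 then e1 else e2) v a2 b2" "a2 \<le> w2" "b2 \<le> d2"
    using assms unfolding cost_def by blast
  then show ?thesis unfolding cost_def
    by (intro exI[of _ "a1 + a2 + 1"] exI[of _ "b1 + b2 + 1"] conjI evals.Cond) auto
qed

lemma cost_Cond_true:
  "cost env b (VNat t) w1 d1 \<Longrightarrow> t \<noteq> 0 \<Longrightarrow> cost env e1 v w2 d2 \<Longrightarrow>
    cost env (Cond b e1 e2) v (w1 + w2 + 1) (d1 + d2 + 1)"
  using cost_Cond[of env b t w1 d1 e1 e2 v w2 d2] by simp

lemma cost_Cond_false:
  "cost env b (VNat 0) w1 d1 \<Longrightarrow> cost env e2 v w2 d2 \<Longrightarrow>
    cost env (Cond b e1 e2) v (w1 + w2 + 1) (d1 + d2 + 1)"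
  using cost_Cond[of env b 0 w1 d1 e1 e2 v w2 d2] by simp

lemma cost_Bind':
  "cost env e1 v1 w1 d1 \<Longrightarrow> cost (v1 # env) e2 v2 w2 d2 \<Longrightarrow> w1 + w2 + 1 \<le> w \<Longrightarrow> d1 + d2 + 1 \<le> d
    \<Longrightarrow> cost env (Bind e1 e2) v2 w d"
  using cost_Bind cost_mono by blast

lemma cost_Op2':
  "cost env e1 v1 w1 d1 \<Longrightarrow> cost env e2 v2 w2 d2 \<Longrightarrow> apply2 f v1 v2 = Some r \<Longrightarrow>
    w1 + w2 + 1 \<le> w \<Longrightarrow> d1 + d2 + 1 \<le> d \<Longrightarrow> cost env (Op2 f e1 e2) r w d"
  using cost_Op2 cost_mono by blast

definition tab :: "nat \<Rightarrow> (nat \<Rightarrow> val) \<Rightarrow> val" where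
  "tab n f = VVec (map f [0..<n])"

lemma tab_cong: "(\<And>i. i < n \<Longrightarrow> f i = g i) \<Longrightarrow> tab n f = tab n g"
  by (simp add: tab_def)

text \<open>Work is bounded iteration by iteration because rows have different lengths, whereas one
  depth bound \<open>db\<close> for all iterations replaces their maximum.\<close>

lemma cost_Tabulate:
  assumes "cost env e (VNat n) w d"
    and "\<And>i. i < n \<Longrightarrow> cost (VNat i # env) b (f i) (ws i) db"
  shows "cost env (Tabulate e b) (tab n f) (w + (\<Sum>i<n. ws i) + 1) (d + db + 1)"
proof -
  obtain a1 b1 where 1: "evals env e (VNat n) a1 b1" "a1 \<le> w" "b1 \<le> d"
    using assms(1) unfolding cost_def by blast
  have "\<forall>i. \<exists>w' d'. i < n \<longrightarrow> evals (VNat i # env) b (f i) w' d' \<and> w' \<le> ws i \<and> d' \<le> db"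
    using assms(2) unfolding cost_def by blast
  then obtain u v where 2: "\<And>i. i < n \<Longrightarrow> evals (VNat i # env) b (f i) (u i) (v i)"
    "\<And>i. i < n \<Longrightarrow> u i \<le> ws i" "\<And>i. i < n \<Longrightarrow> v i \<le> db"
    by metis
  have "Max (insert 0 (v ` {..<n})) \<le> db" using 2(3) by auto
  moreover have "(\<Sum>i<n. u i) \<le> (\<Sum>i<n. ws i)" using 2(2) by (intro sum_mono) auto
  moreover have "evals env (Tabulate e b) (tab n f)
      (a1 + (\<Sum>i<n. u i) + 1) (b1 + Max (insert 0 (v ` {..<n})) + 1)"
    unfolding tab_def by (rule evals.Tabulate[OF 1(1) 2(1)])
  ultimately show ?thesis using 1 unfolding cost_def
    by (metis add_le_mono add_le_mono1)
qed

lemma cost_Tabulate_const: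
  assumes "cost env e (VNat n) w d"
    and "\<And>i. i < n \<Longrightarrow> cost (VNat i # env) b (f i) wb db"
  shows "cost env (Tabulate e b) (tab n f) (w + n * wb + 1) (d + db + 1)"
  using cost_Tabulate[of env e n w d b f "\<lambda>_. wb" db, OF assms] by simp

lemma cost_While_end:
  "cost (v # env) b (VNat 0) w d \<Longrightarrow> cost (v # env) (While b e) v (w + 1) (d + 1)"
  unfolding cost_def by (meson add_le_mono1 evals.While_end)

lemma cost_While_step:
  assumes "cost (v # env) b (VNat t) w1 d1" "t \<noteq> 0" "cost (v # env) e v' w2 d2"
    "cost (v' # env) (While b e) v'' w3 d3"
  shows "cost (v # env) (While b e) v'' (w1 + w2 + w3 + 1) (d1 + d2 + d3 + 1)"
proof -
  obtain a1 b1 a2 b2 a3 b3 where "evals (v # env) b (VNat t) a1 b1" "a1 \<le> w1" "b1 \<le> d1"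
    "evals (v # env) e v' a2 b2" "a2 \<le> w2" "b2 \<le> d2"
    "evals (v' # env) (While b e) v'' a3 b3" "a3 \<le> w3" "b3 \<le> d3"
    using assms unfolding cost_def by blast
  then show ?thesis unfolding cost_def using assms(2)
    by (intro exI[of _ "a1 + a2 + a3 + 1"] exI[of _ "b1 + b2 + b3 + 1"] conjI
        evals.While_step) auto
qed

section \<open>Loop-free expressions, evaluated symbolically\<close>

fun flat :: "expr \<Rightarrow> bool" where
  "flat (Var i) = True"
| "flat (Lit a) = True"
| "flat (Op1 f e) = flat e"
| "flat (Op2 f e1 e2) = (flat e1 \<and> flat e2)"
| "flat (Bind e1 e2) = (flat e1 \<and> flat e2)"
| "flat (Cond b e1 e2) = (flat b \<and> flat e1 \<and> flat e2)"
| "flat (Tabulate e b) = False"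
| "flat (While b e) = False"

text \<open>Charging both branches of a conditional makes the bound independent of the environment,
  so the cost of loop-free code is a numeral found by simplification.\<close>

fun expr_size :: "expr \<Rightarrow> nat" where
  "expr_size (Var i) = 1"
| "expr_size (Lit a) = 1"
| "expr_size (Op1 f e) = expr_size e + 1"
| "expr_size (Op2 f e1 e2) = expr_size e1 + expr_size e2 + 1"
| "expr_size (Bind e1 e2) = expr_size e1 + expr_size e2 + 1"
| "expr_size (Cond b e1 e2) = expr_size b + (expr_size e1 + expr_size e2) + 1"
| "expr_size (Tabulate e b) = 1"
| "expr_size (While b e) = 1"

fun flat_eval :: "val list \<Rightarrow> expr \<Rightarrow> val option" where
  "flat_eval env (Var i) = (if i < length env then Some (env ! i) else None)"
| "flat_eval env (Lit a) = Some (VNat a)"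
| "flat_eval env (Op1 f e) = (case flat_eval env e of None \<Rightarrow> None | Some x \<Rightarrow> apply1 f x)"
| "flat_eval env (Op2 f e1 e2) = (case flat_eval env e1 of None \<Rightarrow> None
     | Some x \<Rightarrow> (case flat_eval env e2 of None \<Rightarrow> None | Some y \<Rightarrow> apply2 f x y))"
| "flat_eval env (Bind e1 e2) = (case flat_eval env e1 of None \<Rightarrow> None | Some x \<Rightarrow> flat_eval (x # env) e2)"
| "flat_eval env (Cond b e1 e2) = (case flat_eval env b of Some (VNat t) \<Rightarrow>
     if t \<noteq> 0 then flat_eval env e1 else flat_eval env e2 | _ \<Rightarrow> None)"
| "flat_eval env (Tabulate e b) = None"
| "flat_eval env (While b e) = None"

lemma cost_flat:
  "flat e \<Longrightarrow> flat_eval env e = Some v \<Longrightarrow> cost env e v (expr_size e) (expr_size e)"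
proof (induction e arbitrary: env v)
  case (Var i)
  then show ?case unfolding cost_def by (auto split: if_splits intro!: evals.Var exI[of _ "Suc 0"] simp flip: One_nat_def)
next
  case (Lit a)
  then show ?case unfolding cost_def by (auto intro!: evals.Lit exI[of _ 1])
next
  case (Op1 f e)
  then show ?case using cost_Op1 by (fastforce split: option.splits)
next
  case (Op2 f e1 e2)
  then show ?case using cost_Op2 by (fastforce split: option.splits)
next
  case (Bind e1 e2)
  then show ?case using cost_Bind by (fastforce split: option.splits)
next
  case (Cond b e1 e2)
  from Cond.prems obtain t where t: "flat_eval env b = Some (VNat t)"
    "flat_eval env (if t \<noteq> 0 then e1 else e2) = Some v"
    by (auto split: option.splits val.splits if_splits)
  have "cost env (if t \<noteq> 0 then e1 else e2) v (expr_size e1 + expr_size e2) (expr_size e1 + expr_size e2)"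
  proof (cases "t = 0")
    case True
    then show ?thesis using Cond t cost_mono[of env e2 v "expr_size e2" "expr_size e2"] by simp
  next
    case False
    then show ?thesis using Cond t cost_mono[of env e1 v "expr_size e1" "expr_size e1"] by simp
  qed
  from cost_Cond[OF _ this] show ?case using Cond t by simp
qed auto

lemma cost_flat': "flat e \<Longrightarrow> flat_eval env e = Some v \<Longrightarrow> expr_size e \<le> w \<Longrightarrow> expr_size e \<le> d \<Longrightarrow> cost env e v w d"
  using cost_flat cost_mono by blast

lemma apply_tab [simp]:
  "apply1 Length (tab n f) = Some (VNat n)"
  "apply2 Index (tab n f) (VNat i) = (if i < n then Some (f i) else None)"
  by (simp_all add: tab_def)

abbreviation "vpair x y \<equiv> VVec [x, y]"

abbreviation rv :: "nat \<Rightarrow> (nat \<Rightarrow> real) \<Rightarrow> val" where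
  "rv n f \<equiv> tab n (\<lambda>i. VReal (f i))"

abbreviation "idx \<equiv> Op2 Index"
abbreviation "len \<equiv> Op1 Length"
abbreviation "fst_e e \<equiv> Op2 Index e (Lit 0)"
abbreviation "snd_e e \<equiv> Op2 Index e (Lit 1)"
abbreviation "rlit a \<equiv> Op1 ToReal (Lit a)"

lemma apply2_pair [simp]:
  "apply2 Pair_of v w = Some (VVec [v, w])"
  by (cases v; cases w) simp_all

abbreviation "x0 \<equiv> Var 0"
abbreviation "x1 \<equiv> Var 1"
abbreviation "x2 \<equiv> Var 2"
abbreviation "x3 \<equiv> Var 3"
abbreviation "x4 \<equiv> Var 4"
abbreviation "x5 \<equiv> Var 5"
abbreviation "x6 \<equiv> Var 6"
abbreviation "x7 \<equiv> Var 7"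
abbreviation "x8 \<equiv> Var 8"
abbreviation "x9 \<equiv> Var 9"
abbreviation "x10 \<equiv> Var 10"
abbreviation "x11 \<equiv> Var 11"
abbreviation "x12 \<equiv> Var 12"
abbreviation "rmul \<equiv> Op2 RMul"
abbreviation "radd \<equiv> Op2 RAdd"
abbreviation "rsub \<equiv> Op2 RSub"
abbreviation "rdiv \<equiv> Op2 RDiv"
abbreviation "rless \<equiv> Op2 RLess"
abbreviation "nadd \<equiv> Op2 NAdd"
abbreviation "nsub \<equiv> Op2 NSub"
abbreviation "nless \<equiv> Op2 NLess"
abbreviation "pair_e \<equiv> Op2 Pair_of"

section \<open>Loops and tree reduction\<close>

text \<open>The counter is a real: iteration counts such as \<open>r_T\<close> are products, but the
  language neither multiplies naturals nor converts reals back. The loop state is a pair of counter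
  and value. The body sees the value as variable 0 and the pair as variable 1; the latter is the
  arbitrary \<open>x\<close> in the cost lemmas.\<close>

definition rep_loop :: "expr \<Rightarrow> expr" where
  "rep_loop b = While (rless (rlit 0) (fst_e x0))
     (pair_e (rsub (fst_e x0) (rlit 1)) (Bind (snd_e x0) b))"

definition rep_e :: "expr \<Rightarrow> expr \<Rightarrow> expr \<Rightarrow> expr" where
  "rep_e c i b = snd_e (Bind (pair_e c i) (rep_loop b))"

lemma cost_rep_loop:
  assumes "\<And>t x. t < T \<Longrightarrow> cost (st t # x # env) b (st (Suc t)) w d"
  shows "t \<le> T \<Longrightarrow> cost (vpair (VReal (real (T - t))) (st t) # env) (rep_loop b)
     (vpair (VReal 0) (st T)) ((T - t) * (w + 30) + 10) ((T - t) * (d + 30) + 10)"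
proof (induction "T - t" arbitrary: t)
  case 0
  then have "t = T" by simp
  have "cost (vpair (VReal 0) (st T) # env) (rep_loop b) (vpair (VReal 0) (st T)) (9 + 1) (9 + 1)"
    unfolding rep_loop_def by (rule cost_While_end, rule cost_flat') simp_all
  then show ?case using \<open>t = T\<close> by simp
next
  case (Suc u)
  then have u: "u = T - Suc t" "t < T" "Suc t \<le> T" by simp_all
  have r: "real (T - t) - 1 = real (T - Suc t)" using u(2) by (simp add: of_nat_diff)
  let ?v = "vpair (VReal (real (T - t))) (st t)"
  have 1: "cost (?v # env) (rless (rlit 0) (fst_e x0)) (VNat 1) 6 6"
    by (rule cost_flat') (use u in simp_all)
  have 2: "cost (?v # env) (rsub (fst_e x0) (rlit 1)) (VReal (real (T - Suc t))) 6 6"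
    by (rule cost_flat') (use r in simp_all)
  have 3: "cost (?v # env) (snd_e x0) (st t) 3 3"
    by (rule cost_flat') simp_all
  have 4: "cost (?v # env) (pair_e (rsub (fst_e x0) (rlit 1)) (Bind (snd_e x0) b))
     (vpair (VReal (real (T - Suc t))) (st (Suc t))) (6 + (3 + w + 1) + 1) (6 + (3 + d + 1) + 1)"
    by (rule cost_Op2[OF 2 cost_Bind[OF 3 assms[OF u(2)]]]) simp
  have 5: "T - t = Suc (T - Suc t)" using u by simp
  show ?case unfolding rep_loop_def
    by (rule cost_mono[OF cost_While_step[OF 1 _ 4 Suc(1)[OF u(1,3), unfolded rep_loop_def]]])
      (simp_all add: 5)
qed

lemma cost_rep:
  assumes c: "cost env c (VReal (real T)) wc dc" and i: "cost env i (st 0) wi di"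
    and b: "\<And>t x. t < T \<Longrightarrow> cost (st t # x # env) b (st (Suc t)) w d"
  shows "cost env (rep_e c i b) (st T) (wc + wi + T * (w + 30) + 20) (dc + di + T * (d + 30) + 20)"
proof -
  have 1: "cost env (pair_e c i) (vpair (VReal (real (T - 0))) (st 0)) (wc + wi + 1) (dc + di + 1)"
    using cost_Op2[OF c i, of Pair_of] by simp
  have 2: "cost env (Lit 1) (VNat 1) 1 1" by (rule cost_flat') simp_all
  show ?thesis unfolding rep_e_def
    by (rule cost_Op2'[OF cost_Bind[OF 1 cost_rep_loop[of T st, OF b]] 2]) simp_all
qed

section \<open>Balanced tree reduction for sums and maxima\<close>

function red :: "(real \<Rightarrow> real \<Rightarrow> real) \<Rightarrow> nat \<Rightarrow> (nat \<Rightarrow> real) \<Rightarrow> real" where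
  "red f n x = (if n \<le> 1 then x 0 else
     red f ((n + 1) div 2) (\<lambda>i. if 2 * i + 1 < n then f (x (2 * i)) (x (2 * i + 1)) else x (2 * i)))"
  by auto
termination by (relation "measure (\<lambda>(f, n, x). n)") auto

declare red.simps [simp del]

definition red_body :: "expr \<Rightarrow> expr" where
  "red_body f = Bind (nadd x0 x0)
     (Cond (nless (nadd x0 (Lit 1)) (len x2))
        (Bind (idx x2 (nadd x0 (Lit 1))) (Bind (idx x3 x1) f))
        (idx x2 x0))"

definition red_loop :: "expr \<Rightarrow> expr" where
  "red_loop f = While (nless (Lit 1) (len x0))
     (Tabulate (Op1 Half (nadd (len x0) (Lit 1))) (red_body f))"

definition red_e :: "expr \<Rightarrow> expr" where
  "red_e f = Cond (len x0) (fst_e (red_loop f)) (rlit 0)"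

lemma cost_red_body:
  assumes f: "\<And>a b env. cost (VReal a # VReal b # env) fe (VReal (f a b)) 20 20"
    and i: "i < (n + 1) div 2"
  shows "cost (VNat i # rv n x # env) (red_body fe)
    (VReal (if 2 * i + 1 < n then f (x (2 * i)) (x (2 * i + 1)) else x (2 * i))) 50 50"
proof -
  have 1: "cost (VNat i # rv n x # env) (nadd x0 x0) (VNat (2 * i)) 3 3"
    by (rule cost_flat') simp_all
  let ?e = "VNat (2 * i) # VNat i # rv n x # env"
  have 2: "cost ?e (nless (nadd x0 (Lit 1)) (len x2)) (VNat (of_bool (2 * i + 1 < n))) 6 6"
    by (rule cost_flat') simp_all
  show ?thesis
  proof (cases "2 * i + 1 < n")
    case True
    have 3: "cost ?e (idx x2 (nadd x0 (Lit 1))) (VReal (x (2 * i + 1))) 5 5"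
      by (rule cost_flat') (use True in simp_all)
    have 4: "cost (VReal (x (2 * i + 1)) # ?e) (idx x3 x1) (VReal (x (2 * i))) 3 3"
      by (rule cost_flat') (use True in simp_all)
    show ?thesis unfolding red_body_def if_P[OF True]
      by (rule cost_Bind'[OF 1 cost_Cond_true[OF 2 _ cost_Bind[OF 3 cost_Bind[OF 4 f]]]]) (use True in simp_all)
  next
    case False
    then have "2 * i < n" using i by linarith
    then have "cost ?e (idx x2 x0) (VReal (x (2 * i))) 3 3"
      by (intro cost_flat') simp_all
    then show ?thesis unfolding red_body_def
      using cost_Bind'[OF 1 cost_Cond_false[of ?e]] 2 False by simp
  qed
qed

text \<open>The array shrinks by a constant factor in every round, so the work is a geometric sum
  and stays linear, while at most \<open>g\<close> rounds are made.\<close>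

lemma cost_red_loop:
  assumes f: "\<And>a b env. cost (VReal a # VReal b # env) fe (VReal (f a b)) 20 20"
  shows "1 \<le> n \<Longrightarrow> n \<le> 2 ^ g \<Longrightarrow>
    cost (rv n x # env) (red_loop fe) (rv 1 (\<lambda>_. red f n x)) (200 * n) (100 * (g + 1))"
proof (induction n arbitrary: x g rule: less_induct)
  case (less n)
  show ?case
  proof (cases "n = 1")
    case True
    then have "rv n x = rv 1 (\<lambda>_. red f n x)" by (simp add: tab_def red.simps)
    moreover have "cost (rv n x # env) (red_loop fe) (rv n x) (4 + 1) (4 + 1)"
      unfolding red_loop_def by (rule cost_While_end, rule cost_flat') (use True in simp_all)
    ultimately show ?thesis using True by (auto elim!: cost_mono)
  next
    case False
    with less.prems have n: "2 \<le> n" by simp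
    let ?n = "(n + 1) div 2"
    let ?x = "\<lambda>i. if 2 * i + 1 < n then f (x (2 * i)) (x (2 * i + 1)) else x (2 * i)"
    have 1: "cost (rv n x # env) (nless (Lit 1) (len x0)) (VNat 1) 4 4"
      by (rule cost_flat') (use n in simp_all)
    have 2: "cost (rv n x # env) (Tabulate (Op1 Half (nadd (len x0) (Lit 1))) (red_body fe))
         (rv ?n ?x) (5 + ?n * 50 + 1) (5 + 50 + 1)"
      by (rule cost_Tabulate_const[OF _ cost_red_body[OF f]]) (rule cost_flat'; simp)
    have m: "?n < n" "1 \<le> ?n" using n by auto
    obtain g' where g: "g = Suc g'" using less.prems n by (cases g) auto
    have "?n \<le> 2 ^ g'" using less.prems g by auto
    note 3 = less.IH[OF m this, of ?x]
    have r: "red f n x = red f ?n ?x" using n by (subst red.simps) simp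
    \<comment> \<open>From \<open>n \<ge> 2\<close> on, n / 2 rounded up is at most 2 n / 3, with
      equality at 3. Each entry of the new array costs 50 now and 200 in the recursion, which fits
      into the budget of 200 per old entry.\<close>
    have "3 * ?n \<le> 2 * n" using n by linarith
    then show ?thesis unfolding r red_loop_def
      by (intro cost_mono[OF cost_While_step[OF 1 _ 2 3[unfolded red_loop_def]]]) (use n in \<open>simp_all add: g\<close>)
  qed
qed

lemma cost_red:
  assumes f: "\<And>a b env. cost (VReal a # VReal b # env) fe (VReal (f a b)) 20 20" and g: "n \<le> 2 ^ g"
  shows "cost (rv n x # env) (red_e fe) (VReal (if n = 0 then 0 else red f n x))
    (200 * n + 20) (100 * (g + 1) + 20)"
proof -
  have 1: "cost (rv n x # env) (len x0) (VNat n) 2 2" by (rule cost_flat') simp_all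
  have 2: "cost (rv n x # env) (Lit 0) (VNat 0) 1 1" by (rule cost_flat') simp_all
  have 3: "cost (rv n x # env) (rlit 0) (VReal 0) 2 2" by (rule cost_flat') simp_all
  show ?thesis
  proof (cases "n = 0")
    case True
    then show ?thesis unfolding red_e_def
      using cost_mono[OF cost_Cond_false[of "rv n x # env", OF _ 3]] 1 by simp
  next
    case False
    then have n: "1 \<le> n" by simp
    show ?thesis unfolding red_e_def
      by (rule cost_mono[OF cost_Cond_true[OF 1 _ cost_Op2[OF cost_red_loop[of fe f, OF f n g] 2]]])
        (use False in simp_all)
  qed
qed

lemma red_add: "1 \<le> n \<Longrightarrow> red (+) n x = (\<Sum>i<n. x i)"
proof (induction n arbitrary: x rule: less_induct)
  case (less n)
  show ?case
  proof (cases "n = 1")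
    case True
    then show ?thesis by (simp add: red.simps)
  next
    case False
    let ?x = "\<lambda>i. if 2 * i + 1 < n then x (2 * i) + x (2 * i + 1) else x (2 * i)"
    have *: "(\<Sum>i<(n + 1) div 2. if 2 * i + 1 < n then x (2 * i) + x (2 * i + 1) else x (2 * i))
        = (\<Sum>i<n. x i)" for n
    proof (induction n rule: nat_less_induct)
      case (1 n)
      show ?case
      proof (cases "n \<le> 1")
        case True
        then show ?thesis by (cases "n = 0") (auto simp: le_Suc_eq)
      next
        case False
        then obtain k where k: "n = Suc (Suc k)" by (metis One_nat_def Suc_le_D not_less_eq_eq)
        have "(\<Sum>i<(n + 1) div 2. if 2 * i + 1 < n then x (2 * i) + x (2 * i + 1) else x (2 * i)) =
          (\<Sum>i<(k + 1) div 2. if 2 * i + 1 < n then x (2 * i) + x (2 * i + 1) else x (2 * i)) +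
          (if 2 * ((k + 1) div 2) + 1 < n then x (2 * ((k + 1) div 2)) + x (2 * ((k + 1) div 2) + 1)
           else x (2 * ((k + 1) div 2)))"
          by (simp add: k)
        also have "\<dots> = (\<Sum>i<n. x i)"
        proof (cases "even k")
          case True
          then have "(k + 1) div 2 = k div 2" by simp
          moreover have "(\<Sum>i<k div 2. if 2 * i + 1 < n then x (2 * i) + x (2 * i + 1) else x (2 * i)) =
            (\<Sum>i<(k + 1) div 2. if 2 * i + 1 < k then x (2 * i) + x (2 * i + 1) else x (2 * i))"
            using True by (intro sum.cong) (auto simp: k)
          moreover have "(\<Sum>i<(k + 1) div 2. if 2 * i + 1 < k then x (2 * i) + x (2 * i + 1) else x (2 * i))
            = (\<Sum>i<k. x i)" using 1 k by simp
          ultimately show ?thesis using k True by simp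
        next
          \<comment> \<open>For odd \<open>k\<close> the entry \<open>k - 1\<close>, unpaired so
            far, is paired with \<open>k\<close>, and \<open>k + 1\<close> becomes the unpaired
            one.\<close>
          case F: False
          then have h: "2 * ((k + 1) div 2) = k + 1" by simp
          obtain j where j: "k = 2 * j + 1" using F oddE by blast
          have "(\<Sum>i<(k + 1) div 2. if 2 * i + 1 < n then x (2 * i) + x (2 * i + 1) else x (2 * i)) =
            (\<Sum>i<(k + 1) div 2. if 2 * i + 1 < k then x (2 * i) + x (2 * i + 1) else x (2 * i)) + x k"
            unfolding j k by simp
          then show ?thesis using 1 k h by simp
        qed
        finally show ?thesis .
      qed
    qed
    have "red (+) n x = red (+) ((n + 1) div 2) ?x"
      using less.prems False by (subst red.simps) simp
    also have "\<dots> = (\<Sum>i<(n + 1) div 2. ?x i)" using less.prems False by (intro less.IH) auto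
    finally show ?thesis using * by simp
  qed
qed

lemma red_max: "1 \<le> n \<Longrightarrow> red max n x = Max (x ` {..<n})"
proof (induction n arbitrary: x rule: less_induct)
  case (less n)
  show ?case
  proof (cases "n = 1")
    case True
    then show ?thesis by (simp add: red.simps lessThan_Suc)
  next
    case False
    let ?x = "\<lambda>i. if 2 * i + 1 < n then max (x (2 * i)) (x (2 * i + 1)) else x (2 * i)"
    have "red max n x = red max ((n + 1) div 2) ?x"
      using less.prems False by (subst red.simps) simp
    also have "\<dots> = Max (?x ` {..<(n + 1) div 2})" using less.prems False by (intro less.IH) auto
    also have "\<dots> = Max (x ` {..<n})"
    proof (rule antisym)
      have "0 \<in> {..<n}" "0 \<in> {..<(n + 1) div 2}" using less.prems by auto
      then have ne: "{..<n} \<noteq> {}" "{..<(n + 1) div 2} \<noteq> {}" by blast+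
      show "Max (?x ` {..<(n + 1) div 2}) \<le> Max (x ` {..<n})"
        using ne by (subst Max_le_iff) (auto intro!: Max_ge simp: max_def)
      have "x i \<le> Max (?x ` {..<(n + 1) div 2})" if "i < n" for i
      proof -
        have "x i \<le> ?x (i div 2)"
        proof (cases "even i")
          case True then show ?thesis by auto
        next
          case False
          then have "2 * (i div 2) + 1 = i" by simp
          then show ?thesis using that by (metis max.cobounded2)
        qed
        also have "\<dots> \<le> Max (?x ` {..<(n + 1) div 2})" using that by (intro Max_ge) auto
        finally show ?thesis .
      qed
      then show "Max (x ` {..<n}) \<le> Max (?x ` {..<(n + 1) div 2})"
        using ne by (subst Max_le_iff) auto
    qed
    finally show ?thesis .
  qed
qed

definition "sum_e = red_e (radd x0 x1)"
definition "max_e = red_e (Cond (rless x0 x1) x1 x0)"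

lemma cost_sum: "n \<le> 2 ^ g \<Longrightarrow> cost (rv n x # env) sum_e (VReal (\<Sum>i<n. x i)) (200 * n + 20) (100 * (g + 1) + 20)"
proof -
  assume n: "n \<le> 2 ^ g"
  have "cost (rv n x # env) sum_e (VReal (if n = 0 then 0 else red (+) n x))
      (200 * n + 20) (100 * (g + 1) + 20)"
    unfolding sum_e_def by (rule cost_red[OF cost_flat' n]) simp_all
  then show ?thesis using red_add[of n x] by (cases n) auto
qed

lemma cost_max: "n \<le> 2 ^ g \<Longrightarrow> cost (rv n x # env) max_e
   (VReal (if n = 0 then 0 else Max (x ` {..<n}))) (200 * n + 20) (100 * (g + 1) + 20)"
proof -
  assume n: "n \<le> 2 ^ g"
  have "cost (rv n x # env) max_e (VReal (if n = 0 then 0 else red max n x))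
      (200 * n + 20) (100 * (g + 1) + 20)"
    unfolding max_e_def by (rule cost_red[OF cost_flat' n]) simp_all
  then show ?thesis using red_max[of n x] by (cases n) auto
qed

section \<open>Signs with a small quadratic form\<close>

lemma half_eq_less: "(a::nat) < b \<Longrightarrow> a div 2 = b div 2 \<Longrightarrow> odd b \<and> a = b - 1"
  by presburger

lemma half_eq_odd_even:
  "(a::nat) div 2 = b div 2 \<and> odd a \<and> even b \<longleftrightarrow> odd a \<and> b = a - 1"
  by presburger

text \<open>Sibling groups \<open>2q\<close> and \<open>2q + 1\<close> merge, and the odd one is
  multiplied by \<open>\<rho>\<close>. Products within a group keep their value since
  \<open>\<rho>\<close> squares to 1; products across siblings, in either order, acquire one factor
  \<open>\<rho>\<close>.\<close>

lemma signed_pair_split: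
  fixes x y \<rho> :: real and a b :: nat
  assumes "\<rho> * \<rho> = 1"
  shows "(if a = b then x * y else 0) +
      \<rho> * (if a div 2 = b div 2 \<and> odd a \<and> even b then x * y else 0) +
      \<rho> * (if b div 2 = a div 2 \<and> odd b \<and> even a then y * x else 0) =
    (if a div 2 = b div 2 then
       x * (if odd a then \<rho> else 1) * (y * (if odd b then \<rho> else 1)) else 0)"
proof (cases "a div 2 = b div 2")
  case True
  have "a = b \<longleftrightarrow> odd a = odd b" using True by presburger
  moreover have "x * \<rho> * (y * \<rho>) = x * y" using assms by (simp add: algebra_simps)
  ultimately show ?thesis using True by (cases "odd a"; cases "odd b") simp_all
next
  case False
  then have "a \<noteq> b" by auto
  then show ?thesis using False by simp
qed

section \<open>Groups of columns within a sorted row\<close>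

context
  fixes l :: nat and col :: "nat \<Rightarrow> nat"
begin

definition grp :: "nat \<Rightarrow> nat \<Rightarrow> nat" where
  "grp lv t = col t div 2 ^ lv"

definition grp_start :: "nat \<Rightarrow> nat \<Rightarrow> nat" where
  "grp_start lv t = card {t'. t' < l \<and> grp lv t' < grp lv t}"

definition grp_prefix :: "nat \<Rightarrow> (nat \<Rightarrow> real) \<Rightarrow> nat \<Rightarrow> real" where
  "grp_prefix lv v t = (\<Sum>t' | t' \<le> t \<and> grp lv t' = grp lv t. v t')"

definition has_left :: "nat \<Rightarrow> nat \<Rightarrow> bool" where
  "has_left lv t \<longleftrightarrow> grp_start lv t > 0 \<and> grp (Suc lv) (grp_start lv t - 1) = grp (Suc lv) t"

text \<open>This is the conditional expectation of the squared row sum when the seed bits below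
  level \<open>lv\<close> are fixed and the others are independent random signs: the product of the
  open signs of two entries has mean 1 if their remaining column bits agree, and mean 0
  otherwise.\<close>

definition grp_pot :: "nat \<Rightarrow> (nat \<Rightarrow> real) \<Rightarrow> real" where
  "grp_pot lv v = (\<Sum>t<l. \<Sum>t'<l. if grp lv t = grp lv t' then v t * v t' else 0)"

text \<open>Half of the coefficient of the next seed bit in that expectation, arranged so that one
  pass over the row with stored prefix sums evaluates it.\<close>

definition grp_cross :: "nat \<Rightarrow> (nat \<Rightarrow> real) \<Rightarrow> real" where
  "grp_cross lv v = (\<Sum>t<l. if has_left lv t then v t * grp_prefix lv v (grp_start lv t - 1) else 0)"

lemma grp_Suc: "grp (Suc lv) t = grp lv t div 2"
  unfolding grp_def using div_mult2_eq[of "col t" "2 ^ lv" 2] by (simp add: mult.commute)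

end

context
  fixes l :: nat and col :: "nat \<Rightarrow> nat"
  assumes col_less: "\<And>t t'. t < t' \<Longrightarrow> t' < l \<Longrightarrow> col t < col t'"
begin

lemma grp_mono: "t \<le> t' \<Longrightarrow> t' < l \<Longrightarrow> grp col lv t \<le> grp col lv t'"
  unfolding grp_def using col_less[of t t'] by (intro div_le_mono) (cases "t = t'"; simp)

text \<open>Groups are monotone along a sorted row, so the entries of smaller groups form an initial
  segment, and its cardinality is the position where it ends.\<close>

lemma grp_start_iff:
  assumes "t < l" "t' < l"
  shows "grp col lv t' < grp col lv t \<longleftrightarrow> t' < grp_start l col lv t"
proof -
  let ?A = "{t'. t' < l \<and> grp col lv t' < grp col lv t}"
  have fin: "finite ?A" by simp
  have down: "b \<in> ?A \<Longrightarrow> a \<le> b \<Longrightarrow> a \<in> ?A" for a b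
    using grp_mono[of a b lv] by auto
  have "?A = {..<card ?A}"
  proof (cases "?A = {}")
    case False
    then have M: "Max ?A \<in> ?A" using fin by (intro Max_in) auto
    have "?A = {..Max ?A}"
    proof (intro equalityI subsetI)
      fix a assume "a \<in> ?A" then show "a \<in> {..Max ?A}" using Max_ge[OF fin] by blast
    next
      fix a assume "a \<in> {..Max ?A}" then show "a \<in> ?A" using down[OF M] by blast
    qed
    then show ?thesis by (metis card_atMost lessThan_Suc_atMost)
  next
    case True
    then show ?thesis by (metis card.empty lessThan_0)
  qed
  then show ?thesis unfolding grp_start_def using assms(2) by blast
qed

lemma grp_start_le: "t < l \<Longrightarrow> grp_start l col lv t \<le> t"
  using grp_start_iff[of t t lv] by simp

text \<open>The group just before the start is the next smaller one present in the row. Either it is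
  the left sibling, and the merged group starts where that one starts, or no entry before the start
  belongs to the merged group.\<close>

lemma grp_start_Suc:
  assumes t: "t < l"
  shows "grp_start l col (Suc lv) t =
    (if has_left l col lv t then grp_start l col lv (grp_start l col lv t - 1) else grp_start l col lv t)"
proof -
  let ?u = "grp_start l col lv t"
  have "{t'. t' < l \<and> grp col (Suc lv) t' < grp col (Suc lv) t} =
    {t'. t' < l \<and> grp col lv t' < (if has_left l col lv t then grp col lv (?u - 1) else grp col lv t)}"
  proof (cases "has_left l col lv t")
    case True
    then have u: "?u > 0" "grp col lv (?u - 1) div 2 = grp col lv t div 2"
      by (auto simp: has_left_def grp_Suc)
    then have "grp col lv (?u - 1) < grp col lv t"
      using grp_start_iff[OF t, of "?u - 1" lv] grp_start_le[OF t, of lv] t by simp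
    with u(2) have "grp col lv (?u - 1) = 2 * (grp col lv t div 2)" by linarith
    then show ?thesis using True by (auto simp: grp_Suc)
  next
    case False
    have "grp col lv t' div 2 < grp col lv t div 2" if "t' < l" "grp col lv t' < grp col lv t" for t'
    proof -
      have u: "t' < ?u" using that grp_start_iff[OF t that(1)] by simp
      then have ul: "?u - 1 < l" "t' \<le> ?u - 1" "?u - 1 \<le> t" "?u > 0"
        using grp_start_le[OF t, of lv] t by auto
      have "grp col (Suc lv) t' \<le> grp col (Suc lv) (?u - 1)" using grp_mono[OF ul(2,1)] .
      moreover have "grp col (Suc lv) (?u - 1) \<le> grp col (Suc lv) t" using grp_mono[OF ul(3) t] .
      moreover have "grp col (Suc lv) (?u - 1) \<noteq> grp col (Suc lv) t" using False ul(4) by (simp add: has_left_def)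
      ultimately show ?thesis by (simp add: grp_Suc)
    qed
    moreover have "grp col lv t' < grp col lv t" if "grp col lv t' div 2 < grp col lv t div 2" for t'
      using that by (meson div_le_mono leD leI)
    ultimately show ?thesis using False by (auto simp: grp_Suc)
  qed
  then show ?thesis by (auto simp: grp_start_def)
qed

text \<open>\<open>has_left\<close> inspects only the entry before the start of the group, which a
  program can do in constant time; the right-hand side is the meaning needed in the
  analysis.\<close>

lemma has_left_iff:
  assumes t: "t < l"
  shows "has_left l col lv t \<longleftrightarrow> odd (grp col lv t) \<and> (\<exists>t'<l. grp col lv t' = grp col lv t - 1)"
proof
  let ?u = "grp_start l col lv t"
  assume h: "has_left l col lv t"
  then have u: "?u > 0" "grp col lv (?u - 1) div 2 = grp col lv t div 2"
    by (auto simp: has_left_def grp_Suc)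
  moreover have ul: "?u - 1 < l" using grp_start_le[OF t, of lv] t by simp
  ultimately have "grp col lv (?u - 1) < grp col lv t"
    using grp_start_iff[OF t, of "?u - 1" lv] by simp
  with u(2) have "odd (grp col lv t)" "grp col lv (?u - 1) = grp col lv t - 1" using half_eq_less by blast+
  then show "odd (grp col lv t) \<and> (\<exists>t'<l. grp col lv t' = grp col lv t - 1)" using ul by blast
next
  let ?u = "grp_start l col lv t"
  assume "odd (grp col lv t) \<and> (\<exists>t'<l. grp col lv t' = grp col lv t - 1)"
  then obtain t' where t': "t' < l" "grp col lv t' = grp col lv t - 1" "odd (grp col lv t)" by blast
  then have "grp col lv t' < grp col lv t" using odd_pos by fastforce
  then have u: "t' < ?u" using grp_start_iff[OF t t'(1)] by simp
  then have ul: "?u - 1 < l" "t' \<le> ?u - 1" "?u - 1 \<le> t" "?u > 0"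
    using grp_start_le[OF t, of lv] t by auto
  have "grp col (Suc lv) t' \<le> grp col (Suc lv) (?u - 1)" using grp_mono[OF ul(2,1)] .
  moreover have "grp col (Suc lv) (?u - 1) \<le> grp col (Suc lv) t" using grp_mono[OF ul(3) t] .
  moreover have "grp col (Suc lv) t' = grp col (Suc lv) t" using t'(2,3) by (auto simp: grp_Suc elim: oddE)
  ultimately show "has_left l col lv t" using ul(4) by (simp add: has_left_def)
qed

lemma grp_prefix_left:
  assumes t: "t < l" and h: "has_left l col lv t"
  shows "grp_prefix col lv v (grp_start l col lv t - 1) = (\<Sum>t' | t' < l \<and> grp col lv t' = grp col lv t - 1. v t')"
    and "grp col lv (grp_start l col lv t - 1) = grp col lv t - 1" "odd (grp col lv t)"
proof -
  let ?u = "grp_start l col lv t"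
  have u: "?u > 0" "grp col lv (?u - 1) div 2 = grp col lv t div 2"
    using h by (auto simp: has_left_def grp_Suc)
  have ul: "?u - 1 < l" using grp_start_le[OF t, of lv] t by simp
  have "grp col lv (?u - 1) < grp col lv t"
    using grp_start_iff[OF t ul, of lv] u by simp
  with u(2) show e: "grp col lv (?u - 1) = grp col lv t - 1" and o: "odd (grp col lv t)" using half_eq_less by blast+
  have "{t'. t' \<le> ?u - 1 \<and> grp col lv t' = grp col lv (?u - 1)} = {t'. t' < l \<and> grp col lv t' = grp col lv t - 1}"
  proof -
    have "t' \<le> ?u - 1" if "t' < l" "grp col lv t' = grp col lv t - 1" for t'
    proof -
      have "grp col lv t' < grp col lv t" using that o odd_pos by fastforce
      then have "t' < ?u" using grp_start_iff[OF t that(1)] by simp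
      then show ?thesis by simp
    qed
    then show ?thesis using ul e by auto
  qed
  then show "grp_prefix col lv v (?u - 1) = (\<Sum>t' | t' < l \<and> grp col lv t' = grp col lv t - 1. v t')"
    by (simp add: grp_prefix_def)
qed

text \<open>Up to \<open>t\<close>, the merged group consists of the complete left sibling, whose
  number is even and which therefore keeps its signs, followed by the part of the own group, scaled
  by \<open>\<rho>\<close> if its number is odd.\<close>

lemma grp_prefix_Suc:
  assumes t: "t < l"
  shows "grp_prefix col (Suc lv) (\<lambda>t. v t * (if odd (grp col lv t) then \<rho> else 1)) t =
    (if has_left l col lv t then grp_prefix col lv v (grp_start l col lv t - 1) else 0) +
    grp_prefix col lv v t * (if odd (grp col lv t) then \<rho> else 1)"
proof -
  have fin: "finite {t'. t' \<le> t \<and> Q t'}" for Q by simp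
  let ?w = "\<lambda>t. v t * (if odd (grp col lv t) then \<rho> else 1)"
  let ?A = "{t'. t' \<le> t \<and> grp col (Suc lv) t' = grp col (Suc lv) t \<and> grp col lv t' \<noteq> grp col lv t}"
  have "{t'. t' \<le> t \<and> grp col (Suc lv) t' = grp col (Suc lv) t} =
    ?A \<union> {t'. t' \<le> t \<and> grp col lv t' = grp col lv t}" by (auto simp: grp_Suc)
  then have "grp_prefix col (Suc lv) ?w t = sum ?w (?A \<union> {t'. t' \<le> t \<and> grp col lv t' = grp col lv t})"
    by (simp add: grp_prefix_def)
  also have "\<dots> = sum ?w ?A + sum ?w {t'. t' \<le> t \<and> grp col lv t' = grp col lv t}"
    by (rule sum.union_disjoint) auto
  also have "sum ?w {t'. t' \<le> t \<and> grp col lv t' = grp col lv t} =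
      grp_prefix col lv v t * (if odd (grp col lv t) then \<rho> else 1)"
    unfolding grp_prefix_def sum_distrib_right by (rule sum.cong) auto
  also have "sum ?w ?A = (if has_left l col lv t then grp_prefix col lv v (grp_start l col lv t - 1) else 0)"
  proof -
    have A: "?A = {t'. t' < l \<and> odd (grp col lv t) \<and> grp col lv t' = grp col lv t - 1}"
    proof -
      have "odd (grp col lv t) \<and> grp col lv t' = grp col lv t - 1"
        if "t' \<le> t" "grp col lv t' div 2 = grp col lv t div 2" "grp col lv t' \<noteq> grp col lv t" for t'
        using grp_mono[OF that(1) t, of lv] that(2,3) half_eq_less[of "grp col lv t'" "grp col lv t"] by simp
      moreover have "t' \<le> t \<and> grp col lv t' div 2 = grp col lv t div 2 \<and> grp col lv t' \<noteq> grp col lv t"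
        if "t' < l" "odd (grp col lv t)" "grp col lv t' = grp col lv t - 1" for t'
      proof -
        have "\<not> grp col lv t \<le> grp col lv t'" using that odd_pos by fastforce
        then have "t' \<le> t" using grp_mono[of t t' lv] that(1) by linarith
        then show ?thesis using that by (auto elim: oddE)
      qed
      moreover have "t' < l" if "t' \<le> t" for t' using that t by simp
      ultimately show ?thesis unfolding grp_Suc by (intro Collect_cong) blast
    qed
    show ?thesis
    proof (cases "has_left l col lv t")
      case True
      note h = grp_prefix_left[OF t True]
      have "sum ?w ?A = sum v {t'. t' < l \<and> grp col lv t' = grp col lv t - 1}"
        unfolding A using h(3) by (intro sum.cong) auto
      then show ?thesis using True h(1)[of v] by simp
    next
      case False
      then have "?A = {}" unfolding A using has_left_iff[OF t] by blast
      then show ?thesis using False by (simp only: sum.empty if_False)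
    qed
  qed
  finally show ?thesis .
qed

lemma grp_cross_eq:
  "grp_cross l col lv v = (\<Sum>t<l. \<Sum>t'<l. if grp col (Suc lv) t = grp col (Suc lv) t' \<and> odd (grp col lv t) \<and> even (grp col lv t')
     then v t * v t' else 0)"
  unfolding grp_cross_def
proof (rule sum.cong[OF refl])
  fix t assume "t \<in> {..<l}"
  then have t: "t < l" by simp
  have *: "grp col (Suc lv) t = grp col (Suc lv) t' \<and> odd (grp col lv t) \<and> even (grp col lv t')
    \<longleftrightarrow> odd (grp col lv t) \<and> grp col lv t' = grp col lv t - 1" for t'
    unfolding grp_Suc using half_eq_odd_even[of "grp col lv t" "grp col lv t'"] by blast
  have s: "(\<Sum>t'<l. if P t' then v t * v t' else 0) = v t * (\<Sum>t' | t' < l \<and> P t'. v t')" for P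
  proof -
    have "(\<Sum>t'<l. if P t' then v t * v t' else 0) = (\<Sum>t' | t' < l \<and> P t'. v t * v t')"
      by (rule sum.mono_neutral_cong_right) auto
    then show ?thesis by (simp add: sum_distrib_left)
  qed
  show "(if has_left l col lv t then v t * grp_prefix col lv v (grp_start l col lv t - 1) else 0) =
    (\<Sum>t'<l. if grp col (Suc lv) t = grp col (Suc lv) t' \<and> odd (grp col lv t) \<and> even (grp col lv t')
       then v t * v t' else 0)"
  proof (cases "has_left l col lv t")
    case True
    then show ?thesis unfolding * s using grp_prefix_left[OF t True] by simp
  next
    case False
    then have "{t'. t' < l \<and> odd (grp col lv t) \<and> grp col lv t' = grp col lv t - 1} = {}"
      using has_left_iff[OF t] by blast
    then show ?thesis unfolding * s by (simp only: False if_False sum.empty mult_zero_right)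
  qed
qed

text \<open>The conditional expectation is affine in the next seed bit, so at least one of the two
  values does not increase it.\<close>

lemma grp_pot_Suc:
  assumes "\<rho> * \<rho> = 1"
  shows "grp_pot l col (Suc lv) (\<lambda>t. v t * (if odd (grp col lv t) then \<rho> else 1)) =
    grp_pot l col lv v + 2 * \<rho> * grp_cross l col lv v"
proof -
  let ?c = "\<lambda>t t'. if grp col (Suc lv) t = grp col (Suc lv) t' \<and> odd (grp col lv t) \<and> even (grp col lv t')
     then v t * v t' else 0"
  have 1: "grp_cross l col lv v = (\<Sum>t<l. \<Sum>t'<l. ?c t' t)"
    unfolding grp_cross_eq by (rule sum.swap)
  have "2 * \<rho> * grp_cross l col lv v = \<rho> * (\<Sum>t<l. \<Sum>t'<l. ?c t t') + \<rho> * (\<Sum>t<l. \<Sum>t'<l. ?c t' t)"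
    using 1 grp_cross_eq[of lv v] by simp
  then have "grp_pot l col lv v + 2 * \<rho> * grp_cross l col lv v =
    (\<Sum>t<l. \<Sum>t'<l. (if grp col lv t = grp col lv t' then v t * v t' else 0) + \<rho> * ?c t t' + \<rho> * ?c t' t)"
    by (simp add: grp_pot_def sum.distrib sum_distrib_left)
  also have "\<dots> = grp_pot l col (Suc lv) (\<lambda>t. v t * (if odd (grp col lv t) then \<rho> else 1))"
    unfolding grp_pot_def
  proof (intro sum.cong refl)
    fix t t'
    show "(if grp col lv t = grp col lv t' then v t * v t' else 0) + \<rho> * ?c t t' + \<rho> * ?c t' t =
      (if grp col (Suc lv) t = grp col (Suc lv) t' then v t * (if odd (grp col lv t) then \<rho> else 1) *
        (v t' * (if odd (grp col lv t') then \<rho> else 1)) else 0)"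
      unfolding grp_Suc by (rule signed_pair_split[OF assms])
  qed
  finally show ?thesis by simp
qed

text \<open>Columns within a row are distinct, so at level 0 every group is a single entry and only
  the diagonal remains. This is where pairwise independence reduces the second moment to the
  variance.\<close>

lemma grp_pot_0: "grp_pot l col 0 v = (\<Sum>t<l. (v t)\<^sup>2)"
proof -
  have "col t = col t' \<longleftrightarrow> t = t'" if "t < l" "t' < l" for t t'
    using col_less[OF _ that(1), of t'] col_less[OF _ that(2), of t] linorder_less_linear[of t t']
    by (metis less_irrefl)
  then have "grp_pot l col 0 v = (\<Sum>t<l. \<Sum>t'<l. if t = t' then v t * v t' else 0)"
    unfolding grp_pot_def grp_def by (intro sum.cong) auto
  then show ?thesis by (simp add: power2_eq_square)
qed

lemma grp_pot_top:
  assumes "\<And>t. t < l \<Longrightarrow> col t < 2 ^ lv"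
  shows "grp_pot l col lv v = (\<Sum>t<l. v t)\<^sup>2"
proof -
  have "grp_pot l col lv v = (\<Sum>t<l. \<Sum>t'<l. v t * v t')"
    unfolding grp_pot_def grp_def using assms by (intro sum.cong) auto
  then show ?thesis by (simp add: power2_eq_square sum_product)
qed

lemma grp_start_0: "t < l \<Longrightarrow> grp_start l col 0 t = t"
proof -
  assume t: "t < l"
  have "{t'. t' < l \<and> col t' < col t} = {..<t}"
  proof (intro equalityI subsetI)
    fix t' assume "t' \<in> {t'. t' < l \<and> col t' < col t}"
    then show "t' \<in> {..<t}" using col_less[of t t'] linorder_less_linear[of t t'] by (metis lessThan_iff less_asym mem_Collect_eq)
  next
    fix t' assume "t' \<in> {..<t}"
    then show "t' \<in> {t'. t' < l \<and> col t' < col t}" using col_less[OF _ t, of t'] t by simp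
  qed
  then show ?thesis by (simp add: grp_start_def grp_def)
qed

lemma grp_prefix_0: "t < l \<Longrightarrow> grp_prefix col 0 v t = v t"
proof -
  assume t: "t < l"
  have "{t'. t' \<le> t \<and> col t' = col t} = {t}"
  proof (intro equalityI subsetI)
    fix t' assume "t' \<in> {t'. t' \<le> t \<and> col t' = col t}"
    then show "t' \<in> {t}" using col_less[OF _ t, of t'] by (cases "t' = t") simp_all
  qed simp
  then show ?thesis by (simp add: grp_prefix_def grp_def)
qed

end

definition enc_rows where
  "enc_rows R l cl \<beta> \<omega> =
     tab R (\<lambda>r. vpair (tab (l r) (\<lambda>t. vpair (VNat (cl r t)) (VReal (\<beta> r t)))) (VReal (\<omega> r)))"

text \<open>
  After \<open>lv\<close> levels the columns are grouped by their leading bits and only one global sign per group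
  is still open. Rows are sorted by column, so the groups of a row are contiguous and no
  compaction is needed: every entry keeps the start of its group and the running sum from there.
  The entry before the start is the last one of the preceding group and hence knows its full sum.
\<close>

definition lv_state where
  "lv_state R n l cl \<beta> lv s = vpair (vpair
     (tab R (\<lambda>r. tab (l r) (\<lambda>t. vpair (VNat (grp_start (l r) (cl r) lv t))
        (VReal (grp_prefix (cl r) lv (\<lambda>t. \<beta> r t * s (cl r t)) t)))))
     (rv n s)) (tab n (\<lambda>j. VNat (j div 2 ^ lv)))"

definition lv_cross where
  "lv_cross R l cl \<beta> \<omega> lv s = (\<Sum>r<R. \<omega> r * grp_cross (l r) (cl r) lv (\<lambda>t. \<beta> r t * s (cl r t)))"

text \<open>
  The final signs are \<open>s\<^sub>j = r \<cdot> (\<Prod>b. r\<^sub>b)\<close> over the set bits \<open>b\<close> of \<open>j\<close>, where \<open>r\<^sub>b\<close> is chosen against the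
  mixed terms of sibling groups. For random \<open>r\<^sub>b\<close> this family is pairwise independent.
\<close>

definition lv_next where
  "lv_next R l cl \<beta> \<omega> lv s j =
     s j * (if odd (j div 2 ^ lv) then if 0 < lv_cross R l cl \<beta> \<omega> lv s then -1 else 1 else 1)"

primrec lv_sign where
  "lv_sign R l cl \<beta> \<omega> 0 = (\<lambda>_. 1)"
| "lv_sign R l cl \<beta> \<omega> (Suc lv) = lv_next R l cl \<beta> \<omega> lv (lv_sign R l cl \<beta> \<omega> lv)"

definition row_dot :: "nat \<Rightarrow> (nat \<Rightarrow> nat) \<Rightarrow> (nat \<Rightarrow> real) \<Rightarrow> (nat \<Rightarrow> real) \<Rightarrow> real" where
  "row_dot l cl \<beta> s = (\<Sum>t<l. \<beta> t * s (cl t))"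

text \<open>The vector \<open>c\<close> is a linear form on the columns; the walk inserts the moves
  of the column potentials. Negation is written as subtraction from 0 because that is what the
  program computes.\<close>

definition signs where
  "signs R n l cl \<beta> \<omega> c G j = (let s = lv_sign R l cl \<beta> \<omega> G in
     if 0 < (\<Sum>r<R. \<omega> r * row_dot (l r) (cl r) (\<beta> r) s) + (\<Sum>j<n. c j * s j) then 0 - s j else s j)"

lemma lv_sign_pm: "lv_sign R l cl \<beta> \<omega> lv j \<in> {1, -1}"
  by (induction lv arbitrary: j) (auto simp: lv_next_def)

lemma signs_pm: "signs R n l cl \<beta> \<omega> c G j \<in> {1, -1}"
  using lv_sign_pm[of R l cl \<beta> \<omega> G j] by (auto simp: signs_def Let_def)

text \<open>Through the \<open>G\<close> levels the weighted quadratic form never increases; it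
  starts as its diagonal and ends as the weighted squares of the row sums. The global sign keeps the
  squares and makes the linear part nonpositive. The bound is what independent random signs achieve
  on average.\<close>

lemma signs_bound:
  fixes \<beta> :: "nat \<Rightarrow> nat \<Rightarrow> real" and \<omega> c :: "nat \<Rightarrow> real" and n :: nat
  assumes cl: "\<And>r t t'. r < R \<Longrightarrow> t < t' \<Longrightarrow> t' < l r \<Longrightarrow> cl r t < cl r t'"
    and G: "\<And>r t. r < R \<Longrightarrow> t < l r \<Longrightarrow> cl r t < 2 ^ G"
  defines "s \<equiv> signs R n l cl \<beta> \<omega> c G"
  shows "(\<Sum>r<R. \<omega> r * ((row_dot (l r) (cl r) (\<beta> r) s)\<^sup>2 + row_dot (l r) (cl r) (\<beta> r) s))
      + (\<Sum>j<n. c j * s j) \<le> (\<Sum>r<R. \<omega> r * (\<Sum>t<l r. (\<beta> r t)\<^sup>2))"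
proof -
  define u where "u = lv_sign R l cl \<beta> \<omega>"
  define pot where "pot lv = (\<Sum>r<R. \<omega> r * grp_pot (l r) (cl r) lv (\<lambda>t. \<beta> r t * u lv (cl r t)))" for lv
  have u: "u lv j \<in> {1, -1}" for lv j unfolding u_def by (rule lv_sign_pm)
  have dec: "pot (Suc lv) \<le> pot lv" for lv
  proof -
    \<comment> \<open>One seed bit is shared by all rows, so it is chosen against the weighted sum
      of their mixed terms.\<close>
    define \<rho> :: real where "\<rho> = (if 0 < lv_cross R l cl \<beta> \<omega> lv (u lv) then -1 else 1)"
    have \<rho>: "\<rho> * \<rho> = 1" by (simp add: \<rho>_def)
    have "u (Suc lv) j = u lv j * (if odd (j div 2 ^ lv) then \<rho> else 1)" for j
      by (simp add: u_def lv_next_def \<rho>_def)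
    then have "pot (Suc lv) = (\<Sum>r<R. \<omega> r * grp_pot (l r) (cl r) (Suc lv)
       (\<lambda>t. \<beta> r t * u lv (cl r t) * (if odd (grp (cl r) lv t) then \<rho> else 1)))"
      by (simp add: pot_def grp_def mult.assoc)
    also have "\<dots> = (\<Sum>r<R. \<omega> r * (grp_pot (l r) (cl r) lv (\<lambda>t. \<beta> r t * u lv (cl r t))
       + 2 * \<rho> * grp_cross (l r) (cl r) lv (\<lambda>t. \<beta> r t * u lv (cl r t))))"
      by (intro sum.cong refl arg_cong2[where f = "(*)"] grp_pot_Suc[OF _ \<rho>] cl) auto
    also have "\<dots> = pot lv + 2 * (\<rho> * lv_cross R l cl \<beta> \<omega> lv (u lv))"
      by (simp add: pot_def lv_cross_def sum.distrib sum_distrib_left algebra_simps)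
    also have "\<rho> * lv_cross R l cl \<beta> \<omega> lv (u lv) \<le> 0" by (simp add: \<rho>_def)
    finally show ?thesis by simp
  qed
  have "pot lv \<le> pot 0" for lv by (rule lift_Suc_antimono_le[of pot, OF dec]) simp
  from this[of G] have "pot G \<le> pot 0" .
  also have "pot 0 = (\<Sum>r<R. \<omega> r * (\<Sum>t<l r. (\<beta> r t)\<^sup>2))"
    unfolding pot_def by (intro sum.cong refl arg_cong2[where f = "(*)"], subst grp_pot_0[OF cl])
      (auto simp: u_def)
  finally have 1: "pot G \<le> (\<Sum>r<R. \<omega> r * (\<Sum>t<l r. (\<beta> r t)\<^sup>2))" .
  have 2: "pot G = (\<Sum>r<R. \<omega> r * (row_dot (l r) (cl r) (\<beta> r) (u G))\<^sup>2)"
    unfolding pot_def row_dot_def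
    by (intro sum.cong refl arg_cong2[where f = "(*)"] grp_pot_top cl G) auto
  define b where "b \<longleftrightarrow> 0 < (\<Sum>r<R. \<omega> r * row_dot (l r) (cl r) (\<beta> r) (u G)) + (\<Sum>j<n. c j * u G j)"
  have s: "s = (\<lambda>j. (if b then -1 else 1) * u G j)"
    by (rule ext) (simp add: s_def signs_def u_def b_def Let_def)
  have r: "row_dot (l r) (cl r) (\<beta> r) s = (if b then -1 else 1) * row_dot (l r) (cl r) (\<beta> r) (u G)" for r
    by (simp add: row_dot_def s sum_negf)
  have "(\<Sum>r<R. \<omega> r * ((row_dot (l r) (cl r) (\<beta> r) s)\<^sup>2 + row_dot (l r) (cl r) (\<beta> r) s)) + (\<Sum>j<n. c j * s j)
    = pot G + (if b then -1 else 1) * ((\<Sum>r<R. \<omega> r * row_dot (l r) (cl r) (\<beta> r) (u G)) + (\<Sum>j<n. c j * u G j))"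
    unfolding r 2 by (simp add: s sum.distrib sum_negf distrib_left)
  also have "\<dots> \<le> pot G" by (simp add: b_def)
  finally show ?thesis using 1 by simp
qed

section \<open>Work and depth of the sign selection\<close>

definition row_size :: "nat \<Rightarrow> (nat \<Rightarrow> nat) \<Rightarrow> nat" where
  "row_size R l = (\<Sum>r<R. l r + 1)"

lemma sum_row_size: "(\<Sum>r<R. a * (l r + 1)) = a * row_size R l"
  unfolding row_size_def sum_distrib_left ..

lemma row_size_ge: "R \<le> row_size R l"
proof -
  have "(\<Sum>r<R. 1) \<le> (\<Sum>r<R. l r + 1)" by (rule sum_mono) simp
  then show ?thesis by (simp add: row_size_def)
qed

text \<open>Parity is not a primitive of the language; a bit has to be read with halving, addition
  and comparison.\<close>

lemma odd_iff_half: "m div 2 + m div 2 < m \<longleftrightarrow> odd m" for m :: nat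
  by presburger

text \<open>The guard on \<open>u\<close> excludes a group at the beginning of the row, where
  truncated subtraction would compare entry 0 with its own group.\<close>

definition left_e :: "expr \<Rightarrow> expr \<Rightarrow> expr \<Rightarrow> expr \<Rightarrow> expr" where
  "left_e u re c Jd = Cond u
     (Cond (nless (Op1 Half (idx Jd (fst_e (idx re (nsub u (Lit 1))))))
                      (Op1 Half (idx Jd c))) (Lit 0) (Lit 1)) (Lit 0)"

abbreviation "odd_e e \<equiv> nless (nadd (Op1 Half e) (Op1 Half e)) e"

text \<open>Variables on entry: 0 the entry, 1 the row, 2 the group numbers of the columns, 3 the
  signs, 4 the segmented rows, 5 the state, 6 the loop pair, 7 the encoded rows.\<close>

definition cross_body :: expr where
  "cross_body =
     Bind (idx (idx x4 x1) x0)
    (Bind (fst_e (idx x8 x2))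
    (Bind (fst_e (idx x0 x2))
    (Cond (left_e (fst_e x2) x1 x0 x5)
       (rmul (rmul (snd_e (idx x1 x3)) (idx x6 x0))
          (snd_e (idx (idx x7 x4) (nsub (fst_e x2) (Lit 1)))))
       (rlit 0))))"

definition cross_e :: expr where
  "cross_e = Bind (Tabulate (len x5) (rmul (snd_e (idx x6 x0))
      (Bind (Tabulate (len (idx x3 x0)) cross_body) sum_e))) sum_e"

text \<open>The environment is that of \<open>cross_body\<close> with the chosen sign and the total
  of the mixed terms inserted as variables 2 and 3.\<close>

definition upd_body :: expr where
  "upd_body =
     Bind (idx (idx x6 x1) x0)
    (Bind (fst_e (idx x10 x2))
    (Bind (fst_e (idx x0 x2))
    (Bind (Cond (odd_e (idx x7 x0)) (rmul (snd_e x2) x5) (snd_e x2))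
    (Cond (left_e (fst_e x3) x2 x1 x8)
       (Bind (idx (idx x10 x5) (nsub (fst_e x3) (Lit 1)))
          (pair_e (fst_e x0) (radd (snd_e x0) x1)))
       (pair_e (fst_e x3) x0)))))"

definition level_e :: expr where
  "level_e =
     Bind (fst_e (fst_e x0))
    (Bind (snd_e (fst_e x1))
    (Bind (snd_e x2)
    (Bind cross_e
    (Bind (Cond (rless (rlit 0) x0) (rsub (rlit 0) (rlit 1)) (rlit 1))
    (pair_e
      (pair_e
        (Tabulate (len x4) (Tabulate (len (idx x5 x0)) upd_body))
        (Tabulate (len x3) (Cond (odd_e (idx x3 x0))
           (rmul (idx x4 x0) x1) (idx x4 x0))))
      (Tabulate (len x2) (Op1 Half (idx x3 x0))))))))"

definition init_e :: expr where
  "init_e = pair_e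
     (pair_e
        (Tabulate (len x0) (Tabulate (len (fst_e (idx x1 x0)))
           (pair_e x0 (snd_e (idx (fst_e (idx x2 x1)) x0)))))
        (Tabulate (len x1) (rlit 1)))
     (Tabulate (len x1) x0)"

definition dot_e :: expr where
  "dot_e = Bind (Tabulate (len x0) (Bind (idx x1 x0)
      (rmul (snd_e x0) (idx x3 (fst_e x0))))) sum_e"

definition signs_e :: expr where
  "signs_e =
     Bind (rep_e x2 init_e level_e)
    (Bind (snd_e (fst_e x0))
    (Bind (Bind (Tabulate (len x2) (rmul (snd_e (idx x3 x0))
       (Bind x1 (Bind (fst_e (idx x4 x1)) dot_e)))) sum_e)
    (Bind (Bind (Tabulate (len x4) (rmul (idx x5 x0) (idx x2 x0))) sum_e)
    (Cond (rless (rlit 0) (radd x1 x0))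
       (Tabulate (len x2) (rsub (rlit 0) (idx x3 x0)))
       x2))))"

abbreviation enc_row :: "nat \<Rightarrow> (nat \<Rightarrow> nat) \<Rightarrow> (nat \<Rightarrow> real) \<Rightarrow> val" where
  "enc_row l cl \<beta> \<equiv> tab l (\<lambda>t. vpair (VNat (cl t)) (VReal (\<beta> t)))"

lemma cost_dot:
  assumes "l \<le> 2 ^ g" "\<And>t. t < l \<Longrightarrow> cl t < n"
  shows "cost (enc_row l cl \<beta> # rv n s # env) dot_e (VReal (row_dot l cl \<beta> s))
    (300 * l + 50) (100 * g + 200)"
  unfolding dot_e_def row_dot_def
proof (rule cost_Bind')
  show "cost (enc_row l cl \<beta> # rv n s # env) (Tabulate (len x0) (Bind (idx x1 x0)
      (rmul (snd_e x0) (idx x3 (fst_e x0))))) (rv l (\<lambda>t. \<beta> t * s (cl t)))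
      (2 + l * 30 + 1) (2 + 30 + 1)"
    by (rule cost_Tabulate_const; rule cost_flat'; use assms in simp)
qed (rule cost_sum[OF assms(1)], simp_all)

context
  fixes R n g :: nat and l :: "nat \<Rightarrow> nat" and cl :: "nat \<Rightarrow> nat \<Rightarrow> nat"
    and \<beta> :: "nat \<Rightarrow> nat \<Rightarrow> real" and \<omega> :: "nat \<Rightarrow> real"
  assumes cl: "\<And>r t t'. r < R \<Longrightarrow> t < t' \<Longrightarrow> t' < l r \<Longrightarrow> cl r t < cl r t'"
    and cl_n: "\<And>r t. r < R \<Longrightarrow> t < l r \<Longrightarrow> cl r t < n"
    and g: "R \<le> 2 ^ g" "n \<le> 2 ^ g" "\<And>r. r < R \<Longrightarrow> l r \<le> 2 ^ g"
begin

text \<open>Naturals are compared by \<open><\<close> only. The preceding entry never lies in a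
  larger group, so not being smaller already means equality.\<close>

lemma left_test:
  assumes "r < R" "t < l r"
  shows "has_left (l r) (cl r) lv t \<longleftrightarrow> 0 < grp_start (l r) (cl r) lv t \<and>
    \<not> cl r (grp_start (l r) (cl r) lv t - 1) div 2 ^ lv div 2 < cl r t div 2 ^ lv div 2"
proof -
  let ?u = "grp_start (l r) (cl r) lv t"
  have "?u \<le> t" by (rule grp_start_le[OF cl]) (use assms in auto)
  then have "grp (cl r) (Suc lv) (?u - 1) \<le> grp (cl r) (Suc lv) t"
    by (intro grp_mono[of "l r", OF cl]) (use assms in auto)
  then show ?thesis unfolding has_left_def grp_Suc by (auto simp: grp_def)
qed

lemma start_less:
  assumes "r < R" "t < l r"
  shows "grp_start (l r) (cl r) lv t < l r"
proof -
  have "grp_start (l r) (cl r) lv t \<le> t" by (rule grp_start_le[OF cl]) (use assms in auto)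
  then show ?thesis using assms by simp
qed

abbreviation "seg_rows lv s \<equiv> tab R (\<lambda>r. tab (l r) (\<lambda>t. vpair (VNat (grp_start (l r) (cl r) lv t))
        (VReal (grp_prefix (cl r) lv (\<lambda>t. \<beta> r t * s (cl r t)) t))))"
abbreviation "grp_cols lv \<equiv> tab n (\<lambda>j. VNat (j div 2 ^ lv))"

lemma cost_cross_body:
  assumes "r < R" "t < l r"
  shows "cost (VNat t # VNat r # grp_cols lv # rv n s # seg_rows lv s # st # x # enc_rows R l cl \<beta> \<omega> # env) cross_body
    (VReal (if has_left (l r) (cl r) lv t then \<beta> r t * s (cl r t) *
       grp_prefix (cl r) lv (\<lambda>t. \<beta> r t * s (cl r t)) (grp_start (l r) (cl r) lv t - 1) else 0)) 100 100"
proof (rule cost_flat')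
  have "grp_start (l r) (cl r) lv t - 1 < l r" using start_less[OF assms, of lv] by simp
  then show "flat_eval (VNat t # VNat r # grp_cols lv # rv n s # seg_rows lv s # st # x # enc_rows R l cl \<beta> \<omega> # env) cross_body =
    Some (VReal (if has_left (l r) (cl r) lv t then \<beta> r t * s (cl r t) *
       grp_prefix (cl r) lv (\<lambda>t. \<beta> r t * s (cl r t)) (grp_start (l r) (cl r) lv t - 1) else 0))"
    using assms cl_n left_test[OF assms, of lv] start_less[OF assms, of lv]
    by (simp add: cross_body_def left_e_def enc_rows_def)
qed (simp_all add: cross_body_def left_e_def)

lemma cost_upd_body:
  assumes "r < R" "t < l r"
  shows "cost (VNat t # VNat r # VReal \<rho> # tot # grp_cols lv # rv n s # seg_rows lv s # st # x # enc_rows R l cl \<beta> \<omega> # env) upd_body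
    (vpair (VNat (grp_start (l r) (cl r) (Suc lv) t)) (VReal (grp_prefix (cl r) (Suc lv)
      (\<lambda>t. \<beta> r t * (s (cl r t) * (if odd (cl r t div 2 ^ lv) then \<rho> else 1))) t))) 150 150"
proof (rule cost_flat')
  note c = cl[OF assms(1)]
  have l: "grp_start (l r) (cl r) lv t - 1 < l r" using start_less[OF assms, of lv] by simp
  have s: "grp_prefix (cl r) (Suc lv)
      (\<lambda>t. \<beta> r t * (s (cl r t) * (if odd (cl r t div 2 ^ lv) then \<rho> else 1))) t =
    (if has_left (l r) (cl r) lv t then grp_prefix (cl r) lv (\<lambda>t. \<beta> r t * s (cl r t)) (grp_start (l r) (cl r) lv t - 1) else 0) +
    grp_prefix (cl r) lv (\<lambda>t. \<beta> r t * s (cl r t)) t * (if odd (cl r t div 2 ^ lv) then \<rho> else 1)"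
    using grp_prefix_Suc[OF c assms(2), where lv = lv and v = "\<lambda>t. \<beta> r t * s (cl r t)" and \<rho> = \<rho>]
    by (simp add: grp_def mult.assoc)
  have st: "grp_start (l r) (cl r) (Suc lv) t = (if has_left (l r) (cl r) lv t
     then grp_start (l r) (cl r) lv (grp_start (l r) (cl r) lv t - 1) else grp_start (l r) (cl r) lv t)"
    by (rule grp_start_Suc[OF c assms(2)])
  show "flat_eval (VNat t # VNat r # VReal \<rho> # tot # grp_cols lv # rv n s # seg_rows lv s # st # x # enc_rows R l cl \<beta> \<omega> # env) upd_body =
    Some (vpair (VNat (grp_start (l r) (cl r) (Suc lv) t)) (VReal (grp_prefix (cl r) (Suc lv)
      (\<lambda>t. \<beta> r t * (s (cl r t) * (if odd (cl r t div 2 ^ lv) then \<rho> else 1))) t)))"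
    unfolding s st
    using assms cl_n l left_test[OF assms, of lv] start_less[OF assms, of lv]
    by (simp add: upd_body_def left_e_def enc_rows_def odd_iff_half)
qed (simp_all add: upd_body_def left_e_def)

abbreviation "prog_size \<equiv> row_size R l + n + 1"

lemma cost_cross:
  "cost (grp_cols lv # rv n s # seg_rows lv s # st # x # enc_rows R l cl \<beta> \<omega> # env) cross_e
    (VReal (lv_cross R l cl \<beta> \<omega> lv s)) (1000 * prog_size) (200 * g + 600)"
proof -
  let ?env = "grp_cols lv # rv n s # seg_rows lv s # st # x # enc_rows R l cl \<beta> \<omega> # env"
  let ?f = "\<lambda>r t. if has_left (l r) (cl r) lv t then \<beta> r t * s (cl r t) *
       grp_prefix (cl r) lv (\<lambda>t. \<beta> r t * s (cl r t)) (grp_start (l r) (cl r) lv t - 1) else 0"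
  have row: "cost (VNat r # ?env) (rmul (snd_e (idx x6 x0))
      (Bind (Tabulate (len (idx x3 x0)) cross_body) sum_e))
      (VReal (\<omega> r * grp_cross (l r) (cl r) lv (\<lambda>t. \<beta> r t * s (cl r t)))) (500 * (l r + 1)) (100 * g + 300)"
    if r: "r < R" for r
  proof (rule cost_Op2')
    show "cost (VNat r # ?env) (snd_e (idx x6 x0)) (VReal (\<omega> r)) 5 5"
      by (rule cost_flat') (use r in \<open>simp_all add: enc_rows_def\<close>)
    show "cost (VNat r # ?env) (Bind (Tabulate (len (idx x3 x0)) cross_body) sum_e)
      (VReal (\<Sum>t<l r. ?f r t))
      (4 + l r * 100 + 1 + (200 * l r + 20) + 1) (4 + 100 + 1 + (100 * (g + 1) + 20) + 1)"
    proof (rule cost_Bind[OF cost_Tabulate_const])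
      show "cost (VNat r # ?env) (len (idx x3 x0)) (VNat (l r)) 4 4"
        by (rule cost_flat') (use r in simp_all)
    qed (rule cost_cross_body[OF r], assumption, rule cost_sum[OF g(3)[OF r]])
    show "apply2 RMul (VReal (\<omega> r)) (VReal (\<Sum>t<l r. ?f r t)) =
      Some (VReal (\<omega> r * grp_cross (l r) (cl r) lv (\<lambda>t. \<beta> r t * s (cl r t))))"
      by (simp add: grp_cross_def)
  qed simp_all
  show ?thesis unfolding cross_e_def lv_cross_def
  proof (rule cost_Bind'[OF cost_Tabulate cost_sum[OF g(1)]])
    show "cost ?env (len x5) (VNat R) 2 2"
      by (rule cost_flat') (simp_all add: enc_rows_def)
    show "2 + (\<Sum>r<R. 500 * (l r + 1)) + 1 + (200 * R + 20) + 1 \<le> 1000 * prog_size"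
      unfolding sum_row_size using row_size_ge[of R l] by simp
  qed (rule row, assumption, simp)
qed

lemma cost_level:
  "cost (lv_state R n l cl \<beta> lv s # x # enc_rows R l cl \<beta> \<omega> # env) level_e
    (lv_state R n l cl \<beta> (Suc lv) (lv_next R l cl \<beta> \<omega> lv s)) (2000 * prog_size) (200 * g + 1000)"
proof -
  let ?s = "lv_next R l cl \<beta> \<omega> lv s" and ?e = "x # enc_rows R l cl \<beta> \<omega> # env"
    and ?st = "lv_state R n l cl \<beta> lv s"
    and ?tot = "lv_cross R l cl \<beta> \<omega> lv s"
  let ?rho = "if 0 < ?tot then -1 else 1 :: real"
  have 1: "cost (?st # ?e) (fst_e (fst_e x0)) (seg_rows lv s) 5 5"
    by (rule cost_flat') (simp_all add: lv_state_def)
  have 2: "cost (seg_rows lv s # ?st # ?e) (snd_e (fst_e x1)) (rv n s) 5 5"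
    by (rule cost_flat') (simp_all add: lv_state_def)
  have 3: "cost (rv n s # seg_rows lv s # ?st # ?e) (snd_e x2) (grp_cols lv) 3 3"
    by (rule cost_flat') (simp_all add: lv_state_def)
  let ?step_env = "grp_cols lv # rv n s # seg_rows lv s # ?st # ?e"
  have 4: "cost (VReal ?tot # ?step_env) (Cond (rless (rlit 0) x0) (rsub (rlit 0) (rlit 1)) (rlit 1))
     (VReal ?rho) 20 20"
    by (rule cost_flat') simp_all
  let ?F = "VReal ?rho # VReal ?tot # ?step_env"
  have 5: "cost ?F (Tabulate (len x4) (Tabulate (len (idx x5 x0)) upd_body))
     (seg_rows (Suc lv) ?s) (2 + (\<Sum>r<R. 200 * (l r + 1)) + 1) (2 + 160 + 1)"
  proof (rule cost_Tabulate)
    fix r assume r: "r < R"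
    show "cost (VNat r # ?F) (Tabulate (len (idx x5 x0)) upd_body)
       (tab (l r) (\<lambda>t. vpair (VNat (grp_start (l r) (cl r) (Suc lv) t))
        (VReal (grp_prefix (cl r) (Suc lv) (\<lambda>t. \<beta> r t * ?s (cl r t)) t)))) (200 * (l r + 1)) 160"
      unfolding lv_next_def
    proof (rule cost_mono[OF cost_Tabulate_const[OF _ cost_upd_body[OF r]]])
      show "cost (VNat r # ?F) (len (idx x5 x0)) (VNat (l r)) 4 4"
        by (rule cost_flat') (use r in simp_all)
    qed simp_all
  qed (rule cost_flat'; simp)
  have 6: "cost ?F (Tabulate (len x3) (Cond (odd_e (idx x3 x0))
           (rmul (idx x4 x0) x1) (idx x4 x0))) (rv n ?s) (2 + n * 30 + 1) (2 + 30 + 1)"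
    by (rule cost_Tabulate_const; rule cost_flat'; simp add: odd_iff_half lv_next_def)
  have d: "i div 2 ^ lv div 2 = i div 2 ^ Suc lv" for i :: nat
    by (simp add: mult.commute flip: div_mult2_eq)
  have 7: "cost ?F (Tabulate (len x2) (Op1 Half (idx x3 x0))) (grp_cols (Suc lv)) (2 + n * 5 + 1) (2 + 5 + 1)"
    by (rule cost_Tabulate_const; rule cost_flat'; simp add: d del: power_Suc)
  have 9: "cost ?F (pair_e
      (pair_e
        (Tabulate (len x4) (Tabulate (len (idx x5 x0)) upd_body))
        (Tabulate (len x3) (Cond (odd_e (idx x3 x0))
           (rmul (idx x4 x0) x1) (idx x4 x0))))
      (Tabulate (len x2) (Op1 Half (idx x3 x0))))
     (lv_state R n l cl \<beta> (Suc lv) ?s) (300 * prog_size) 300"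
    by (rule cost_Op2'[OF cost_Op2[OF 5[unfolded sum_row_size] 6] 7]) (simp_all add: lv_state_def)
  show ?thesis unfolding level_e_def
    by (rule cost_mono[OF cost_Bind[OF 1 cost_Bind[OF 2 cost_Bind[OF 3 cost_Bind[OF cost_cross
       cost_Bind[OF 4 9]]]]]]) simp_all
qed

text \<open>Each of the \<open>G\<close> levels costs work linear in the numbers of entries, rows
  and columns, and depth linear in \<open>g\<close> for its sums. Both \<open>G\<close> and
  \<open>g\<close> are logarithmic in the application.\<close>

lemma cost_signs:
  "cost (enc_rows R l cl \<beta> \<omega> # rv n c # VReal (real G) # env) signs_e
    (rv n (signs R n l cl \<beta> \<omega> c G)) (5000 * prog_size * (G + 1)) (2000 * (g + 1) * (G + 1))"
proof -
  let ?rows = "enc_rows R l cl \<beta> \<omega>"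
  let ?e = "?rows # rv n c # VReal (real G) # env"
  let ?st = "\<lambda>lv. lv_state R n l cl \<beta> lv (lv_sign R l cl \<beta> \<omega> lv)"
  let ?s = "lv_sign R l cl \<beta> \<omega> G"
  have 1: "cost ?e (Tabulate (len x0) (Tabulate (len (fst_e (idx x1 x0)))
           (pair_e x0 (snd_e (idx (fst_e (idx x2 x1)) x0)))))
     (seg_rows 0 (\<lambda>_. 1)) (2 + (\<Sum>r<R. 50 * (l r + 1)) + 1) (2 + 50 + 1)"
  proof (rule cost_Tabulate)
    fix r assume r: "r < R"
    show "cost (VNat r # ?e) (Tabulate (len (fst_e (idx x1 x0)))
           (pair_e x0 (snd_e (idx (fst_e (idx x2 x1)) x0))))
       (tab (l r) (\<lambda>t. vpair (VNat (grp_start (l r) (cl r) 0 t))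
        (VReal (grp_prefix (cl r) 0 (\<lambda>t. \<beta> r t * 1) t)))) (50 * (l r + 1)) 50"
    proof (rule cost_mono[OF cost_Tabulate_const])
      show "cost (VNat r # ?e) (len (fst_e (idx x1 x0))) (VNat (l r)) 6 6"
        by (rule cost_flat') (use r in \<open>simp_all add: enc_rows_def\<close>)
      fix t assume t: "t < l r"
      have "grp_start (l r) (cl r) 0 t = t" "grp_prefix (cl r) 0 (\<lambda>t. \<beta> r t * 1) t = \<beta> r t * 1"
        using grp_start_0[OF cl[OF r] t] grp_prefix_0[OF cl[OF r] t] by auto
      then show "cost (VNat t # VNat r # ?e) (pair_e x0 (snd_e (idx (fst_e (idx x2 x1)) x0)))
        (vpair (VNat (grp_start (l r) (cl r) 0 t)) (VReal (grp_prefix (cl r) 0 (\<lambda>t. \<beta> r t * 1) t))) 20 20"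
        by (intro cost_flat') (use r t in \<open>simp_all add: enc_rows_def\<close>)
    qed simp_all
  qed (rule cost_flat'; simp add: enc_rows_def)
  have 2: "cost ?e (Tabulate (len x1) (rlit 1)) (rv n (\<lambda>_. 1)) (2 + n * 2 + 1) (2 + 2 + 1)"
    by (rule cost_Tabulate_const; rule cost_flat'; simp)
  have 3: "cost ?e (Tabulate (len x1) x0) (grp_cols 0) (2 + n * 1 + 1) (2 + 1 + 1)"
    by (rule cost_Tabulate_const; rule cost_flat'; simp)
  have init: "cost ?e init_e (?st 0) (100 * prog_size) 100"
    unfolding init_e_def
    by (rule cost_Op2'[OF cost_Op2[OF 1[unfolded sum_row_size] 2] 3]) (simp_all add: lv_state_def)
  have loop: "cost ?e (rep_e x2 init_e level_e) (?st G)
    (1 + 100 * prog_size + G * (2000 * prog_size + 30) + 20) (1 + 100 + G * (200 * g + 1000 + 30) + 20)"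
  proof (rule cost_rep[where st = ?st, OF _ init])
    show "cost ?e x2 (VReal (real G)) 1 1" by (rule cost_flat') simp_all
    show "cost (?st lv # x # ?e) level_e (?st (Suc lv)) (2000 * prog_size) (200 * g + 1000)" for lv x
      using cost_level by simp
  qed
  have 5: "cost (?st G # ?e) (snd_e (fst_e x0)) (rv n ?s) 5 5"
    by (rule cost_flat') (simp_all add: lv_state_def)
  let ?step_env = "rv n ?s # ?st G # ?e"
  have 6: "cost ?step_env (Bind (Tabulate (len x2) (rmul (snd_e (idx x3 x0))
       (Bind x1 (Bind (fst_e (idx x4 x1)) dot_e)))) sum_e)
     (VReal (\<Sum>r<R. \<omega> r * row_dot (l r) (cl r) (\<beta> r) ?s)) (700 * prog_size) (200 * g + 500)"
  proof (rule cost_Bind'[OF cost_Tabulate cost_sum[OF g(1)]])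
    show "cost ?step_env (len x2) (VNat R) 2 2" by (rule cost_flat') (simp_all add: enc_rows_def)
    fix r assume r: "r < R"
    show "cost (VNat r # ?step_env) (rmul (snd_e (idx x3 x0))
       (Bind x1 (Bind (fst_e (idx x4 x1)) dot_e)))
       (VReal (\<omega> r * row_dot (l r) (cl r) (\<beta> r) ?s)) (400 * (l r + 1)) (100 * g + 250)"
    proof (rule cost_Op2'[OF _ cost_Bind[OF _ cost_Bind[OF _ cost_dot[OF g(3)[OF r] cl_n[OF r]]]]])
      show "cost (VNat r # ?step_env) (snd_e (idx x3 x0)) (VReal (\<omega> r)) 5 5"
        by (rule cost_flat') (use r in \<open>simp_all add: enc_rows_def\<close>)
      show "cost (VNat r # ?step_env) x1 (rv n ?s) 1 1" by (rule cost_flat') simp_all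
      show "cost (rv n ?s # VNat r # ?step_env) (fst_e (idx x4 x1)) (enc_row (l r) (cl r) (\<beta> r)) 5 5"
        by (rule cost_flat') (use r in \<open>simp_all add: enc_rows_def\<close>)
    qed simp_all
  next
    show "2 + (\<Sum>r<R. 400 * (l r + 1)) + 1 + (200 * R + 20) + 1 \<le> 700 * prog_size"
      unfolding sum_row_size using row_size_ge[of R l] by simp
  qed simp
  let ?A = "VReal (\<Sum>r<R. \<omega> r * row_dot (l r) (cl r) (\<beta> r) ?s)"
  have 7: "cost (?A # ?step_env) (Bind (Tabulate (len x4) (rmul (idx x5 x0) (idx x2 x0))) sum_e)
     (VReal (\<Sum>j<n. c j * ?s j)) (2 + n * 10 + 1 + (200 * n + 20) + 1) (2 + 10 + 1 + (100 * (g + 1) + 20) + 1)"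
    by (rule cost_Bind[OF cost_Tabulate_const cost_sum[OF g(2)]]; rule cost_flat'; simp)
  let ?B = "VReal (\<Sum>j<n. c j * ?s j)"
  let ?b = "0 < (\<Sum>r<R. \<omega> r * row_dot (l r) (cl r) (\<beta> r) ?s) + (\<Sum>j<n. c j * ?s j)"
  have 8: "cost (?B # ?A # ?step_env) (Cond (rless (rlit 0) (radd x1 x0))
       (Tabulate (len x2) (rsub (rlit 0) (idx x3 x0)))
       x2) (rv n (signs R n l cl \<beta> \<omega> c G)) (6 + (2 + n * 10 + 1) + 1) (6 + (2 + 10 + 1) + 1)"
  proof (rule cost_Cond[where t = "of_bool ?b"])
    show "cost (?B # ?A # ?step_env) (rless (rlit 0) (radd x1 x0)) (VNat (of_bool ?b)) 6 6"
      by (rule cost_flat') simp_all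
    show "cost (?B # ?A # ?step_env) (if of_bool ?b \<noteq> (0::nat)
       then Tabulate (len x2) (rsub (rlit 0) (idx x3 x0)) else Var 2)
       (rv n (signs R n l cl \<beta> \<omega> c G)) (2 + n * 10 + 1) (2 + 10 + 1)"
    proof (cases ?b)
      case True
      have "cost (?B # ?A # ?step_env) (Tabulate (len x2) (rsub (rlit 0) (idx x3 x0)))
        (rv n (signs R n l cl \<beta> \<omega> c G)) (2 + n * 10 + 1) (2 + 10 + 1)"
        by (rule cost_Tabulate_const; rule cost_flat'; use True in \<open>simp add: signs_def Let_def\<close>)
      then show ?thesis using True by simp
    next
      case False
      then have "rv n (signs R n l cl \<beta> \<omega> c G) = rv n ?s" by (simp add: signs_def Let_def)
      moreover have "cost (?B # ?A # ?step_env) x2 (rv n ?s) (2 + n * 10 + 1) (2 + 10 + 1)"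
        by (rule cost_flat') simp_all
      ultimately show ?thesis using False by simp
    qed
  qed
  have "G * (2000 * prog_size + 30) \<le> G * (2030 * prog_size)" by (intro mult_le_mono) simp_all
  then have w: "1 + 100 * prog_size + G * (2000 * prog_size + 30) + 20 + (5 + (700 * prog_size +
    (2 + n * 10 + 1 + (200 * n + 20) + 1 + (6 + (2 + n * 10 + 1) + 1) + 1) + 1) + 1) + 1 \<le> 5000 * prog_size * (G + 1)"
    by (simp add: algebra_simps)
  have d: "1 + 100 + G * (200 * g + 1000 + 30) + 20 + (5 + (200 * g + 500 +
    (2 + 10 + 1 + (100 * (g + 1) + 20) + 1 + (6 + (2 + 10 + 1) + 1) + 1) + 1) + 1) + 1 \<le> 2000 * (g + 1) * (G + 1)"
    by (simp add: algebra_simps)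
  show ?thesis unfolding signs_e_def
    by (rule cost_mono[OF cost_Bind[OF loop cost_Bind[OF 5 cost_Bind[OF 6 cost_Bind[OF 7 8]]]] w d])
qed

end

section \<open>The random walk\<close>

lemma sum_lessThan_add: "(\<Sum>r<m + k. f r) = (\<Sum>i<m. f i) + (\<Sum>i<k. f (i + m))"
  for f :: "nat \<Rightarrow> 'a :: comm_monoid_add"
  by (induction k) (simp_all add: add.commute add.left_commute)

text \<open>
  A state \<open>(p, Z, W)\<close> consists of the current fractional values, a potential for every column and a
  weight for every row of a doubled system, in which rows \<open>i\<close> and \<open>m + i\<close> watch the upper and the
  lower tail of row \<open>i\<close> of the matrix.
\<close>

type_synonym wstate = "(nat \<Rightarrow> real) \<times> (nat \<Rightarrow> real) \<times> (nat \<Rightarrow> real)"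

definition base :: "nat \<Rightarrow> nat \<Rightarrow> nat" where
  "base m r = (if r < m then r else r - m)"

definition w_delta :: "real \<Rightarrow> (nat \<Rightarrow> real) \<Rightarrow> nat \<Rightarrow> real" where
  "w_delta \<epsilon> p j = (if p j + \<epsilon> * p j < 1 then \<epsilon> * p j else 1 - p j)"

text \<open>
  As \<open>1 \<plusminus> \<epsilon> \<le> ((1 - \<epsilon>\<^sup>2/32) (1 \<plusminus> \<epsilon>/2))\<^sup>2\<close>, after \<open>t\<close> steps \<open>4 n (1 - \<epsilon>\<^sup>2/32)\<^sup>t Z\<^sub>j\<close> dominates \<open>\<surd>p\<^sub>j\<close> unless
  \<open>p\<^sub>j = 1\<close>, whereas \<open>Z\<^sub>j\<close> itself is a martingale for random signs.
\<close>

definition w_coef :: "real \<Rightarrow> (nat \<Rightarrow> real) \<Rightarrow> (nat \<Rightarrow> real) \<Rightarrow> nat \<Rightarrow> real" where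
  "w_coef \<epsilon> p Z j = (if p j + \<epsilon> * p j < 1 then \<epsilon> / 2 * Z j else 0 - Z j)"

text \<open>The exponent of a row of the doubled system, with its sign. It becomes 0 once the two
  weights together reach 1; \<open>w_B\<close> and \<open>w_D\<close> then vanish and both weights
  stay as they are, which is the freezing.\<close>

definition w_mu :: "nat \<Rightarrow> (nat \<Rightarrow> real) \<Rightarrow> (nat \<Rightarrow> real) \<Rightarrow> nat \<Rightarrow> real" where
  "w_mu m lam W r = (if W (base m r) + W (base m r + m) < 1 then
     if r < m then lam (base m r) else 0 - lam (base m r) else 0)"

text \<open>
  With \<open>X = \<Sum>a\<^sub>j (p\<^sub>j - p0\<^sub>j)\<close> and \<open>V = \<Sum>a\<^sub>j\<^sup>2 p\<^sub>j (1 - p\<^sub>j)\<close>, a step with signs \<open>s\<close> changes \<open>\<mu> X + 2 \<mu>\<^sup>2 V\<close> by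
  \<open>\<Sum>\<beta>\<^sub>j s\<^sub>j\<close> minus \<open>w_dec\<close>.
\<close>

definition w_beta :: "(nat \<Rightarrow> real) \<Rightarrow> (nat \<Rightarrow> real) \<Rightarrow> real \<Rightarrow> nat \<Rightarrow> real \<Rightarrow> real" where
  "w_beta p \<delta> \<mu> j a = \<mu> * a * (1 + 2 * (\<mu> * a) * (1 - 2 * p j)) * \<delta> j"

definition w_dec :: "(nat \<Rightarrow> real) \<Rightarrow> real \<Rightarrow> nat \<Rightarrow> (nat \<Rightarrow> nat) \<Rightarrow> (nat \<Rightarrow> real) \<Rightarrow> real" where
  "w_dec \<delta> \<mu> l cl a = (\<Sum>t<l. 2 * ((\<mu> * a t * \<delta> (cl t)) * (\<mu> * a t * \<delta> (cl t))))"

context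
  fixes n m G :: nat and l :: "nat \<Rightarrow> nat" and cl :: "nat \<Rightarrow> nat \<Rightarrow> nat"
    and a :: "nat \<Rightarrow> nat \<Rightarrow> real" and lam :: "nat \<Rightarrow> real" and \<epsilon> :: real
begin

abbreviation "base_len r \<equiv> l (base m r)"
abbreviation "base_col r \<equiv> cl (base m r)"

definition w_B :: "wstate \<Rightarrow> nat \<Rightarrow> nat \<Rightarrow> real" where
  "w_B = (\<lambda>(p, Z, W) r t. w_beta p (w_delta \<epsilon> p) (w_mu m lam W r) (base_col r t) (a (base m r) t))"

definition w_D :: "wstate \<Rightarrow> nat \<Rightarrow> real" where
  "w_D = (\<lambda>(p, Z, W) r. w_dec (w_delta \<epsilon> p) (w_mu m lam W r) (base_len r) (base_col r) (a (base m r)))"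

text \<open>Dividing by \<open>1 + D\<close> is the rational substitute for the factor
  \<open>exp (- D)\<close>, which it bounds from above.\<close>

definition w_om :: "wstate \<Rightarrow> nat \<Rightarrow> real" where
  "w_om = (\<lambda>(p, Z, W) r. W r / (1 + w_D (p, Z, W) r))"

definition w_s :: "wstate \<Rightarrow> nat \<Rightarrow> real" where
  "w_s = (\<lambda>(p, Z, W). signs (m + m) n base_len base_col (w_B (p, Z, W)) (w_om (p, Z, W)) (w_coef \<epsilon> p Z) G)"

definition w_z :: "wstate \<Rightarrow> nat \<Rightarrow> real" where
  "w_z st r = row_dot (base_len r) (base_col r) (w_B st r) (w_s st)"

definition w_step :: "wstate \<Rightarrow> wstate" where
  "w_step = (\<lambda>(p, Z, W).
     (\<lambda>j. p j + w_delta \<epsilon> p j * w_s (p, Z, W) j,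
      \<lambda>j. Z j + w_coef \<epsilon> p Z j * w_s (p, Z, W) j,
      \<lambda>r. w_om (p, Z, W) r * (1 + w_z (p, Z, W) r + w_z (p, Z, W) r * w_z (p, Z, W) r)))"

lemma w_s_pm: "w_s st j = 1 \<or> w_s st j = -1"
  using signs_pm by (cases st) (fastforce simp: w_s_def)

lemma w_D_nonneg: "0 \<le> w_D st r"
  by (cases st) (auto simp: w_D_def w_dec_def intro!: sum_nonneg)

definition "row_dev p0 p i = (\<Sum>t<l i. a i t * (p (cl i t) - p0 (cl i t)))"
definition "w_V p i = (\<Sum>t<l i. (a i t)\<^sup>2 * (p (cl i t) * (1 - p (cl i t))))"

text \<open>The exponential bounds are kept only for rows whose two weights sum to less than 1; a
  frozen row never becomes live again. A column can escape its bound by \<open>Z\<close> only by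
  reaching exactly 1, where its step size is 0.\<close>

definition walk_ok :: "(nat \<Rightarrow> real) \<Rightarrow> (nat \<Rightarrow> real) \<Rightarrow> nat \<Rightarrow> wstate \<Rightarrow> bool" where
  "walk_ok p0 W0 k = (\<lambda>(p, Z, W).
     (\<forall>j<n. 0 \<le> p j \<and> p j \<le> 1 \<and> 0 \<le> Z j \<and>
        (p j = 1 \<or> p j \<le> (4 * real n * (1 - \<epsilon>\<^sup>2 / 32) ^ k * Z j)\<^sup>2)) \<and>
     (\<forall>r<m + m. 0 < W r) \<and>
     (\<forall>i<m. W i + W (i + m) < 1 \<longrightarrow>
        W0 i * exp (lam i * row_dev p0 p i + 2 * (lam i)\<^sup>2 * (w_V p i - w_V p0 i)) \<le> W i \<and>
        W0 i * exp (- lam i * row_dev p0 p i + 2 * (lam i)\<^sup>2 * (w_V p i - w_V p0 i)) \<le> W (i + m)))"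

definition w_tot :: "wstate \<Rightarrow> real" where
  "w_tot = (\<lambda>(p, Z, W). (\<Sum>r<m + m. W r) + (\<Sum>j<n. Z j))"

section \<open>One step of the walk: invariant and total weight\<close>

context
  fixes p0 W0 :: "nat \<Rightarrow> real" and \<Delta> :: "nat \<Rightarrow> real"
  assumes cl: "\<And>i t t'. i < m \<Longrightarrow> t < t' \<Longrightarrow> t' < l i \<Longrightarrow> cl i t < cl i t'"
    and cl_n: "\<And>i t. i < m \<Longrightarrow> t < l i \<Longrightarrow> cl i t < n"
    and nG: "n \<le> 2 ^ G"
    and a: "\<And>i t. i < m \<Longrightarrow> t < l i \<Longrightarrow> 0 \<le> a i t"
    and eps: "0 < \<epsilon>" "\<epsilon> \<le> 1 / 2"
    and p0: "\<And>j. j < n \<Longrightarrow> 0 \<le> p0 j" "\<And>j. j < n \<Longrightarrow> p0 j \<le> 1"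
    and \<Delta>: "\<And>i. i < m \<Longrightarrow> 0 < \<Delta> i"
    and lam: "\<And>i. i < m \<Longrightarrow> 0 < lam i"
    and lam_a: "\<And>i t. i < m \<Longrightarrow> t < l i \<Longrightarrow> lam i * a i t \<le> 1 / 5"
    and lam_mean: "\<And>i. i < m \<Longrightarrow> \<epsilon> * (lam i * ((\<Sum>t<l i. a i t * p0 (cl i t)) + \<Delta> i / 2)) \<le> 1 / 2"
    and W0: "\<And>i. i < m \<Longrightarrow> exp (- (lam i * \<Delta> i / 4)) \<le> W0 i" "\<And>i. i < m \<Longrightarrow> W0 (i + m) = W0 i"
    and lam_var: "\<And>i. i < m \<Longrightarrow> 2 * (lam i)\<^sup>2 * (\<Sum>t<l i. p0 (cl i t) * (a i t)\<^sup>2) \<le> lam i * \<Delta> i / 4"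
begin


abbreviation "w_X \<equiv> row_dev p0"
abbreviation "w_inv \<equiv> walk_ok p0 W0"

lemma delta_bounds:
  assumes "0 \<le> p j" "p j \<le> 1"
  shows "0 \<le> w_delta \<epsilon> p j" "w_delta \<epsilon> p j \<le> \<epsilon> * p j" "w_delta \<epsilon> p j \<le> p j"
    "w_delta \<epsilon> p j \<le> 1 - p j"
proof -
  show "0 \<le> w_delta \<epsilon> p j" "w_delta \<epsilon> p j \<le> \<epsilon> * p j" using assms eps by (auto simp: w_delta_def)
  moreover have "\<epsilon> * p j \<le> 1 * p j" using assms eps by (intro mult_right_mono) auto
  ultimately show "w_delta \<epsilon> p j \<le> p j" by simp
  show "w_delta \<epsilon> p j \<le> 1 - p j" by (auto simp: w_delta_def)
qed

lemma w_V_bounds: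
  assumes i: "i < m" and p: "\<And>j. j < n \<Longrightarrow> 0 \<le> p j" "\<And>j. j < n \<Longrightarrow> p j \<le> 1"
  shows "0 \<le> w_V p i" "w_V p i \<le> (\<Sum>t<l i. p (cl i t) * (a i t)\<^sup>2)"
proof -
  show "0 \<le> w_V p i" unfolding w_V_def using p cl_n[OF i] by (intro sum_nonneg mult_nonneg_nonneg) auto
  show "w_V p i \<le> (\<Sum>t<l i. p (cl i t) * (a i t)\<^sup>2)" unfolding w_V_def
  proof (intro sum_mono)
    fix t assume "t \<in> {..<l i}"
    then have "p (cl i t) * (1 - p (cl i t)) \<le> p (cl i t) * 1"
      using p cl_n[OF i] by (intro mult_left_mono) auto
    then show "(a i t)\<^sup>2 * (p (cl i t) * (1 - p (cl i t))) \<le> p (cl i t) * (a i t)\<^sup>2"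
      by (metis mult.commute mult.right_neutral mult_left_mono zero_le_power2)
  qed
qed

text \<open>In the exponent, the initial weight takes away at most
  \<open>lam i * \<Delta> i / 4\<close>, and so does the variance term, because the current variance
  is nonnegative and the initial one is bounded by \<open>lam_var\<close>. A weight below 1
  therefore leaves less than \<open>lam i * \<Delta> i / 2\<close> for the deviation.\<close>

lemma active_dev:
  assumes i: "i < m" and p: "\<And>j. j < n \<Longrightarrow> 0 \<le> p j" "\<And>j. j < n \<Longrightarrow> p j \<le> 1"
    and w: "W0 i * exp (\<sigma> * lam i * x + 2 * (lam i)\<^sup>2 * (w_V p i - w_V p0 i)) < 1"
    and "\<sigma> = 1 \<or> \<sigma> = -1"
  shows "\<sigma> * x < \<Delta> i / 2"
proof -
  have "2 * (lam i)\<^sup>2 * w_V p0 i \<le> 2 * (lam i)\<^sup>2 * (\<Sum>t<l i. p0 (cl i t) * (a i t)\<^sup>2)"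
    using w_V_bounds(2)[OF i, of p0] p0 by (intro mult_left_mono) auto
  also have "\<dots> \<le> lam i * \<Delta> i / 4" by (rule lam_var[OF i])
  finally have 1: "2 * (lam i)\<^sup>2 * w_V p0 i \<le> lam i * \<Delta> i / 4" .
  have "0 \<le> 2 * (lam i)\<^sup>2 * w_V p i" using w_V_bounds(1)[OF i, of p] p by simp
  then have 2: "- (lam i * \<Delta> i / 4) \<le> 2 * (lam i)\<^sup>2 * (w_V p i - w_V p0 i)"
    using 1 by (simp add: algebra_simps)
  let ?e = "\<sigma> * lam i * x + 2 * (lam i)\<^sup>2 * (w_V p i - w_V p0 i)"
  have "exp (- (lam i * \<Delta> i / 4) + ?e) \<le> W0 i * exp ?e"
    unfolding exp_add using W0(1)[OF i] by (intro mult_right_mono) auto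
  also have "\<dots> < 1" by (rule w)
  finally have "- (lam i * \<Delta> i / 4) + ?e < 0" by simp
  with 2 have "lam i * (\<sigma> * x) < lam i * (\<Delta> i / 2)" by (simp add: algebra_simps)
  then show ?thesis using lam[OF i] by simp
qed

text \<open>The Taylor bound covers \<open>0 \<le> z\<close>. For negative \<open>z\<close> one has
  \<open>exp z * (1 - z) \<le> 1 \<le> 1 - z^3\<close>, and the last term is
  \<open>(1 + z + z * z) * (1 - z)\<close>.\<close>

lemma exp_le_quadratic:
  assumes "(z::real) \<le> 1"
  shows "exp z \<le> 1 + z + z * z"
proof (cases "0 \<le> z")
  case True
  then show ?thesis using exp_bound[of z] assms by (simp add: power2_eq_square)
next
  case False
  have "1 - z \<le> exp (- z)" using exp_ge_add_one_self[of "-z"] by simp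
  then have "exp z * (1 - z) \<le> exp z * exp (- z)" by (intro mult_left_mono) auto
  then have "exp z * (1 - z) \<le> 1" by (simp add: exp_minus)
  moreover have "1 \<le> (1 + z + z * z) * (1 - z)"
  proof -
    have "z * (z * z) \<le> 0" using False by (intro mult_nonpos_nonneg) auto
    then show ?thesis by (simp add: algebra_simps)
  qed
  ultimately have "exp z * (1 - z) \<le> (1 + z + z * z) * (1 - z)" by linarith
  then show ?thesis using False by (intro mult_right_le_imp_le[of "exp z" "1 - z"]) auto
qed

text \<open>The bound 1/5 on \<open>lam i * a i t\<close> keeps the correction factor of
  \<open>w_beta\<close> within 7/5, and its square 49/25 is at most 2, the factor with which
  \<open>w_dec\<close> charges the variance.\<close>

lemma beta_bound:
  assumes i: "i < m" "t < l i" and p: "0 \<le> p j" "p j \<le> 1" and mu: "\<bar>\<mu>\<bar> \<le> lam i"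
  shows "\<bar>w_beta p \<delta> \<mu> j (a i t)\<bar> \<le> 7 / 5 * (\<bar>\<mu>\<bar> * a i t * \<bar>\<delta> j\<bar>)"
    and "(w_beta p \<delta> \<mu> j (a i t))\<^sup>2 \<le> 2 * ((\<mu> * a i t * \<delta> j) * (\<mu> * a i t * \<delta> j))"
proof -
  have "\<bar>\<mu>\<bar> * a i t \<le> lam i * a i t" using mu a[OF i] by (intro mult_right_mono) auto
  then have 1: "\<bar>\<mu> * a i t\<bar> \<le> 1 / 5" using lam_a[OF i] a[OF i] by (simp add: abs_mult)
  have "\<bar>2 * (\<mu> * a i t) * (1 - 2 * p j)\<bar> = 2 * \<bar>\<mu> * a i t\<bar> * \<bar>1 - 2 * p j\<bar>" by (simp only: abs_mult abs_numeral)
  also have "\<dots> \<le> 2 * (1 / 5) * 1" using 1 p by (intro mult_mono) auto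
  finally have 2: "\<bar>1 + 2 * (\<mu> * a i t) * (1 - 2 * p j)\<bar> \<le> 7 / 5" by linarith
  have eq: "w_beta p \<delta> \<mu> j (a i t) = (1 + 2 * (\<mu> * a i t) * (1 - 2 * p j)) * (\<mu> * a i t * \<delta> j)"
    by (simp add: w_beta_def)
  then have "\<bar>w_beta p \<delta> \<mu> j (a i t)\<bar> = \<bar>1 + 2 * (\<mu> * a i t) * (1 - 2 * p j)\<bar> * (\<bar>\<mu>\<bar> * a i t * \<bar>\<delta> j\<bar>)"
    using a[OF i] by (simp add: abs_mult)
  also have "\<dots> \<le> 7 / 5 * (\<bar>\<mu>\<bar> * a i t * \<bar>\<delta> j\<bar>)" using 2 a[OF i] by (intro mult_right_mono) auto
  finally show "\<bar>w_beta p \<delta> \<mu> j (a i t)\<bar> \<le> 7 / 5 * (\<bar>\<mu>\<bar> * a i t * \<bar>\<delta> j\<bar>)" .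
  have "(1 + 2 * (\<mu> * a i t) * (1 - 2 * p j))\<^sup>2 \<le> (7 / 5)\<^sup>2"
    using power_mono[OF 2, of 2] by simp
  also have "(7 / 5)\<^sup>2 \<le> (2::real)" by (simp add: power2_eq_square)
  finally show "(w_beta p \<delta> \<mu> j (a i t))\<^sup>2 \<le> 2 * ((\<mu> * a i t * \<delta> j) * (\<mu> * a i t * \<delta> j))"
    unfolding eq power_mult_distrib[of "1 + _"] power2_eq_square[of "\<mu> * a i t * \<delta> j", symmetric]
    by (intro mult_right_mono) auto
qed

lemma mu_bound: "r < m + m \<Longrightarrow> \<bar>w_mu m lam W r\<bar> \<le> lam (base m r)" "r < m + m \<Longrightarrow> base m r < m"
proof -
  assume r: "r < m + m"
  then show b: "base m r < m" by (auto simp: base_def)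
  show "\<bar>w_mu m lam W r\<bar> \<le> lam (base m r)" using lam[OF b] by (simp add: w_mu_def)
qed

text \<open>The exponent of the row changes by exactly \<open>z - D\<close>, and for
  \<open>z \<le> 1\<close> the exponential of this is at most
  \<open>(1 + z + z * z) / (1 + D)\<close>, the factor applied to the weight.\<close>

lemma step_row:
  assumes inv: "w_inv k (p, Z, W)" and i: "i < m" and act: "W i + W (i + m) < 1"
    and r: "(r = i \<and> \<sigma> = 1) \<or> (r = i + m \<and> \<sigma> = -1)"
  shows "W r * exp (\<sigma> * lam i * (w_X (fst (w_step (p, Z, W))) i - w_X p i) +
      2 * (lam i)\<^sup>2 * (w_V (fst (w_step (p, Z, W))) i - w_V p i)) \<le> snd (snd (w_step (p, Z, W))) r"
proof -
  let ?st = "(p, Z, W)"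
  define s where "s = w_s ?st"
  define \<delta> where "\<delta> = w_delta \<epsilon> p"
  define \<mu> where "\<mu> = \<sigma> * lam i"
  define D where "D = w_D ?st r"
  define z where "z = w_z ?st r"
  have p: "0 \<le> p j" "p j \<le> 1" if "j < n" for j using inv that by (auto simp: walk_ok_def)
  have W: "0 < W i" "0 < W (i + m)" "0 < W r" using inv i r by (auto simp: walk_ok_def)
  have br: "base m r = i" using i r by (auto simp: base_def)
  have mu: "w_mu m lam W r = \<mu>" using act i r br by (auto simp: w_mu_def \<mu>_def)
  have mu2: "\<mu>\<^sup>2 = (lam i)\<^sup>2" "\<bar>\<mu>\<bar> = lam i" using r lam[OF i] by (auto simp: \<mu>_def)
  have s2: "s j * s j = 1" "\<bar>s j\<bar> = 1" for j using w_s_pm[of ?st j] by (auto simp: s_def)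
  have D: "D = (\<Sum>t<l i. 2 * ((\<mu> * a i t * \<delta> (cl i t)) * (\<mu> * a i t * \<delta> (cl i t))))"
    by (simp add: D_def w_D_def w_dec_def br mu \<delta>_def)
  have z: "z = (\<Sum>t<l i. w_beta p \<delta> \<mu> (cl i t) (a i t) * s (cl i t))"
    by (simp add: z_def w_z_def row_dot_def w_B_def br mu \<delta>_def s_def)
  have p': "fst (w_step ?st) = (\<lambda>j. p j + \<delta> j * s j)"
    by (simp add: w_step_def \<delta>_def s_def)
  \<comment> \<open>As the signs square to 1, the second-order change of \<open>p (1 - p)\<close>
    does not depend on them; it is the deterministic decrease \<open>D\<close>.\<close>
  have ident: "\<sigma> * lam i * (w_X (fst (w_step ?st)) i - w_X p i) +
      2 * (lam i)\<^sup>2 * (w_V (fst (w_step ?st)) i - w_V p i) = z - D"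
  proof -
    have t: "\<mu> * (a i t * (p j + \<delta> j * s j - p0 j) - a i t * (p j - p0 j)) +
       2 * \<mu>\<^sup>2 * ((a i t)\<^sup>2 * ((p j + \<delta> j * s j) * (1 - (p j + \<delta> j * s j))) - (a i t)\<^sup>2 * (p j * (1 - p j)))
       = w_beta p \<delta> \<mu> j (a i t) * s j - 2 * ((\<mu> * a i t * \<delta> j) * (\<mu> * a i t * \<delta> j))" for j t
    proof -
      have "(p j + \<delta> j * s j) * (1 - (p j + \<delta> j * s j)) - p j * (1 - p j)
        = \<delta> j * s j * (1 - 2 * p j) - \<delta> j * \<delta> j * (s j * s j)" by (simp add: algebra_simps)
      then have "(a i t)\<^sup>2 * ((p j + \<delta> j * s j) * (1 - (p j + \<delta> j * s j))) - (a i t)\<^sup>2 * (p j * (1 - p j))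
        = (a i t)\<^sup>2 * (\<delta> j * s j * (1 - 2 * p j) - \<delta> j * \<delta> j)"
        by (simp only: right_diff_distrib[symmetric] s2 mult_1_right)
      then show ?thesis by (simp add: w_beta_def algebra_simps power2_eq_square)
    qed
    show ?thesis
      unfolding p' row_dev_def w_V_def D z mu2(1)[symmetric] \<mu>_def[symmetric] sum_subtractf[symmetric]
        sum_distrib_left sum.distrib[symmetric] t ..
  qed
  \<comment> \<open>Step sizes are at most \<open>\<epsilon> * p\<close>, so \<open>z\<close> is at
    most 7/5 times \<open>\<epsilon> * lam i\<close> times the current mean of the row. As the row
    is live, that mean exceeds the initial one by less than \<open>\<Delta> i / 2\<close>, and
    \<open>lam_mean\<close> bounds the whole by 7/10.\<close>
  have "z \<le> 1"
  proof -
    have X: "w_X p i < \<Delta> i / 2"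
    proof -
      have "W0 i * exp (lam i * w_X p i + 2 * (lam i)\<^sup>2 * (w_V p i - w_V p0 i)) \<le> W i"
        using inv i act by (auto simp: walk_ok_def)
      then have "W0 i * exp (1 * lam i * w_X p i + 2 * (lam i)\<^sup>2 * (w_V p i - w_V p0 i)) < 1"
        using act W by simp
      from active_dev[OF i _ _ this] p show ?thesis by simp
    qed
    have "z \<le> (\<Sum>t<l i. 7 / 5 * (\<epsilon> * (lam i * (a i t * p (cl i t)))))"
      unfolding z
    proof (intro sum_mono)
      fix t assume "t \<in> {..<l i}"
      then have t: "t < l i" by simp
      note j = cl_n[OF i t]
      have "w_beta p \<delta> \<mu> (cl i t) (a i t) * s (cl i t) \<le> \<bar>w_beta p \<delta> \<mu> (cl i t) (a i t)\<bar>"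
        using s2(2)[of "cl i t"] by (metis abs_ge_self abs_mult mult.right_neutral)
      also have "\<dots> \<le> 7 / 5 * (\<bar>\<mu>\<bar> * a i t * \<bar>\<delta> (cl i t)\<bar>)"
        by (rule beta_bound(1)[OF i t, where p = p, OF p[OF j]]) (simp add: mu2)
      also have "\<dots> \<le> 7 / 5 * (lam i * a i t * (\<epsilon> * p (cl i t)))"
        using delta_bounds[of p, OF p[OF j]] lam[OF i] a[OF i t]
        unfolding mu2 \<delta>_def by (intro mult_left_mono mult_nonneg_nonneg) auto
      finally show "w_beta p \<delta> \<mu> (cl i t) (a i t) * s (cl i t) \<le> 7 / 5 * (\<epsilon> * (lam i * (a i t * p (cl i t))))"
        by (simp add: mult_ac)
    qed
    also have "\<dots> = 7 / 5 * (\<epsilon> * (lam i * (\<Sum>t<l i. a i t * p (cl i t))))"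
      by (simp only: sum_distrib_left)
    also have "(\<Sum>t<l i. a i t * p (cl i t)) = (\<Sum>t<l i. a i t * p0 (cl i t)) + w_X p i"
      unfolding row_dev_def sum.distrib[symmetric] by (intro sum.cong) (simp_all add: algebra_simps)
    also have "7 / 5 * (\<epsilon> * (lam i * ((\<Sum>t<l i. a i t * p0 (cl i t)) + w_X p i))) \<le>
      7 / 5 * (\<epsilon> * (lam i * ((\<Sum>t<l i. a i t * p0 (cl i t)) + \<Delta> i / 2)))"
      using eps lam[OF i] X by (intro mult_left_mono add_left_mono) auto
    also have "\<dots> \<le> 7 / 5 * (1 / 2)" using lam_mean[OF i] by (intro mult_left_mono) auto
    finally show "z \<le> 1" by simp
  qed
  have D0: "0 \<le> D" unfolding D_def by (rule w_D_nonneg)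
  have "exp (z - D) = exp z / exp D" by (rule exp_diff)
  also have "\<dots> \<le> (1 + z + z * z) / (1 + D)"
    using exp_le_quadratic[OF \<open>z \<le> 1\<close>] exp_ge_add_one_self[of D] D0
    by (intro frac_le order_trans[OF exp_ge_zero[of z]]) auto
  finally have "W r * exp (z - D) \<le> W r * ((1 + z + z * z) / (1 + D))"
    using W by (intro mult_left_mono) auto
  also have "\<dots> = snd (snd (w_step ?st)) r" by (simp add: w_step_def w_om_def z_def D_def)
  finally show ?thesis unfolding ident .
qed

lemma step_frozen:
  assumes "r < m + m" "\<not> W (base m r) + W (base m r + m) < 1"
  shows "snd (snd (w_step (p, Z, W))) r = W r"
proof -
  have "w_mu m lam W r = 0" using assms by (simp add: w_mu_def)
  then show ?thesis
    by (simp add: w_step_def w_om_def w_z_def w_D_def w_dec_def w_B_def w_beta_def row_dot_def)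
qed

lemma step_inv:
  assumes inv: "w_inv k (p, Z, W)"
  shows "w_inv (Suc k) (w_step (p, Z, W))"
proof -
  let ?st = "(p, Z, W)"
  obtain p' Z' W' where st': "w_step ?st = (p', Z', W')" by (cases "w_step ?st")
  define s where "s = w_s ?st"
  have p': "p' j = p j + w_delta \<epsilon> p j * s j" and Z': "Z' j = Z j + w_coef \<epsilon> p Z j * s j"
    and W': "W' r = w_om ?st r * (1 + w_z ?st r + w_z ?st r * w_z ?st r)" for j r
    using st' by (auto simp: w_step_def s_def)
  have s: "s j = 1 \<or> s j = -1" for j using w_s_pm by (simp add: s_def)
  have inv1: "0 \<le> p j" "p j \<le> 1" "0 \<le> Z j"
    "p j = 1 \<or> p j \<le> (4 * real n * (1 - \<epsilon>\<^sup>2 / 32) ^ k * Z j)\<^sup>2" if "j < n" for j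
    using inv that by (auto simp: walk_ok_def)
  have Wpos: "0 < W r" if "r < m + m" for r using inv that by (auto simp: walk_ok_def)
  have W'pos: "0 < W' r" if "r < m + m" for r
  proof -
    have "0 < w_om ?st r" using Wpos[OF that] w_D_nonneg[of ?st r] by (simp add: w_om_def add_pos_nonneg)
    moreover have "0 < 1 + z + z * z" for z :: real
    proof -
      have "1 + z + z * z = (z + 1 / 2)\<^sup>2 + 3 / 4" by (simp add: power2_eq_square algebra_simps)
      then show ?thesis by (simp add: add_nonneg_pos)
    qed
    ultimately show ?thesis unfolding W' by simp
  qed
  let ?\<rho> = "1 - \<epsilon>\<^sup>2 / 32"
  have col: "0 \<le> p' j \<and> p' j \<le> 1 \<and> 0 \<le> Z' j \<and> (p' j = 1 \<or> p' j \<le> (4 * real n * ?\<rho> ^ Suc k * Z' j)\<^sup>2)"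
    if j: "j < n" for j
  proof -
    note b = delta_bounds[of p j, OF inv1(1,2)[OF j]]
    have p01: "0 \<le> p' j" "p' j \<le> 1" using s[of j] b inv1[OF j] unfolding p' by auto
    have e2: "\<epsilon>\<^sup>2 \<le> 1 / 4" using power_mono[of \<epsilon> "1/2" 2] eps by (simp add: power2_eq_square)
    have rho: "0 \<le> ?\<rho>" "?\<rho> \<le> 1" using e2 by auto
    show ?thesis
    proof (cases "p j + \<epsilon> * p j < 1")
      case True
      then have pj: "p' j = p j * (1 + \<epsilon> * s j)" and Zj: "Z' j = Z j * (1 + \<epsilon> / 2 * s j)"
        by (simp_all add: p' Z' w_delta_def w_coef_def algebra_simps)
      have "0 \<le> \<epsilon> * p j" using eps inv1[OF j] by simp
      then have "p j \<noteq> 1" using True eps by auto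
      then have le: "p j \<le> (4 * real n * ?\<rho> ^ k * Z j)\<^sup>2" using inv1(4)[OF j] by simp
      have Z0: "0 \<le> Z' j" unfolding Zj using s[of j] eps inv1[OF j] by auto
      \<comment> \<open>The square of \<open>1 + x / 2\<close> exceeds \<open>1 + x\<close> by
        \<open>\<epsilon>^2 / 4\<close>. It is at most 4, and the squared decay factor takes away at
        most the fraction \<open>\<epsilon>^2 / 16\<close> of it, so the surplus suffices; this is
        the origin of the constant 32.\<close>
      have key: "1 + \<epsilon> * s j \<le> (?\<rho> * (1 + \<epsilon> / 2 * s j))\<^sup>2"
      proof -
        define x where "x = \<epsilon> * s j"
        have x: "x\<^sup>2 = \<epsilon>\<^sup>2" "\<bar>x\<bar> \<le> 1 / 2" using s[of j] eps by (auto simp: x_def)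
        have "(1 + x / 2)\<^sup>2 \<le> (5 / 4)\<^sup>2" using x(2) by (intro power_mono) auto
        then have q: "(1 + x / 2)\<^sup>2 \<le> 4" by (simp add: power2_eq_square)
        have "1 - \<epsilon>\<^sup>2 / 16 \<le> ?\<rho>\<^sup>2"
          using zero_le_power2[of "\<epsilon>\<^sup>2 / 32"] by (simp only: power2_diff power_one)
        then have "(1 - \<epsilon>\<^sup>2 / 16) * (1 + x / 2)\<^sup>2 \<le> ?\<rho>\<^sup>2 * (1 + x / 2)\<^sup>2" by (intro mult_right_mono) auto
        moreover have "\<epsilon>\<^sup>2 / 16 * (1 + x / 2)\<^sup>2 \<le> \<epsilon>\<^sup>2 / 16 * 4" using q by (intro mult_left_mono) auto
        moreover have "(1 + x / 2)\<^sup>2 = 1 + x + \<epsilon>\<^sup>2 / 4" using x(1) by (simp add: power2_eq_square algebra_simps)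
        moreover have "(1 - \<epsilon>\<^sup>2 / 16) * (1 + x / 2)\<^sup>2 = (1 + x / 2)\<^sup>2 - \<epsilon>\<^sup>2 / 16 * (1 + x / 2)\<^sup>2"
          by (simp only: left_diff_distrib mult_1)
        ultimately have "1 + x \<le> ?\<rho>\<^sup>2 * (1 + x / 2)\<^sup>2" by argo
        then show ?thesis by (simp add: x_def power_mult_distrib)
      qed
      have "p' j \<le> (4 * real n * ?\<rho> ^ k * Z j)\<^sup>2 * (?\<rho> * (1 + \<epsilon> / 2 * s j))\<^sup>2"
        unfolding pj using le key s[of j] eps by (intro mult_mono) auto
      also have "\<dots> = (4 * real n * ?\<rho> ^ Suc k * Z' j)\<^sup>2"
        unfolding Zj power_mult_distrib[symmetric] by (simp add: mult_ac)
      finally show ?thesis using p01 Z0 by simp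
    next
      \<comment> \<open>Close to 1 the step size is \<open>1 - p j\<close> and the potential moves
        by its own value. Upwards, \<open>p j\<close> becomes 1 and \<open>Z j\<close> becomes 0;
        downwards, \<open>p j\<close> does not increase and \<open>Z j\<close> doubles, which
        outweighs the decay factor.\<close>
      case False
      then have pj: "p' j = p j + (1 - p j) * s j" and Zj: "Z' j = Z j - Z j * s j"
        by (simp_all add: p' Z' w_delta_def w_coef_def)
      show ?thesis
      proof (cases "s j = 1 \<or> p j = 1")
        case True
        then have "p' j = 1" by (auto simp: pj)
        then show ?thesis using p01 s[of j] inv1[OF j] by (auto simp: Zj)
      next
        case ns: False
        then have sj: "s j = -1" using s[of j] by blast
        have "p' j \<le> p j" using inv1[OF j] by (simp add: pj sj)
        also have "p j \<le> (4 * real n * ?\<rho> ^ k * Z j)\<^sup>2" using inv1(4)[OF j] ns by simp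
        also have "\<dots> \<le> (4 * real n * ?\<rho> ^ Suc k * Z' j)\<^sup>2"
        proof (rule power_mono)
          have "1 * (4 * real n * ?\<rho> ^ k * Z j) \<le> (2 * ?\<rho>) * (4 * real n * ?\<rho> ^ k * Z j)"
            using e2 rho inv1[OF j] by (intro mult_right_mono) auto
          moreover have "Z' j = 2 * Z j" by (simp add: Zj sj)
          then have "(2 * ?\<rho>) * (4 * real n * ?\<rho> ^ k * Z j) = 4 * real n * ?\<rho> ^ Suc k * Z' j"
            by (simp only: power_Suc mult_ac)
          ultimately show "4 * real n * ?\<rho> ^ k * Z j \<le> 4 * real n * ?\<rho> ^ Suc k * Z' j"
            by (simp only: mult_1)
        qed (use rho inv1[OF j] in simp)
        finally show ?thesis using p01 inv1[OF j] by (auto simp: Zj sj)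
      qed
    qed
  qed
  have row: "W0 i * exp (lam i * w_X p' i + 2 * (lam i)\<^sup>2 * (w_V p' i - w_V p0 i)) \<le> W' i \<and>
        W0 i * exp (- lam i * w_X p' i + 2 * (lam i)\<^sup>2 * (w_V p' i - w_V p0 i)) \<le> W' (i + m)"
    if i: "i < m" and act': "W' i + W' (i + m) < 1" for i
  proof -
    \<comment> \<open>Frozen weights do not move, so a row that is live after the step was live
      before it.\<close>
    have act: "W i + W (i + m) < 1"
    proof (rule ccontr)
      assume na: "\<not> W i + W (i + m) < 1"
      then have "W' i = W i" "W' (i + m) = W (i + m)"
        using step_frozen[of i W p Z] step_frozen[of "i + m" W p Z] i st' by (simp_all add: base_def)
      then show False using act' na by simp
    qed
    have old: "W0 i * exp (lam i * w_X p i + 2 * (lam i)\<^sup>2 * (w_V p i - w_V p0 i)) \<le> W i"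
        "W0 i * exp (- lam i * w_X p i + 2 * (lam i)\<^sup>2 * (w_V p i - w_V p0 i)) \<le> W (i + m)"
      using inv i act by (auto simp: walk_ok_def)
    have spl: "W0 i * exp (\<sigma> * x' + (v' - v0)) = W0 i * exp (\<sigma> * x + (v - v0)) * exp (\<sigma> * (x' - x) + (v' - v))"
      for \<sigma> x x' v v' v0 :: real
      unfolding mult.assoc exp_add[symmetric] by (simp add: algebra_simps)
    have "W0 i * exp (lam i * w_X p' i + 2 * (lam i)\<^sup>2 * (w_V p' i - w_V p0 i)) =
      W0 i * exp (lam i * w_X p i + 2 * (lam i)\<^sup>2 * (w_V p i - w_V p0 i)) *
      exp (1 * lam i * (w_X p' i - w_X p i) + 2 * (lam i)\<^sup>2 * (w_V p' i - w_V p i))"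
      using spl[of "1 * lam i" "w_X p' i" "2 * (lam i)\<^sup>2 * w_V p' i" "2 * (lam i)\<^sup>2 * w_V p0 i"
          "w_X p i" "2 * (lam i)\<^sup>2 * w_V p i"]
      unfolding right_diff_distrib[symmetric, of "2 * (lam i)\<^sup>2"] by simp
    also have "\<dots> \<le> W i * exp (1 * lam i * (w_X p' i - w_X p i) + 2 * (lam i)\<^sup>2 * (w_V p' i - w_V p i))"
      by (intro mult_right_mono old) auto
    also have "\<dots> \<le> W' i" using step_row[OF inv i act, of i 1] st' by simp
    finally have 1: "W0 i * exp (lam i * w_X p' i + 2 * (lam i)\<^sup>2 * (w_V p' i - w_V p0 i)) \<le> W' i" .
    have "W0 i * exp (- lam i * w_X p' i + 2 * (lam i)\<^sup>2 * (w_V p' i - w_V p0 i)) =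
      W0 i * exp (- lam i * w_X p i + 2 * (lam i)\<^sup>2 * (w_V p i - w_V p0 i)) *
      exp (-1 * lam i * (w_X p' i - w_X p i) + 2 * (lam i)\<^sup>2 * (w_V p' i - w_V p i))"
      using spl[of "-1 * lam i" "w_X p' i" "2 * (lam i)\<^sup>2 * w_V p' i" "2 * (lam i)\<^sup>2 * w_V p0 i"
          "w_X p i" "2 * (lam i)\<^sup>2 * w_V p i"]
      unfolding right_diff_distrib[symmetric, of "2 * (lam i)\<^sup>2"] by simp
    also have "\<dots> \<le> W (i + m) * exp (-1 * lam i * (w_X p' i - w_X p i) + 2 * (lam i)\<^sup>2 * (w_V p' i - w_V p i))"
      by (intro mult_right_mono old) auto
    also have "\<dots> \<le> W' (i + m)" using step_row[OF inv i act, of "i + m" "-1"] st' by simp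
    finally show ?thesis using 1 by simp
  qed
  show ?thesis unfolding st' walk_ok_def using col row W'pos by simp
qed

text \<open>The sum of squared coefficients left over by \<open>signs_bound\<close> is at most
  \<open>D\<close> for each row, and \<open>w_om\<close> was obtained by dividing by exactly
  \<open>1 + D\<close>, so the excess is absorbed.\<close>

lemma step_tot:
  assumes inv: "w_inv k (p, Z, W)"
  shows "w_tot (w_step (p, Z, W)) \<le> w_tot (p, Z, W)"
proof -
  let ?st = "(p, Z, W)"
  let ?om = "w_om ?st" and ?z = "w_z ?st" and ?B = "w_B ?st" and ?D = "w_D ?st" and ?s = "w_s ?st"
  have om: "0 \<le> ?om r" "?om r * (1 + ?D r) = W r" if "r < m + m" for r
  proof -
    have "0 < W r" using inv that by (auto simp: walk_ok_def)
    moreover have "0 < 1 + ?D r" using w_D_nonneg[of ?st r] by simp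
    ultimately show "0 \<le> ?om r" "?om r * (1 + ?D r) = W r" by (simp_all add: w_om_def)
  qed
  have p: "0 \<le> p j" "p j \<le> 1" if "j < n" for j using inv that by (auto simp: walk_ok_def)
  have sb: "(\<Sum>r<m + m. ?om r * ((?z r)\<^sup>2 + ?z r)) + (\<Sum>j<n. w_coef \<epsilon> p Z j * ?s j)
     \<le> (\<Sum>r<m + m. ?om r * (\<Sum>t<base_len r. (?B r t)\<^sup>2))"
    unfolding w_z_def w_s_def prod.case
  proof (rule signs_bound)
    fix r t assume r: "r < m + m" "t < base_len r"
    then have "base m r < m" using mu_bound(2) by simp
    then have "base_col r t < n" using cl_n r by simp
    then show "base_col r t < 2 ^ G" using nG by simp
  qed (use mu_bound(2) cl in simp)
  have "w_tot (w_step ?st) = (\<Sum>r<m + m. ?om r) + (\<Sum>j<n. Z j) +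
     ((\<Sum>r<m + m. ?om r * ((?z r)\<^sup>2 + ?z r)) + (\<Sum>j<n. w_coef \<epsilon> p Z j * ?s j))"
    by (simp add: w_tot_def w_step_def sum.distrib distrib_left power2_eq_square)
  also have "\<dots> \<le> (\<Sum>r<m + m. ?om r) + (\<Sum>j<n. Z j) + (\<Sum>r<m + m. ?om r * (\<Sum>t<base_len r. (?B r t)\<^sup>2))"
    using sb by simp
  also have "(\<Sum>r<m + m. ?om r * (\<Sum>t<base_len r. (?B r t)\<^sup>2)) \<le> (\<Sum>r<m + m. ?om r * ?D r)"
  proof (intro sum_mono mult_left_mono)
    fix r assume "r \<in> {..<m + m}"
    then have r: "r < m + m" by simp
    note b = mu_bound(2)[OF r]
    show "0 \<le> ?om r" by (rule om[OF r])
    show "(\<Sum>t<base_len r. (?B r t)\<^sup>2) \<le> ?D r" unfolding w_D_def w_dec_def w_B_def prod.case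
    proof (rule sum_mono)
      fix t assume "t \<in> {..<base_len r}"
      then have t: "t < base_len r" by simp
      show "(w_beta p (w_delta \<epsilon> p) (w_mu m lam W r) (base_col r t) (a (base m r) t))\<^sup>2 \<le>
        2 * ((w_mu m lam W r * a (base m r) t * w_delta \<epsilon> p (base_col r t)) *
          (w_mu m lam W r * a (base m r) t * w_delta \<epsilon> p (base_col r t)))"
        by (rule beta_bound(2)[OF b t, where p = p, OF p[OF cl_n[OF b t]] mu_bound(1)[OF r]])
    qed
  qed
  also have "(\<Sum>r<m + m. ?om r) + (\<Sum>j<n. Z j) + (\<Sum>r<m + m. ?om r * ?D r) =
    (\<Sum>r<m + m. ?om r * (1 + ?D r)) + (\<Sum>j<n. Z j)" by (simp add: sum.distrib distrib_left)
  also have "\<dots> = w_tot ?st" using om(2) by (simp add: w_tot_def)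
  finally show ?thesis by simp
qed

text \<open>The start value \<open>1 / (4 n)\<close> makes the column bound equal to 1 at time 0 and
  contributes 1/4 to the total. The factor 2 stands for the two tails of each row.\<close>

lemma walk_inv:
  assumes n: "0 < n"
  defines "init \<equiv> (p0, \<lambda>_. 1 / (4 * real n), W0)"
  shows "w_inv k ((w_step ^^ k) init) \<and> w_tot ((w_step ^^ k) init) \<le> 2 * (\<Sum>i<m. W0 i) + 1 / 4"
proof (induction k)
  case 0
  have "0 < W0 r" if "r < m + m" for r
  proof (cases "r < m")
    case True
    then show ?thesis using W0(1)[of r] exp_gt_zero order_less_le_trans by blast
  next
    case False
    then have "r - m < m" "r = (r - m) + m" using that by auto
    then show ?thesis using W0[of "r - m"] exp_gt_zero order_less_le_trans by metis
  qed
  moreover have "p0 j \<le> 1\<^sup>2" if "j < n" for j using p0[OF that] by simp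
  ultimately have "w_inv 0 init" using p0 W0(2) n by (auto simp: walk_ok_def init_def row_dev_def)
  moreover have "(\<Sum>r<m + m. W0 r) = (\<Sum>i<m. W0 i) + (\<Sum>i<m. W0 (i + m))"
    by (rule sum_lessThan_add)
  moreover have "(\<Sum>i<m. W0 (i + m)) = (\<Sum>i<m. W0 i)" using W0(2) by simp
  ultimately show ?case using n by (simp add: init_def w_tot_def)
next
  case (Suc k)
  obtain p Z W where st: "(w_step ^^ k) init = (p, Z, W)" by (cases "(w_step ^^ k) init")
  then have inv: "w_inv k (p, Z, W)" and tot: "w_tot (p, Z, W) \<le> 2 * (\<Sum>i<m. W0 i) + 1 / 4"
    using Suc by auto
  show ?case using st step_inv[OF inv] order_trans[OF step_tot[OF inv] tot] by simp
qed

end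

end

section \<open>The rounding program\<close>

definition step_test :: "expr \<Rightarrow> expr \<Rightarrow> expr" where
  "step_test p eps = rless (radd (idx p x0) (rmul eps (idx p x0))) (rlit 1)"

definition base_e :: "expr \<Rightarrow> expr" where
  "base_e v = Cond (nless x0 (len v)) x0 (nsub x0 (len v))"

definition mu_e :: expr where
  "mu_e = Cond (rless (radd (idx x4 x0) (idx x4 (nadd x0 (len x10)))) (rlit 1))
      (Cond (nless x1 (len x10)) (idx x10 x0) (rsub (rlit 0) (idx x10 x0)))
      (rlit 0)"

definition beta_body :: expr where
  "beta_body =
     Bind (idx x1 x0)
    (Bind (rmul x3 (snd_e x0))
    (pair_e (fst_e x1)
       (rmul (rmul x0 (radd (rlit 1) (rmul (rmul (rlit 2) x0)
          (rsub (rlit 1) (rmul (rlit 2) (idx x11 (fst_e x1))))))) (idx x8 (fst_e x1)))))"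

definition dec_body :: expr where
  "dec_body =
     Bind (idx x2 x0)
    (Bind (rmul (rmul x4 (snd_e x0)) (idx x8 (fst_e x0)))
       (rmul (rlit 2) (rmul x0 x0)))"

text \<open>Variables on entry: 0 the row of the doubled system, 1 the column coefficients, 2 the
  step sizes, 3 to 5 \<open>W\<close>, \<open>Z\<close> and \<open>p\<close>, 6 the state, 7 the
  loop pair, 8 the matrix, 9 the exponents, 10 the step parameter, 11 the number of levels. The
  result has the row format of \<open>enc_rows\<close>.\<close>

definition row_e :: expr where
  "row_e =
     Bind (base_e x9)
    (Bind mu_e
    (Bind (idx x10 x1)
    (Bind (Tabulate (len x0) beta_body)
    (Bind (Bind (Tabulate (len x1) dec_body) sum_e)
    (pair_e x1 (rdiv (idx x8 x5) (radd (rlit 1) x0)))))))"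

definition upw_e :: expr where
  "upw_e = Bind (Bind x1 (Bind (fst_e (idx x3 x1)) dot_e))
     (rmul (snd_e (idx x3 x1)) (radd (radd (rlit 1) x0) (rmul x0 x0)))"

definition step_e :: expr where
  "step_e =
     Bind (fst_e (fst_e x0))
    (Bind (snd_e (fst_e x1))
    (Bind (snd_e x2)
    (Bind (Tabulate (len x2) (Cond (step_test x3 x8)
       (rmul x8 (idx x3 x0)) (rsub (rlit 1) (idx x3 x0))))
    (Bind (Tabulate (len x2) (Cond (step_test x4 x9)
       (rmul (rdiv x9 (rlit 2)) (idx x3 x0)) (rsub (rlit 0) (idx x3 x0))))
    (Bind (Tabulate (len x2) row_e)
    (Bind (Bind x11 (Bind x2 (Bind x2 signs_e)))
    (pair_e
      (pair_e
        (Tabulate (len x6) (radd (idx x7 x0) (rmul (idx x4 x0) (idx x1 x0))))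
        (Tabulate (len x5) (radd (idx x6 x0) (rmul (idx x3 x0) (idx x1 x0)))))
      (Tabulate (len x1) upw_e))))))))"

definition enc_st :: "nat \<Rightarrow> nat \<Rightarrow> wstate \<Rightarrow> val" where
  "enc_st n m = (\<lambda>(p, Z, W). vpair (vpair (rv n p) (rv n Z)) (rv (m + m) W))"

abbreviation enc_mat :: "nat \<Rightarrow> (nat \<Rightarrow> nat) \<Rightarrow> (nat \<Rightarrow> nat \<Rightarrow> nat) \<Rightarrow> (nat \<Rightarrow> nat \<Rightarrow> real) \<Rightarrow> val" where
  "enc_mat m l cl a \<equiv> tab m (\<lambda>i. enc_row (l i) (cl i) (a i))"

lemma row_size_double: "row_size (m + m) (\<lambda>r. l (base m r)) = 2 * row_size m l"
  unfolding row_size_def sum_lessThan_add by (simp add: base_def)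

context
  fixes n m G g :: nat and l :: "nat \<Rightarrow> nat" and cl :: "nat \<Rightarrow> nat \<Rightarrow> nat"
    and a :: "nat \<Rightarrow> nat \<Rightarrow> real" and lam :: "nat \<Rightarrow> real" and \<epsilon> :: real
  assumes cl: "\<And>i t t'. i < m \<Longrightarrow> t < t' \<Longrightarrow> t' < l i \<Longrightarrow> cl i t < cl i t'"
    and cl_n: "\<And>i t. i < m \<Longrightarrow> t < l i \<Longrightarrow> cl i t < n"
    and g: "m + m \<le> 2 ^ g" "n \<le> 2 ^ g" "\<And>i. i < m \<Longrightarrow> l i \<le> 2 ^ g"
begin

abbreviation "deltas p \<equiv> w_delta \<epsilon> p"
abbreviation "step_env p Z W st x env \<equiv> rv (m + m) W # rv n Z # rv n p # st # x # enc_mat m l cl a # rv m lam # VReal \<epsilon> # VReal (real G) # env"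

lemma base_less: "r < m + m \<Longrightarrow> base m r < m"
  by (auto simp: base_def)

lemma cost_row:
  assumes r: "r < m + m"
  shows "cost (VNat r # cf # rv n (deltas p) # step_env p Z W st x env) row_e
    (vpair (enc_row (l (base m r)) (cl (base m r)) (w_B m cl a lam \<epsilon> (p, Z, W) r))
      (VReal (w_om m l cl a lam \<epsilon> (p, Z, W) r)))
    (500 * (l (base m r) + 1)) (100 * g + 500)"
proof -
  let ?b = "base m r"
  let ?mu = "w_mu m lam W r"
  let ?D = "w_D m l cl a lam \<epsilon> (p, Z, W) r"
  let ?B = "w_B m cl a lam \<epsilon> (p, Z, W) r"
  let ?e = "VNat r # cf # rv n (deltas p) # step_env p Z W st x env"
  note b = base_less[OF r]
  have 1: "cost ?e (base_e x9) (VNat ?b) 20 20"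
    by (rule cost_flat') (simp_all add: base_e_def base_def)
  have 2: "cost (VNat ?b # ?e) mu_e (VReal ?mu) 50 50"
    by (rule cost_flat') (use b in \<open>simp_all add: mu_e_def w_mu_def\<close>)
  let ?e1 = "VReal ?mu # VNat ?b # ?e"
  have 3: "cost ?e1 (idx x10 x1) (enc_row (l ?b) (cl ?b) (a ?b)) 3 3"
    by (rule cost_flat') (use b in simp_all)
  let ?e2 = "enc_row (l ?b) (cl ?b) (a ?b) # ?e1"
  have 4: "cost ?e2 (Tabulate (len x0) beta_body) (enc_row (l ?b) (cl ?b) ?B) (2 + l ?b * 50 + 1) (2 + 50 + 1)"
    by (rule cost_Tabulate_const; rule cost_flat'; use b cl_n in \<open>simp add: beta_body_def w_B_def w_beta_def\<close>)
  let ?e3 = "enc_row (l ?b) (cl ?b) ?B # ?e2"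
  have 5: "cost ?e3 (Bind (Tabulate (len x1) dec_body) sum_e) (VReal ?D)
    (2 + l ?b * 40 + 1 + (200 * l ?b + 20) + 1) (2 + 40 + 1 + (100 * (g + 1) + 20) + 1)"
    unfolding w_D_def w_dec_def prod.case
    by (rule cost_Bind[OF cost_Tabulate_const cost_sum[OF g(3)[OF b]]]; rule cost_flat';
        use b cl_n in \<open>simp add: dec_body_def\<close>)
  have "1 + ?D \<noteq> 0" using w_D_nonneg[of m l cl a lam \<epsilon> "(p, Z, W)" r] by linarith
  then have 6: "cost (VReal ?D # ?e3) (pair_e x1 (rdiv (idx x8 x5) (radd (rlit 1) x0)))
     (vpair (enc_row (l ?b) (cl ?b) ?B) (VReal (w_om m l cl a lam \<epsilon> (p, Z, W) r))) 20 20"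
    by (intro cost_flat') (use r in \<open>simp_all add: w_om_def\<close>)
  show ?thesis unfolding row_e_def
    by (rule cost_mono[OF cost_Bind[OF 1 cost_Bind[OF 2 cost_Bind[OF 3 cost_Bind[OF 4 cost_Bind[OF 5 6]]]]]]) simp_all
qed

lemma cost_step:
  "cost (enc_st n m st # x # enc_mat m l cl a # rv m lam # VReal \<epsilon> # VReal (real G) # env) step_e
    (enc_st n m (w_step n m G l cl a lam \<epsilon> st))
    (20000 * (row_size m l + n + 1) * (G + 1)) (10000 * (g + 1) * (G + 1))"
proof -
  obtain p Z W where st: "st = (p, Z, W)" by (cases st)
  let ?sz = "row_size m l + n + 1"
  let ?e0 = "enc_st n m st # x # enc_mat m l cl a # rv m lam # VReal \<epsilon> # VReal (real G) # env"
  have 1: "cost ?e0 (fst_e (fst_e x0)) (rv n p) 5 5"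
    by (rule cost_flat') (simp_all add: st enc_st_def)
  have 2: "cost (rv n p # ?e0) (snd_e (fst_e x1)) (rv n Z) 5 5"
    by (rule cost_flat') (simp_all add: st enc_st_def)
  have 3: "cost (rv n Z # rv n p # ?e0) (snd_e x2) (rv (m + m) W) 3 3"
    by (rule cost_flat') (simp_all add: st enc_st_def)
  let ?e1 = "step_env p Z W (enc_st n m st) x env"
  have 4: "cost ?e1 (Tabulate (len x2) (Cond (step_test x3 x8)
       (rmul x8 (idx x3 x0)) (rsub (rlit 1) (idx x3 x0))))
     (rv n (deltas p)) (2 + n * 30 + 1) (2 + 30 + 1)"
    by (rule cost_Tabulate_const; rule cost_flat'; simp add: step_test_def w_delta_def)
  let ?e2 = "rv n (deltas p) # ?e1"
  have 5: "cost ?e2 (Tabulate (len x2) (Cond (step_test x4 x9)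
       (rmul (rdiv x9 (rlit 2)) (idx x3 x0)) (rsub (rlit 0) (idx x3 x0))))
     (rv n (w_coef \<epsilon> p Z)) (2 + n * 30 + 1) (2 + 30 + 1)"
    by (rule cost_Tabulate_const; rule cost_flat'; simp add: step_test_def w_coef_def)
  let ?e3 = "rv n (w_coef \<epsilon> p Z) # ?e2"
  let ?R = "m + m" and ?l = "\<lambda>r. l (base m r)" and ?cl = "\<lambda>r. cl (base m r)"
    and ?B = "w_B m cl a lam \<epsilon> (p, Z, W)" and ?om = "w_om m l cl a lam \<epsilon> (p, Z, W)"
  let ?s = "w_s n m G l cl a lam \<epsilon> (p, Z, W)"
  have 6: "cost ?e3 (Tabulate (len x2) row_e) (enc_rows ?R ?l ?cl ?B ?om)
     (2 + (\<Sum>r<?R. 500 * (?l r + 1)) + 1) (2 + (100 * g + 500) + 1)"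
    unfolding enc_rows_def
    by (rule cost_Tabulate[OF _ cost_row]) (rule cost_flat'; simp)
  let ?e4 = "enc_rows ?R ?l ?cl ?B ?om # ?e3"
  have 7: "cost ?e4 (Bind x11 (Bind x2 (Bind x2 signs_e))) (rv n ?s)
     (1 + (1 + (1 + 5000 * (row_size ?R ?l + n + 1) * (G + 1) + 1) + 1) + 1)
     (1 + (1 + (1 + 2000 * (g + 1) * (G + 1) + 1) + 1) + 1)"
  proof (rule cost_Bind[OF _ cost_Bind[OF _ cost_Bind]])
    show "cost ?e4 x11 (VReal (real G)) 1 1" by (rule cost_flat') simp_all
    show "cost (VReal (real G) # ?e4) x2 (rv n (w_coef \<epsilon> p Z)) 1 1" by (rule cost_flat') simp_all
    show "cost (rv n (w_coef \<epsilon> p Z) # VReal (real G) # ?e4) x2 (enc_rows ?R ?l ?cl ?B ?om) 1 1"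
      by (rule cost_flat') simp_all
    show "cost (enc_rows ?R ?l ?cl ?B ?om # rv n (w_coef \<epsilon> p Z) # VReal (real G) # ?e4) signs_e (rv n ?s)
      (5000 * (row_size ?R ?l + n + 1) * (G + 1)) (2000 * (g + 1) * (G + 1))"
      unfolding w_s_def prod.case
      by (rule cost_signs) (use cl cl_n base_less g in auto)
  qed
  let ?e5 = "rv n ?s # ?e4"
  obtain p' Z' W' where st': "w_step n m G l cl a lam \<epsilon> st = (p', Z', W')" by (metis prod_cases3)
  have p': "p' = (\<lambda>j. p j + deltas p j * ?s j)" and Z': "Z' = (\<lambda>j. Z j + w_coef \<epsilon> p Z j * ?s j)"
    and W': "W' = (\<lambda>r. ?om r * (1 + w_z n m G l cl a lam \<epsilon> (p, Z, W) r +
      w_z n m G l cl a lam \<epsilon> (p, Z, W) r * w_z n m G l cl a lam \<epsilon> (p, Z, W) r))"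
    using st' by (simp_all add: st w_step_def fun_eq_iff)
  have 8: "cost ?e5 (Tabulate (len x6) (radd (idx x7 x0) (rmul (idx x4 x0) (idx x1 x0))))
     (rv n p') (2 + n * 20 + 1) (2 + 20 + 1)"
    by (rule cost_Tabulate_const; rule cost_flat'; simp add: p')
  have 9: "cost ?e5 (Tabulate (len x5) (radd (idx x6 x0) (rmul (idx x3 x0) (idx x1 x0))))
     (rv n Z') (2 + n * 20 + 1) (2 + 20 + 1)"
    by (rule cost_Tabulate_const; rule cost_flat'; simp add: Z')
  have 10: "cost ?e5 (Tabulate (len x1) upw_e)
     (rv ?R W') (2 + (\<Sum>r<?R. 400 * (?l r + 1)) + 1) (2 + (100 * g + 300) + 1)"
  proof (rule cost_Tabulate)
    show "cost ?e5 (len x1) (VNat ?R) 2 2" by (rule cost_flat') (simp_all add: enc_rows_def)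
    fix r assume r: "r < ?R"
    note b = base_less[OF r]
    let ?z = "w_z n m G l cl a lam \<epsilon> (p, Z, W) r"
    have z: "cost (VNat r # ?e5) (Bind x1 (Bind (fst_e (idx x3 x1)) dot_e)) (VReal ?z)
      (1 + (5 + (300 * ?l r + 50) + 1) + 1) (1 + (5 + (100 * g + 200) + 1) + 1)"
      unfolding w_z_def
    proof (rule cost_Bind[OF _ cost_Bind[OF _ cost_dot]])
      show "cost (VNat r # ?e5) x1 (rv n ?s) 1 1" by (rule cost_flat') simp_all
      show "cost (rv n ?s # VNat r # ?e5) (fst_e (idx x3 x1)) (enc_row (?l r) (?cl r) (?B r)) 5 5"
        by (rule cost_flat') (use r in \<open>simp_all add: enc_rows_def\<close>)
    qed (use g(3)[OF b] cl_n[OF b] in auto)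
    have w: "cost (VReal ?z # VNat r # ?e5) (rmul (snd_e (idx x3 x1)) (radd (radd (rlit 1) x0) (rmul x0 x0)))
      (VReal (W' r)) 20 20"
      by (rule cost_flat') (use r in \<open>simp_all add: enc_rows_def W'\<close>)
    show "cost (VNat r # ?e5) upw_e (VReal (W' r)) (400 * (?l r + 1)) (100 * g + 300)"
      unfolding upw_e_def by (rule cost_Bind'[OF z w]) simp_all
  qed
  have 11: "cost ?e5 (pair_e
      (pair_e
        (Tabulate (len x6) (radd (idx x7 x0) (rmul (idx x4 x0) (idx x1 x0))))
        (Tabulate (len x5) (radd (idx x6 x0) (rmul (idx x3 x0) (idx x1 x0)))))
      (Tabulate (len x1) upw_e)) (enc_st n m (w_step n m G l cl a lam \<epsilon> st))
    (1000 * ?sz) (100 * g + 500)"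
  proof -
    have e: "enc_st n m (w_step n m G l cl a lam \<epsilon> st) = vpair (vpair (rv n p') (rv n Z')) (rv ?R W')"
      by (simp add: st' enc_st_def)
    show ?thesis unfolding e
      by (rule cost_Op2'[OF cost_Op2[OF 8 9] 10[unfolded sum_row_size row_size_double]]) simp_all
  qed
  note 6 = 6[unfolded sum_row_size row_size_double] and 7 = 7[unfolded row_size_double]
  have "1000 * ?sz \<le> 1000 * ?sz * (G + 1)" "2 * row_size m l + n + 1 \<le> 2 * ?sz" by simp_all
  then have "5000 * (2 * row_size m l + n + 1) * (G + 1) \<le> 5000 * (2 * ?sz) * (G + 1)"
    by (intro mult_le_mono) simp_all
  then have w: "5 + (5 + (3 + (2 + n * 30 + 1 + (2 + n * 30 + 1 + (2 + 500 * (2 * row_size m l) + 1 +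
     (1 + (1 + (1 + 5000 * (2 * row_size m l + n + 1) * (G + 1) + 1) + 1) + 1 + 1000 * ?sz + 1) + 1) + 1) + 1) + 1) + 1) + 1
     \<le> 20000 * ?sz * (G + 1)"
    by (simp add: algebra_simps)
  have d: "5 + (5 + (3 + (2 + 30 + 1 + (2 + 30 + 1 + (2 + (100 * g + 500) + 1 +
     (1 + (1 + (1 + 2000 * (g + 1) * (G + 1) + 1) + 1) + 1 + (100 * g + 500) + 1) + 1) + 1) + 1) + 1) + 1) + 1
     \<le> 10000 * (g + 1) * (G + 1)"
    by (simp add: algebra_simps)
  show ?thesis unfolding step_e_def
    by (rule cost_mono[OF cost_Bind[OF 1 cost_Bind[OF 2 cost_Bind[OF 3 cost_Bind[OF 4 cost_Bind[OF 5
      cost_Bind[OF 6 cost_Bind[OF 7 11]]]]]]] w d])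
qed

end

section \<open>Bit lengths in place of logarithms\<close>

fun bitlen :: "nat \<Rightarrow> nat" where
  "bitlen x = (if x = 0 then 0 else Suc (bitlen (x div 2)))"

declare bitlen.simps [simp del]

lemma bitlen_less: "x < 2 ^ bitlen x"
proof (induction x rule: bitlen.induct)
  case (1 x)
  then show ?case by (subst bitlen.simps) auto
qed

lemma bitlen_le: "0 < x \<Longrightarrow> 2 ^ bitlen x \<le> 2 * x"
proof (induction x rule: bitlen.induct)
  case (1 x)
  show ?case
  proof (cases "x div 2 = 0")
    case True
    then have "x = 1" using 1(2) by auto
    then show ?thesis by (simp add: bitlen.simps)
  next
    case False
    then have "2 ^ bitlen (x div 2) \<le> 2 * (x div 2)" using 1 by auto
    then show ?thesis using 1(2) by (subst bitlen.simps) auto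
  qed
qed

text \<open>The count is kept as a real because it enters products.\<close>

definition bitlen_e :: "expr \<Rightarrow> expr" where
  "bitlen_e x = snd_e (Bind (pair_e x (rlit 0))
     (While (fst_e x0) (pair_e (Op1 Half (fst_e x0)) (radd (snd_e x0) (rlit 1)))))"

lemma cost_bitlen_loop:
  "cost (vpair (VNat x) (VReal y) # env)
     (While (fst_e x0) (pair_e (Op1 Half (fst_e x0)) (radd (snd_e x0) (rlit 1))))
     (vpair (VNat 0) (VReal (y + real (bitlen x)))) (20 * bitlen x + 10) (20 * bitlen x + 10)"
proof (induction x arbitrary: y rule: bitlen.induct)
  case (1 x)
  show ?case
  proof (cases "x = 0")
    case True
    then show ?thesis
      by (simp add: bitlen.simps)
        (rule cost_mono[OF cost_While_end[where w = 3 and d = 3]]; (rule cost_flat')?; simp)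
  next
    case False
    have 2: "cost (vpair (VNat x) (VReal y) # env) (fst_e x0) (VNat x) 3 3"
      by (rule cost_flat') simp_all
    have 3: "cost (vpair (VNat x) (VReal y) # env)
       (pair_e (Op1 Half (fst_e x0)) (radd (snd_e x0) (rlit 1)))
       (vpair (VNat (x div 2)) (VReal (y + 1))) 15 15"
      by (rule cost_flat') simp_all
    have e: "y + 1 + real (bitlen (x div 2)) = y + real (bitlen x)"
      using False by (subst (2) bitlen.simps) simp
    have b: "bitlen x = Suc (bitlen (x div 2))" using False by (subst bitlen.simps) simp
    show ?thesis
      by (rule cost_mono[OF cost_While_step[OF 2 False 3 1[OF False, of "y + 1", unfolded e]]]) (simp_all add: b)
  qed
qed

lemma cost_bitlen:
  assumes "cost env e (VNat x) w d"
  shows "cost env (bitlen_e e) (VReal (real (bitlen x))) (w + 20 * bitlen x + 30) (d + 20 * bitlen x + 30)"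
proof -
  have 1: "cost env (rlit 0) (VReal 0) 2 2" by (rule cost_flat') simp_all
  have 2: "cost env (Lit 1) (VNat 1) 1 1" by (rule cost_flat') simp_all
  have 3: "apply2 Pair_of (VNat x) (VReal 0) = Some (vpair (VNat x) (VReal 0))" by simp
  show ?thesis unfolding bitlen_e_def
    by (rule cost_mono[OF cost_Op2[OF cost_Bind[OF cost_Op2[OF assms 1 3] cost_bitlen_loop] 2]]) simp_all
qed

text \<open>Variables on entry: 0 the row, 1 \<open>r_K\<close>, 2 \<open>r_L\<close>, 3
  \<open>r_G\<close>, 4 the matrix, 5 \<open>p\<close>, 6 \<open>\<Delta>\<close>, 7
  \<open>k\<close>. The initial weight is a power, computed by \<open>r_L\<close>
  multiplications.\<close>

definition par_body :: expr where
  "par_body =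
     Bind (idx x4 x0)
    (Bind (idx x7 x1)
    (Bind (Bind (Tabulate (len x1) (Bind (idx x2 x0)
        (rmul (idx x9 (fst_e x0)) (rmul (snd_e x0) (snd_e x0))))) sum_e)
    (Bind (Bind (Tabulate (len x2) (Bind (idx x3 x0)
        (rmul (idx x10 (fst_e x0)) (snd_e x0)))) sum_e)
    (Bind (Bind (Tabulate (len x3) (snd_e (idx x4 x0))) max_e)
    (Bind (radd (radd (rdiv (rmul (rlit 8) x2) (rmul x3 x3))
                          (rdiv (rmul (rlit 5) x0) x3))
                  (radd (rdiv x1 (rmul (Op1 ToReal x12) x3))
                          (rdiv (rlit 1) x7)))
    (Bind (rdiv (rlit 1) x0)
    (pair_e (rdiv x0 x5)
       (rep_e x9 (rlit 1) (rmul x0 (rsub (rlit 1) (rdiv x2 (rmul (rlit 8) x11)))))))))))) "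

definition walk_e :: expr where
  "walk_e =
     Bind (bitlen_e (nadd (nadd (len x1) (len x2)) (Lit 1)))
    (Bind (rmul (rlit 256) (radd x0 (rlit 3)))
    (Bind (rmul (rlit 2) (radd (Op1 ToReal x5) x0))
    (Bind (Tabulate (len x5) par_body)
    (Bind (rdiv (rlit 1) x1)
    (Bind (Tabulate (len x1) (fst_e (idx x2 x0)))
    (Bind (pair_e
        (pair_e x7 (Tabulate (len x7) (rdiv (rlit 1) (rmul (rlit 4) (Op1 ToReal (len x8))))))
        (Tabulate (nadd (len x2) (len x2)) (Bind (base_e x3) (snd_e (idx x4 x0)))))
    (Bind (rmul (rmul (rlit 32) (rmul x4 x4)) (radd (rmul (rlit 3) x6) (rlit 4)))
    (Bind x7
    (Bind x4
    (Bind x4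
    (Bind x11
    (Bind (rep_e x4 x5 step_e)
    (Bind (fst_e (fst_e x0))
    (Bind (snd_e x1)
    (pair_e
      (Tabulate (len x1) (Cond (rless (idx x2 x0) (rlit 1)) (rlit 0) (rlit 1)))
      (Tabulate (len x4) (Cond (rless (radd (idx x1 x0)
         (idx x1 (nadd x0 (len x5)))) (rlit 1)) (Lit 0) (Lit 1))))))))))))))))))"

definition trivial_e :: "nat \<Rightarrow> expr" where
  "trivial_e b = pair_e (Tabulate (len x1) (rlit 0)) (Tabulate (len x2) (Lit b))"

text \<open>Degenerate inputs are separated because the walk divides by \<open>k\<close> and by the
  number of columns. For \<open>k = 0\<close> every row may be declared bad, and without rows or
  columns none has to be.\<close>

definition round_e :: expr where
  "round_e = Cond (nless x3 (Lit 1)) (trivial_e 1)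
     (Cond (Cond (len x1) (len x2) (Lit 0)) walk_e (trivial_e 0))"

lemma cost_trivial:
  "cost (A # rv n p # rv m \<Delta> # env) (trivial_e b) (vpair (rv n (\<lambda>_. 0)) (tab m (\<lambda>_. VNat b)))
     (10 * (n + m + 1)) 20"
proof -
  have 1: "cost (A # rv n p # rv m \<Delta> # env) (Tabulate (len x1) (rlit 0)) (rv n (\<lambda>_. 0)) (2 + n * 2 + 1) (2 + 2 + 1)"
    by (rule cost_Tabulate_const; rule cost_flat'; simp)
  have 2: "cost (A # rv n p # rv m \<Delta> # env) (Tabulate (len x2) (Lit b)) (tab m (\<lambda>_. VNat b)) (2 + m * 1 + 1) (2 + 1 + 1)"
    by (rule cost_Tabulate_const; rule cost_flat'; simp)
  show ?thesis unfolding trivial_e_def by (rule cost_Op2'[OF 1 2]) simp_all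
qed

section \<open>Parameters of the walk and cost of the whole program\<close>

locale rounding =
  fixes n m k :: nat and l :: "nat \<Rightarrow> nat" and cl :: "nat \<Rightarrow> nat \<Rightarrow> nat"
    and a :: "nat \<Rightarrow> nat \<Rightarrow> real" and p \<Delta> :: "nat \<Rightarrow> real"
  assumes cl: "\<And>i t t'. i < m \<Longrightarrow> t < t' \<Longrightarrow> t' < l i \<Longrightarrow> cl i t < cl i t'"
    and cl_n: "\<And>i t. i < m \<Longrightarrow> t < l i \<Longrightarrow> cl i t < n"
    and l_n: "\<And>i. i < m \<Longrightarrow> l i \<le> n"
    and nm: "0 < n" "0 < m" "0 < k"
    and \<Delta>: "\<And>i. i < m \<Longrightarrow> 0 < \<Delta> i"
    and a: "\<And>i t. i < m \<Longrightarrow> t < l i \<Longrightarrow> 0 \<le> a i t"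
    and p: "\<And>j. j < n \<Longrightarrow> 0 \<le> p j" "\<And>j. j < n \<Longrightarrow> p j \<le> 1"
begin

text \<open>
  The four summands of \<open>r_H\<close> enforce the constraints on the exponent \<open>h = 1 / r_H\<close>: small against the
  variance, against the largest entry, against the mean, and at most logarithmic. The last one
  bounds the step size and is harmless since a tail probability below \<open>1 / (8 m)\<close> need not be
  resolved. A sum is used instead of the minimum of the reciprocals to avoid divisions by zero.
\<close>

definition "r_G = bitlen (n + m + 1)"
definition "r_L = 256 * (r_G + 3)"
text \<open>The exponent times the mean is at most \<open>k\<close>, and \<open>r_h i\<close> is at
  most \<open>r_L\<close>, so the step parameter \<open>1 / r_K\<close> meets the bound 1/2 demanded
  of a single step.\<close>

definition "r_K = 2 * (k + r_L)"
text \<open>In \<open>32 * r_K * r_K\<close> steps the decay factor shrinks at least by the factor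
  e. After \<open>3 * r_G + 4\<close> such rounds it is below \<open>1 / (16 n^2 m)\<close>.\<close>

definition "r_T = 32 * (r_K * r_K) * (3 * r_G + 4)"
definition "r_Q i = (\<Sum>t<l i. p (cl i t) * (a i t * a i t))"
definition "r_M i = (\<Sum>t<l i. p (cl i t) * a i t)"
definition "r_mx i = (if l i = 0 then 0 else Max (a i ` {..<l i}))"
definition "r_H i = 8 * r_Q i / (\<Delta> i * \<Delta> i) + 5 * r_mx i / \<Delta> i + (r_M i / (real k * \<Delta> i) + 1 / real r_L)"
definition "r_h i = 1 / r_H i"
definition "r_lam i = r_h i / \<Delta> i"
definition "r_w i = (1 - r_h i / (8 * real r_L)) ^ r_L"
definition "r_eps = 1 / real r_K"
definition "r_init = (p, \<lambda>_::nat. 1 / (4 * real n), \<lambda>r. r_w (base m r))"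
definition "r_walk t = ((w_step n m r_G l cl a r_lam r_eps) ^^ t) r_init"
definition "r_p = fst (r_walk r_T)"
definition "r_W = snd (snd (r_walk r_T))"

lemma r_L_pos: "0 < r_L" by (simp add: r_L_def)

lemma r_sizes: "n \<le> 2 ^ r_G" "m + m \<le> 2 ^ (r_G + 1)" "n \<le> 2 ^ (r_G + 1)" "i < m \<Longrightarrow> l i \<le> 2 ^ (r_G + 1)"
proof -
  have 1: "n + m + 1 < 2 ^ r_G" unfolding r_G_def by (rule bitlen_less)
  then show "n \<le> 2 ^ r_G" "m + m \<le> 2 ^ (r_G + 1)" "n \<le> 2 ^ (r_G + 1)" by simp_all
  then show "l i \<le> 2 ^ (r_G + 1)" if "i < m" using l_n[OF that] by linarith
qed

lemma r_nonneg:
  assumes i: "i < m"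
  shows "0 \<le> r_Q i" "0 \<le> r_M i" "0 \<le> r_mx i" "t < l i \<Longrightarrow> a i t \<le> r_mx i"
proof -
  show "0 \<le> r_Q i" "0 \<le> r_M i"
    using p(1)[OF cl_n[OF i]] a[OF i] by (auto simp: r_Q_def r_M_def intro!: sum_nonneg)
  show *: "t < l i \<Longrightarrow> a i t \<le> r_mx i" for t by (auto simp: r_mx_def)
  show "0 \<le> r_mx i"
  proof (cases "l i = 0")
    case False
    then show ?thesis using *[of 0] a[OF i, of 0] by simp
  qed (simp add: r_mx_def)
qed

lemma r_H_pos: "i < m \<Longrightarrow> 0 < r_H i"
  using r_nonneg[of i] \<Delta>[of i] r_L_pos unfolding r_H_def
  by (intro add_nonneg_pos add_nonneg_nonneg divide_nonneg_nonneg) auto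

lemma cost_par:
  assumes i: "i < m"
  shows "cost (VNat i # VReal K # VReal (real r_L) # G # enc_mat m l cl a # rv n p # rv m \<Delta> # VNat k # env) par_body
    (vpair (VReal (r_lam i)) (VReal (r_w i))) (1000 * (l i + 1) + 100 * r_L) (1000 * (r_G + 1) + 100 * r_L)"
proof -
  let ?g = "r_G + 1"
  let ?e = "VNat i # VReal K # VReal (real r_L) # G # enc_mat m l cl a # rv n p # rv m \<Delta> # VNat k # env"
  let ?ar = "enc_row (l i) (cl i) (a i)"
  note sm = cost_sum[OF r_sizes(4)[OF i]] and mx = cost_max[OF r_sizes(4)[OF i]]
  have D0: "\<Delta> i \<noteq> 0" using \<Delta>[OF i] by simp
  have H0: "r_H i \<noteq> 0" using r_H_pos[OF i] by simp
  have L0: "real r_L \<noteq> 0" using r_L_pos by simp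
  have 1: "cost ?e (idx x4 x0) ?ar 3 3"
    by (rule cost_flat') (use i in simp_all)
  have 2: "cost (?ar # ?e) (idx x7 x1) (VReal (\<Delta> i)) 3 3"
    by (rule cost_flat') (use i in simp_all)
  let ?e2 = "VReal (\<Delta> i) # ?ar # ?e"
  have 3: "cost ?e2 (Bind (Tabulate (len x1) (Bind (idx x2 x0)
        (rmul (idx x9 (fst_e x0)) (rmul (snd_e x0) (snd_e x0))))) sum_e)
     (VReal (r_Q i)) (2 + l i * 40 + 1 + (200 * l i + 20) + 1) (2 + 40 + 1 + (100 * (?g + 1) + 20) + 1)"
    unfolding r_Q_def
    by (rule cost_Bind[OF cost_Tabulate_const sm]; rule cost_flat'; use i cl_n in simp)
  let ?e3 = "VReal (r_Q i) # ?e2"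
  have 4: "cost ?e3 (Bind (Tabulate (len x2) (Bind (idx x3 x0)
        (rmul (idx x10 (fst_e x0)) (snd_e x0)))) sum_e)
     (VReal (r_M i)) (2 + l i * 40 + 1 + (200 * l i + 20) + 1) (2 + 40 + 1 + (100 * (?g + 1) + 20) + 1)"
    unfolding r_M_def
    by (rule cost_Bind[OF cost_Tabulate_const sm]; rule cost_flat'; use i cl_n in simp)
  let ?e4 = "VReal (r_M i) # ?e3"
  have 5: "cost ?e4 (Bind (Tabulate (len x3) (snd_e (idx x4 x0))) max_e)
     (VReal (r_mx i)) (2 + l i * 40 + 1 + (200 * l i + 20) + 1) (2 + 40 + 1 + (100 * (?g + 1) + 20) + 1)"
    unfolding r_mx_def
    by (rule cost_Bind[OF cost_Tabulate_const mx]; rule cost_flat'; use i cl_n in simp)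
  let ?e5 = "VReal (r_mx i) # ?e4"
  have 6: "cost ?e5 (radd (radd (rdiv (rmul (rlit 8) x2) (rmul x3 x3))
                          (rdiv (rmul (rlit 5) x0) x3))
                  (radd (rdiv x1 (rmul (Op1 ToReal x12) x3))
                          (rdiv (rlit 1) x7))) (VReal (r_H i)) 50 50"
    by (rule cost_flat') (use D0 L0 nm in \<open>simp_all add: r_H_def\<close>)
  have 7: "cost (VReal (r_H i) # ?e5) (rdiv (rlit 1) x0) (VReal (r_h i)) 5 5"
    by (rule cost_flat') (use H0 in \<open>simp_all add: r_h_def\<close>)
  let ?e7 = "VReal (r_h i) # VReal (r_H i) # ?e5"
  have 8: "cost ?e7 (rdiv x0 x5) (VReal (r_lam i)) 5 5"
    by (rule cost_flat') (use D0 in \<open>simp_all add: r_lam_def\<close>)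
  let ?st = "\<lambda>t. VReal ((1 - r_h i / (8 * real r_L)) ^ t)"
  have 9: "cost ?e7 (rep_e x9 (rlit 1) (rmul x0 (rsub (rlit 1) (rdiv x2 (rmul (rlit 8) x11)))))
     (VReal (r_w i)) (1 + 2 + r_L * (20 + 30) + 20) (1 + 2 + r_L * (20 + 30) + 20)"
    unfolding r_w_def
    by (rule cost_rep[where st = ?st]; rule cost_flat'; use L0 in simp)
  have 10: "cost ?e7 (pair_e (rdiv x0 x5)
       (rep_e x9 (rlit 1) (rmul x0 (rsub (rlit 1) (rdiv x2 (rmul (rlit 8) x11))))))
     (vpair (VReal (r_lam i)) (VReal (r_w i))) (50 + 50 * r_L) (50 + 50 * r_L)"
    by (rule cost_Op2'[OF 8 9]) simp_all
  show ?thesis unfolding par_body_def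
    by (rule cost_mono[OF cost_Bind[OF 1 cost_Bind[OF 2 cost_Bind[OF 3 cost_Bind[OF 4 cost_Bind[OF 5
       cost_Bind[OF 6 cost_Bind[OF 7 10]]]]]]]]) simp_all
qed

lemma cost_walk:
  "cost (enc_mat m l cl a # rv n p # rv m \<Delta> # VNat k # env) walk_e
    (vpair (rv n (\<lambda>j. if r_p j < 1 then 0 else 1)) (tab m (\<lambda>i. VNat (if r_W i + r_W (i + m) < 1 then 0 else 1))))
    (100000 * (row_size m l + n + 1) * ((r_G + 1) * (r_T + 1) + r_L)) (100000 * (r_G + 2) * ((r_G + 1) * (r_T + 1) + r_L))"
proof -
  let ?A = "enc_mat m l cl a"
  let ?sz = "row_size m l + n + 1"
  let ?e = "?A # rv n p # rv m \<Delta> # VNat k # env"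
  have "cost ?e (nadd (nadd (len x1) (len x2)) (Lit 1)) (VNat (n + m + 1)) 7 7"
    by (rule cost_flat') simp_all
  from cost_bitlen[OF this, folded r_G_def]
  have 1: "cost ?e (bitlen_e (nadd (nadd (len x1) (len x2)) (Lit 1)))
    (VReal (real r_G)) (7 + 20 * r_G + 30) (7 + 20 * r_G + 30)" .
  let ?e1 = "VReal (real r_G) # ?e"
  have 2: "cost ?e1 (rmul (rlit 256) (radd x0 (rlit 3))) (VReal (real r_L)) 7 7"
    by (rule cost_flat') (simp_all add: r_L_def)
  let ?e2 = "VReal (real r_L) # ?e1"
  have 3: "cost ?e2 (rmul (rlit 2) (radd (Op1 ToReal x5) x0)) (VReal (real r_K)) 7 7"
    by (rule cost_flat') (simp_all add: r_K_def)
  let ?e3 = "VReal (real r_K) # ?e2"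
  let ?par = "tab m (\<lambda>i. vpair (VReal (r_lam i)) (VReal (r_w i)))"
  have 4: "cost ?e3 (Tabulate (len x5) par_body) ?par
    (2 + (\<Sum>i<m. (1000 + 100 * r_L) * (l i + 1)) + 1) (2 + (1000 * (r_G + 1) + 100 * r_L) + 1)"
  proof (rule cost_Tabulate)
    show "cost ?e3 (len x5) (VNat m) 2 2" by (rule cost_flat') simp_all
  qed (rule cost_mono[OF cost_par], simp_all add: algebra_simps)
  note 4 = 4[unfolded sum_row_size]
  let ?e4 = "?par # ?e3"
  have K0: "real r_K \<noteq> 0" using nm by (simp add: r_K_def)
  have 5: "cost ?e4 (rdiv (rlit 1) x1) (VReal r_eps) 5 5"
    by (rule cost_flat') (use K0 in \<open>simp_all add: r_eps_def\<close>)
  let ?e5 = "VReal r_eps # ?e4"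
  have 6: "cost ?e5 (Tabulate (len x1) (fst_e (idx x2 x0))) (rv m r_lam) (2 + m * 10 + 1) (2 + 10 + 1)"
    by (rule cost_Tabulate_const; rule cost_flat'; simp)
  let ?e6 = "rv m r_lam # ?e5"
  have 71: "cost ?e6 x7 (rv n p) 1 1" by (rule cost_flat') simp_all
  have 72: "cost ?e6 (Tabulate (len x7) (rdiv (rlit 1) (rmul (rlit 4) (Op1 ToReal (len x8)))))
     (rv n (\<lambda>_. 1 / (4 * real n))) (2 + n * 20 + 1) (2 + 20 + 1)"
    by (rule cost_Tabulate_const; rule cost_flat'; use nm in simp)
  have 73: "cost ?e6 (Tabulate (nadd (len x2) (len x2)) (Bind (base_e x3) (snd_e (idx x4 x0))))
     (rv (m + m) (\<lambda>r. r_w (base m r))) (5 + (m + m) * 30 + 1) (5 + 30 + 1)"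
    by (rule cost_Tabulate_const; rule cost_flat'; auto simp: base_e_def base_def)
  have 7: "cost ?e6 (pair_e
        (pair_e x7 (Tabulate (len x7) (rdiv (rlit 1) (rmul (rlit 4) (Op1 ToReal (len x8))))))
        (Tabulate (nadd (len x2) (len x2)) (Bind (base_e x3) (snd_e (idx x4 x0)))))
     (enc_st n m r_init) (60 * (n + m + 1)) 100"
    by (rule cost_Op2'[OF cost_Op2[OF 71 72] 73]) (simp_all add: enc_st_def r_init_def)
  let ?e7 = "enc_st n m r_init # ?e6"
  have 8: "cost ?e7 (rmul (rmul (rlit 32) (rmul x4 x4)) (radd (rmul (rlit 3) x6) (rlit 4)))
     (VReal (real r_T)) 20 20"
    by (rule cost_flat') (simp_all add: r_T_def)
  let ?e8 = "VReal (real r_T) # ?e7"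
  have 9: "cost ?e8 x7 (VReal (real r_G)) 1 1" by (rule cost_flat') simp_all
  let ?e9 = "VReal (real r_G) # ?e8"
  have 10: "cost ?e9 x4 (VReal r_eps) 1 1" by (rule cost_flat') simp_all
  let ?e10 = "VReal r_eps # ?e9"
  have 11: "cost ?e10 x4 (rv m r_lam) 1 1" by (rule cost_flat') simp_all
  let ?e11 = "rv m r_lam # ?e10"
  have 12: "cost ?e11 x11 ?A 1 1" by (rule cost_flat') simp_all
  let ?e12 = "?A # ?e11"
  let ?sw = "20000 * ?sz * (r_G + 1)" and ?sd = "10000 * (r_G + 1 + 1) * (r_G + 1)"
  have 13: "cost ?e12 (rep_e x4 x5 step_e) (enc_st n m (r_walk r_T))
     (1 + 1 + r_T * (?sw + 30) + 20) (1 + 1 + r_T * (?sd + 30) + 20)"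
  proof (rule cost_rep[where st = "\<lambda>t. enc_st n m (r_walk t)"])
    show "cost ?e12 x4 (VReal (real r_T)) 1 1" by (rule cost_flat') simp_all
    show "cost ?e12 x5 (enc_st n m (r_walk 0)) 1 1" by (rule cost_flat') (simp_all add: r_walk_def)
    show "cost (enc_st n m (r_walk t) # x # ?e12) step_e (enc_st n m (r_walk (Suc t))) ?sw ?sd" for t x
      using cost_step[OF cl cl_n r_sizes(2,3,4)] by (simp add: r_walk_def)
  qed
  let ?e13 = "enc_st n m (r_walk r_T) # ?e12"
  obtain Z where st: "r_walk r_T = (r_p, Z, r_W)"
    unfolding r_p_def r_W_def by (metis prod.collapse)
  have 14: "cost ?e13 (fst_e (fst_e x0)) (rv n r_p) 5 5"
    by (rule cost_flat') (simp_all add: st enc_st_def)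
  have 15: "cost (rv n r_p # ?e13) (snd_e x1) (rv (m + m) r_W) 3 3"
    by (rule cost_flat') (simp_all add: st enc_st_def)
  let ?e15 = "rv (m + m) r_W # rv n r_p # ?e13"
  have 161: "cost ?e15 (Tabulate (len x1) (Cond (rless (idx x2 x0) (rlit 1)) (rlit 0) (rlit 1)))
     (rv n (\<lambda>j. if r_p j < 1 then 0 else 1)) (2 + n * 20 + 1) (2 + 20 + 1)"
    by (rule cost_Tabulate_const; rule cost_flat'; simp)
  have 162: "cost ?e15 (Tabulate (len x4) (Cond (rless (radd (idx x1 x0)
         (idx x1 (nadd x0 (len x5)))) (rlit 1)) (Lit 0) (Lit 1)))
     (tab m (\<lambda>i. VNat (if r_W i + r_W (i + m) < 1 then 0 else 1))) (2 + m * 20 + 1) (2 + 20 + 1)"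
    by (rule cost_Tabulate_const; rule cost_flat'; simp)
  have 16: "cost ?e15 (pair_e
      (Tabulate (len x1) (Cond (rless (idx x2 x0) (rlit 1)) (rlit 0) (rlit 1)))
      (Tabulate (len x4) (Cond (rless (radd (idx x1 x0)
         (idx x1 (nadd x0 (len x5)))) (rlit 1)) (Lit 0) (Lit 1))))
     (vpair (rv n (\<lambda>j. if r_p j < 1 then 0 else 1)) (tab m (\<lambda>i. VNat (if r_W i + r_W (i + m) < 1 then 0 else 1))))
     (20 * (n + m + 1)) 50"
    by (rule cost_Op2'[OF 161 162]) simp_all
  have msz: "m \<le> row_size m l" by (rule row_size_ge)
  define X where "X = (r_G + 1) * (r_T + 1) + r_L"
  have X: "r_G + 1 \<le> X" "r_L \<le> X" "1 \<le> X" "r_T * (r_G + 1) \<le> X" "r_T \<le> X" by (simp_all add: X_def algebra_simps)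
  have w: "7 + 20 * r_G + 30 + (7 + (7 + (2 + (1000 + 100 * r_L) * row_size m l + 1 + (5 + (2 + m * 10 + 1 + (60 * (n + m + 1) +
    (20 + (1 + (1 + (1 + (1 + (1 + 1 + r_T * (?sw + 30) + 20 + (5 + (3 + 20 * (n + m + 1) + 1) + 1) + 1) + 1) + 1) + 1) + 1) + 1) + 1) + 1) + 1) + 1) + 1) + 1) + 1
    \<le> 100000 * ?sz * X"
  proof -
    have "r_T * (?sw + 30) = 20000 * ?sz * (r_T * (r_G + 1)) + 30 * r_T" by (simp add: algebra_simps)
    also have "\<dots> \<le> 20000 * ?sz * X + 30 * X" using X by (intro add_mono mult_le_mono) auto
    finally have 1: "r_T * (?sw + 30) \<le> 20000 * ?sz * X + 30 * X" .
    have "?sz * 1 \<le> ?sz * X" using X by (intro mult_le_mono) simp_all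
    then have 2: "?sz \<le> ?sz * X" by (simp only: mult_1_right)
    have "row_size m l \<le> ?sz" by simp
    note 2 = 2 le_trans[OF this 2]
    have "1 * X \<le> ?sz * X" by (intro mult_le_mono) simp_all
    note 2 = 2 this
    have 3: "(1000 + 100 * r_L) * row_size m l \<le> 1100 * X * ?sz" using X by (intro mult_le_mono) auto
    have 4: "n + m + 1 \<le> ?sz" using msz by simp
    \<comment> \<open>With variables in place of the products, the comparison of the accumulated
      cost is linear.\<close>
    have gen: "7 + 20 * r_G + 30 + (7 + (7 + (2 + P2 + 1 + (5 + (2 + m * 10 + 1 + (60 * (n + m + 1) +
    (20 + (1 + (1 + (1 + (1 + (1 + 1 + P1 + 20 + (5 + (3 + 20 * (n + m + 1) + 1) + 1) + 1) + 1) + 1) + 1) + 1) + 1) + 1) + 1) + 1) + 1) + 1) + 1) + 1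
      \<le> 100000 * S"
      if "P1 \<le> 20000 * S + 30 * X" "P2 \<le> 1100 * S" "n + m + 1 \<le> S" "X \<le> S" for P1 P2 S
      using that X(1,3) by simp
    show ?thesis unfolding mult.assoc[of 100000]
      by (rule gen) (use 1 2 3 le_trans[OF 4 2(1)] in \<open>simp_all only: mult.assoc mult.commute[of X]\<close>)
  qed
  have d: "7 + 20 * r_G + 30 + (7 + (7 + (2 + (1000 * (r_G + 1) + 100 * r_L) + 1 + (5 + (2 + 10 + 1 + (100 +
    (20 + (1 + (1 + (1 + (1 + (1 + 1 + r_T * (?sd + 30) + 20 + (5 + (3 + 50 + 1) + 1) + 1) + 1) + 1) + 1) + 1) + 1) + 1) + 1) + 1) + 1) + 1) + 1) + 1
    \<le> 100000 * (r_G + 2) * X"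
  proof -
    have "r_T * (?sd + 30) = 10000 * (r_G + 2) * (r_T * (r_G + 1)) + 30 * r_T" by (simp add: algebra_simps)
    also have "\<dots> \<le> 10000 * (r_G + 2) * X + 30 * X" using X by (intro add_mono mult_le_mono) auto
    finally have 1: "r_T * (?sd + 30) \<le> 10000 * (r_G + 2) * X + 30 * X" .
    have "1 * X \<le> (r_G + 2) * X" by (intro mult_le_mono) simp_all
    then have 2: "X \<le> (r_G + 2) * X" by (simp only: mult_1)
    have gen: "7 + 20 * r_G + 30 + (7 + (7 + (2 + (1000 * (r_G + 1) + 100 * r_L) + 1 + (5 + (2 + 10 + 1 + (100 +
    (20 + (1 + (1 + (1 + (1 + (1 + 1 + P1 + 20 + (5 + (3 + 50 + 1) + 1) + 1) + 1) + 1) + 1) + 1) + 1) + 1) + 1) + 1) + 1) + 1) + 1) + 1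
      \<le> 100000 * S"
      if "P1 \<le> 10000 * S + 30 * X" "X \<le> S" for P1 S
      using that X(1,2,3) by simp
    show ?thesis unfolding mult.assoc[of 100000]
      by (rule gen) (use 1 2 in \<open>simp_all only: mult.assoc\<close>)
  qed
  show ?thesis unfolding walk_e_def X_def[symmetric]
    by (rule cost_mono[OF cost_Bind[OF 1 cost_Bind[OF 2 cost_Bind[OF 3 cost_Bind[OF 4 cost_Bind[OF 5 cost_Bind[OF 6
      cost_Bind[OF 7 cost_Bind[OF 8 cost_Bind[OF 9 cost_Bind[OF 10 cost_Bind[OF 11 cost_Bind[OF 12 cost_Bind[OF 13
      cost_Bind[OF 14 cost_Bind[OF 15 16]]]]]]]]]]]]]]] w d])
qed

end

section \<open>Quality of the rounding\<close>

text \<open>For \<open>u \<le> 1 / 2\<close> one has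
  \<open>1 \<le> (1 - u) * (1 + 2 * u) \<le> (1 - u) * exp (2 * u)\<close>.\<close>

lemma power_one_minus_ge: "0 \<le> u \<Longrightarrow> u \<le> 1 / 2 \<Longrightarrow> exp (- (2 * u * real N)) \<le> (1 - u) ^ N" for u :: real
proof -
  assume u: "0 \<le> u" "u \<le> 1 / 2"
  have "u * (2 * u) \<le> u * 1" using u by (intro mult_left_mono) auto
  then have "1 \<le> (1 - u) * (1 + 2 * u)" by (simp add: algebra_simps)
  also have "\<dots> \<le> (1 - u) * exp (2 * u)" using u exp_ge_add_one_self[of "2 * u"] by (intro mult_left_mono) auto
  finally have "exp (- (2 * u)) * 1 \<le> exp (- (2 * u)) * ((1 - u) * exp (2 * u))" by (intro mult_left_mono) auto
  also have "\<dots> = (1 - u) * (exp (- (2 * u)) * exp (2 * u))" by (simp only: mult_ac)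
  also have "\<dots> = 1 - u" by (simp add: exp_minus)
  finally have "exp (- (2 * u)) ^ N \<le> (1 - u) ^ N" by (intro power_mono) auto
  then show ?thesis by (simp add: exp_of_nat_mult[symmetric] mult_ac)
qed

lemma power_one_minus_le: "0 \<le> u \<Longrightarrow> u \<le> 1 \<Longrightarrow> (1 - u) ^ N \<le> exp (- (u * real N))" for u :: real
proof -
  assume u: "0 \<le> u" "u \<le> 1"
  have "(1 - u) ^ N \<le> exp (- u) ^ N" using exp_ge_add_one_self[of "- u"] u by (intro power_mono) auto
  then show ?thesis by (simp add: exp_of_nat_mult[symmetric] mult_ac)
qed

context rounding
begin

lemma H_terms:
  assumes i: "i < m"
  shows "8 * r_Q i / (\<Delta> i * \<Delta> i) \<le> r_H i" "5 * r_mx i / \<Delta> i \<le> r_H i"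
    "r_M i / (real k * \<Delta> i) \<le> r_H i" "1 / real r_L \<le> r_H i"
proof -
  have "0 \<le> 8 * r_Q i / (\<Delta> i * \<Delta> i)" "0 \<le> 5 * r_mx i / \<Delta> i" "0 \<le> r_M i / (real k * \<Delta> i)" "0 \<le> 1 / real r_L"
    using r_nonneg[OF i] \<Delta>[OF i] by (simp_all add: zero_le_divide_iff)
  then show "8 * r_Q i / (\<Delta> i * \<Delta> i) \<le> r_H i" "5 * r_mx i / \<Delta> i \<le> r_H i"
    "r_M i / (real k * \<Delta> i) \<le> r_H i" "1 / real r_L \<le> r_H i"
    unfolding r_H_def by linarith+
qed

text \<open>The upper bounds are the summands of \<open>r_H i\<close> cleared of denominators. The 5
  yields the 1/5 used in \<open>beta_bound\<close>; the 8 yields the quarter of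
  \<open>r_lam i * \<Delta> i\<close> granted to the variance.\<close>

lemma lam_bounds:
  assumes i: "i < m"
  shows "0 < r_lam i" "r_lam i * r_mx i \<le> 1 / 5" "r_lam i * r_M i \<le> real k" "r_lam i * \<Delta> i = r_h i"
    "0 < r_h i" "r_h i \<le> real r_L" "8 * (r_lam i * r_Q i) \<le> \<Delta> i"
proof -
  note H = r_H_pos[OF i] and D = \<Delta>[OF i] and T = H_terms[OF i]
  have lam: "r_lam i = 1 / (r_H i * \<Delta> i)" by (simp add: r_lam_def r_h_def)
  show "0 < r_lam i" "r_lam i * \<Delta> i = r_h i" "0 < r_h i" using H D by (simp_all add: lam r_h_def)
  show "r_lam i * r_mx i \<le> 1 / 5" using T(2) H D by (simp add: lam field_simps)
  show "r_lam i * r_M i \<le> real k" using T(3) H D nm by (simp add: lam field_simps)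
  show "r_h i \<le> real r_L" using T(4) H r_L_pos by (simp add: r_h_def field_simps)
  show "8 * (r_lam i * r_Q i) \<le> \<Delta> i" using T(1) H D by (simp add: lam field_simps)
qed

text \<open>The lower bound is what a live row needs to control its deviation, the upper bound
  enters the count of bad rows. The exponents differ by a factor 2 because \<open>1 - u\<close> is
  squeezed between \<open>exp (- 2 u)\<close> and \<open>exp (- u)\<close>.\<close>

lemma w_bounds:
  assumes i: "i < m"
  shows "exp (- (r_h i / 4)) \<le> r_w i" "r_w i \<le> exp (- (r_h i / 8))"
proof -
  have L: "0 < real r_L" using r_L_pos by simp
  let ?u = "r_h i / (8 * real r_L)"
  have u: "0 \<le> ?u" "?u \<le> 1 / 8" using lam_bounds(5,6)[OF i] L by (simp_all add: field_simps)
  have e: "2 * ?u * real r_L = r_h i / 4" "?u * real r_L = r_h i / 8" using L by simp_all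
  show "exp (- (r_h i / 4)) \<le> r_w i"
    using power_one_minus_ge[of ?u r_L] u unfolding r_w_def e(1) by simp
  show "r_w i \<le> exp (- (r_h i / 8))"
    using power_one_minus_le[of ?u r_L] u unfolding r_w_def e(2) by simp
qed

lemma eps_bounds: "0 < r_eps" "r_eps \<le> 1 / 2"
  using nm by (simp_all add: r_eps_def r_K_def)

abbreviation "vinv \<equiv> walk_ok n m l cl a r_lam r_eps p (\<lambda>r. r_w (base m r))"

lemma eps_mean:
  assumes i: "i < m"
  shows "r_eps * (r_lam i * ((\<Sum>t<l i. a i t * p (cl i t)) + \<Delta> i / 2)) \<le> 1 / 2"
proof -
  have M: "(\<Sum>t<l i. a i t * p (cl i t)) = r_M i" by (simp add: r_M_def mult.commute)
  have "r_lam i * (r_M i + \<Delta> i / 2) = r_lam i * r_M i + r_h i / 2"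
    using lam_bounds(4)[OF i] by (simp add: algebra_simps)
  also have "\<dots> \<le> real k + real r_L" using lam_bounds(3,5,6)[OF i] by linarith
  finally have "r_eps * (r_lam i * (r_M i + \<Delta> i / 2)) \<le> r_eps * (real k + real r_L)"
    using eps_bounds by (intro mult_left_mono) auto
  also have "\<dots> = 1 / 2" using nm by (simp add: r_eps_def r_K_def field_simps)
  finally show ?thesis unfolding M .
qed

lemma lam_var:
  assumes i: "i < m"
  shows "2 * (r_lam i)\<^sup>2 * (\<Sum>t<l i. p (cl i t) * (a i t)\<^sup>2) \<le> r_lam i * \<Delta> i / 4"
proof -
  have "(\<Sum>t<l i. p (cl i t) * (a i t)\<^sup>2) = r_Q i" by (simp add: r_Q_def power2_eq_square)
  moreover have "r_lam i * (8 * (r_lam i * r_Q i)) \<le> r_lam i * \<Delta> i"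
    using lam_bounds[OF i] by (intro mult_left_mono) auto
  ultimately show ?thesis by (simp add: power2_eq_square)
qed

lemma lam_entry:
  assumes "i < m" "t < l i"
  shows "r_lam i * a i t \<le> 1 / 5"
proof -
  have "r_lam i * a i t \<le> r_lam i * r_mx i"
    using lam_bounds(1)[OF assms(1)] r_nonneg(4)[OF assms] by (intro mult_left_mono) auto
  then show ?thesis using lam_bounds(2)[OF assms(1)] by linarith
qed

lemma w_base:
  "i < m \<Longrightarrow> exp (- (r_lam i * \<Delta> i / 4)) \<le> r_w (base m i)"
  "i < m \<Longrightarrow> r_w (base m (i + m)) = r_w (base m i)"
  using w_bounds(1)[of i] lam_bounds(4)[of i] by (simp_all add: base_def)

lemmas walk_assms = cl cl_n r_sizes(1) a eps_bounds p \<Delta> lam_bounds(1)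
  lam_entry eps_mean w_base lam_var

lemma walk_facts:
  shows "vinv t (r_walk t)" "w_tot n m (r_walk t) \<le> 2 * (\<Sum>i<m. r_w i) + 1 / 4"
proof -
  have "vinv t (r_walk t) \<and> w_tot n m (r_walk t) \<le> 2 * (\<Sum>i<m. r_w (base m i)) + 1 / 4"
    unfolding r_walk_def r_init_def by (rule walk_inv[where l = l and cl = cl and a = a and lam = r_lam and ?p0.0 = p and ?W0.0 = "\<lambda>r. r_w (base m r)" and \<Delta> = \<Delta>, OF walk_assms nm(1)])
  moreover have "(\<Sum>i<m. r_w (base m i)) = (\<Sum>i<m. r_w i)" by (intro sum.cong) (simp_all add: base_def)
  ultimately show "vinv t (r_walk t)" "w_tot n m (r_walk t) \<le> 2 * (\<Sum>i<m. r_w i) + 1 / 4" by simp_all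
qed

text \<open>Such a row is frozen from the start and hence bad. A good row therefore starts with a
  weight below 1/2, which makes its largest entry small against \<open>\<Delta> i\<close>, as the
  final rounding requires.\<close>

lemma frozen_walk:
  assumes i: "i < m" and f: "1 \<le> r_w i + r_w i"
  shows "snd (snd (r_walk t)) i = r_w i \<and> snd (snd (r_walk t)) (i + m) = r_w i"
proof (induction t)
  case 0
  show ?case using i by (simp add: r_walk_def r_init_def base_def)
next
  case (Suc t)
  obtain p' Z W where st: "r_walk t = (p', Z, W)" by (metis prod_cases3)
  then have W: "W i = r_w i" "W (i + m) = r_w i" using Suc by auto
  have "snd (snd (w_step n m r_G l cl a r_lam r_eps (p', Z, W))) r = W r" if "r = i \<or> r = i + m" for r
    by (rule step_frozen[where l = l and cl = cl and a = a and lam = r_lam and ?p0.0 = p and ?W0.0 = "\<lambda>r. r_w (base m r)" and \<Delta> = \<Delta>, OF walk_assms]) (use that i f W in \<open>auto simp: base_def\<close>)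
  moreover have "r_walk (Suc t) = w_step n m r_G l cl a r_lam r_eps (p', Z, W)"
    using st by (simp add: r_walk_def)
  ultimately show ?case using W by simp
qed

lemma r_W_pos: "r < m + m \<Longrightarrow> 0 < r_W r"
  using walk_facts(1)[of r_T] unfolding walk_ok_def r_W_def by (cases "r_walk r_T") auto

lemma card_bad: "real (card {i. i < m \<and> 1 \<le> r_W i + r_W (i + m)}) \<le> 2 * (\<Sum>i<m. r_w i) + 1 / 4"
proof -
  let ?I = "{i. i < m \<and> 1 \<le> r_W i + r_W (i + m)}"
  obtain Z where st: "r_walk r_T = (r_p, Z, r_W)" unfolding r_p_def r_W_def by (metis prod.collapse)
  have Z: "0 \<le> Z j" if "j < n" for j using walk_facts(1)[of r_T] that unfolding st walk_ok_def by auto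
  have "real (card ?I) = (\<Sum>i\<in>?I. 1)" by simp
  also have "\<dots> \<le> (\<Sum>i\<in>?I. r_W i + r_W (i + m))" by (rule sum_mono) auto
  also have "\<dots> \<le> (\<Sum>i<m. r_W i + r_W (i + m))"
  proof (intro sum_mono2)
    fix i assume "i \<in> {..<m} - ?I"
    then show "0 \<le> r_W i + r_W (i + m)" using r_W_pos[of i] r_W_pos[of "i + m"] by simp
  qed auto
  also have "\<dots> = (\<Sum>r<m + m. r_W r)" by (simp add: sum.distrib sum_lessThan_add)
  also have "\<dots> \<le> w_tot n m (r_walk r_T)" using sum_nonneg[of "{..<n}" Z] Z by (simp add: st w_tot_def)
  also have "\<dots> \<le> 2 * (\<Sum>i<m. r_w i) + 1 / 4" by (rule walk_facts)
  finally show ?thesis .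
qed

text \<open>A single potential is at most the total, which is at most \<open>3 m\<close> since
  initial weights are at most 1. With the decay \<open>1 / (16 n^2 m)\<close>, the bound on the
  square root of \<open>r_p j\<close> is at most \<open>3 / (4 n)\<close>, so a value other than 1
  is at most \<open>1 / n^2\<close>.\<close>

lemma final_round:
  assumes j: "j < n"
  shows "\<bar>r_p j - (if r_p j < 1 then 0 else 1)\<bar> \<le> 1 / real n"
proof -
  obtain Z where st: "r_walk r_T = (r_p, Z, r_W)" unfolding r_p_def r_W_def by (metis prod.collapse)
  let ?\<rho> = "1 - r_eps\<^sup>2 / 32"
  have inv: "0 \<le> r_p j" "r_p j \<le> 1" "0 \<le> Z j" "r_p j = 1 \<or> r_p j \<le> (4 * real n * ?\<rho> ^ r_T * Z j)\<^sup>2"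
    using walk_facts(1)[of r_T] j unfolding st walk_ok_def by auto
  have Zn: "0 \<le> Z j" if "j < n" for j using walk_facts(1)[of r_T] that unfolding st walk_ok_def by auto
  have "Z j \<le> (\<Sum>j<n. Z j)" using j Zn by (intro member_le_sum) auto
  also have "\<dots> \<le> w_tot n m (r_walk r_T)"
    using sum_nonneg[of "{..<m + m}" r_W] r_W_pos by (simp add: st w_tot_def less_imp_le)
  also have "\<dots> \<le> 2 * (\<Sum>i<m. r_w i) + 1 / 4" by (rule walk_facts)
  also have "(\<Sum>i<m. r_w i) \<le> (\<Sum>i<m. 1)"
  proof (rule sum_mono)
    fix i assume "i \<in> {..<m}"
    then show "r_w i \<le> 1" using w_bounds(2)[of i] lam_bounds(5)[of i] by (auto intro: order_trans)
  qed
  finally have Zj: "Z j \<le> 2 * real m + 1 / 4" by simp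
  then have Zj: "Z j \<le> 3 * real m" using nm by simp
  have rho: "?\<rho> ^ r_T \<le> 1 / (16 * real n * real n * real m)"
  proof -
    let ?B = "3 * r_G + 4"
    let ?u = "r_eps\<^sup>2 / 32"
    have e2: "r_eps\<^sup>2 \<le> 1" using eps_bounds by (simp add: power_le_one)
    have K: "0 < real r_K" using nm by (simp add: r_K_def)
    have "real r_T = 32 * (real r_K * real r_K) * real ?B" by (simp only: r_T_def of_nat_mult of_nat_numeral)
    then have T: "?u * real r_T = real ?B" using K by (simp add: r_eps_def power2_eq_square)
    have "?\<rho> ^ r_T \<le> exp (- (?u * real r_T))" by (rule power_one_minus_le) (use e2 in auto)
    also have "\<dots> = exp (-1) ^ ?B" unfolding T exp_of_nat_mult[symmetric] by simp
    also have "\<dots> \<le> (1 / 2) ^ ?B"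
    proof (rule power_mono)
      have "2 \<le> exp (1::real)" using exp_ge_add_one_self[of 1] by simp
      then show "exp (-1) \<le> (1 / 2 :: real)" by (simp add: exp_minus field_simps)
    qed simp
    also have "\<dots> = 1 / (16 * 2 ^ r_G * 2 ^ r_G * 2 ^ r_G)"
    proof -
      have "?B = r_G + r_G + r_G + 4" by simp
      then have "(2::real) ^ ?B = 16 * 2 ^ r_G * 2 ^ r_G * 2 ^ r_G" by (simp only: power_add) simp
      then show ?thesis by (simp add: power_one_over)
    qed
    also have "\<dots> \<le> 1 / (16 * real n * real n * real m)"
    proof -
      have "n + m + 1 < 2 ^ r_G" unfolding r_G_def by (rule bitlen_less)
      then have "real n \<le> real (2 ^ r_G)" "real m \<le> real (2 ^ r_G)" by (simp_all only: of_nat_le_iff)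
      then have g: "real n \<le> 2 ^ r_G" "real m \<le> 2 ^ r_G" by (simp_all only: of_nat_power of_nat_numeral)
      have "16 * real n * real n * real m \<le> 16 * 2 ^ r_G * 2 ^ r_G * 2 ^ r_G"
        using g by (intro mult_mono) auto
      then show ?thesis using nm by (intro divide_left_mono) auto
    qed
    finally show ?thesis .
  qed
  have "4 * real n * ?\<rho> ^ r_T * Z j \<le> 4 * real n * (1 / (16 * real n * real n * real m)) * (3 * real m)"
    using rho Zj inv(3) by (intro mult_mono mult_left_mono) auto
  also have "\<dots> \<le> 1 / real n" using nm by (simp add: field_simps)
  finally have x: "4 * real n * ?\<rho> ^ r_T * Z j \<le> 1 / real n" .
  have "r_eps\<^sup>2 \<le> 1" using eps_bounds by (simp add: power_le_one)
  then have x0: "0 \<le> 4 * real n * ?\<rho> ^ r_T * Z j" using inv(3) by simp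
  have "(4 * real n * ?\<rho> ^ r_T * Z j)\<^sup>2 \<le> (1 / real n)\<^sup>2" using x x0 by (rule power_mono)
  also have "\<dots> \<le> 1 / real n" using nm by (simp add: power2_eq_square field_simps)
  finally show ?thesis using inv by auto
qed

text \<open>The final rounding errs by at most \<open>1 / n\<close> in each of at most
  \<open>n\<close> columns of the row, in total by at most one largest entry.\<close>

lemma good_row:
  assumes i: "i < m" and good: "r_W i + r_W (i + m) < 1"
  shows "\<bar>\<Sum>t<l i. a i t * (p (cl i t) - (if r_p (cl i t) < 1 then 0 else 1))\<bar> \<le> \<Delta> i"
proof -
  obtain Z where st: "r_walk r_T = (r_p, Z, r_W)" unfolding r_p_def r_W_def by (metis prod.collapse)
  have r_p: "0 \<le> r_p j" "r_p j \<le> 1" if "j < n" for j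
    using walk_facts(1)[of r_T] that unfolding st walk_ok_def by auto
  let ?q = "\<lambda>j. if r_p j < 1 then 0 else 1 :: real"
  have "r_w i + r_w i < 1"
  proof (rule ccontr)
    assume "\<not> ?thesis"
    then have "r_W i = r_w i" "r_W (i + m) = r_w i" using frozen_walk[OF i, of r_T] st by auto
    then show False using good \<open>\<not> r_w i + r_w i < 1\<close> by simp
  qed
  \<comment> \<open>A weight below 1/2 forces \<open>r_h i\<close> above 1, hence
    \<open>r_H i\<close> below 1, and the second summand of \<open>r_H i\<close> bounds the largest
    entry by \<open>\<Delta> i / 5\<close>.\<close>
  then have "exp (- (r_h i / 4)) < 1 / 2" using w_bounds(1)[OF i] by simp
  then have h1: "1 < r_h i" using exp_ge_add_one_self[of "- (r_h i / 4)"] by simp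
  have "r_H i < 1" using h1 r_H_pos[OF i] by (simp add: r_h_def field_simps)
  then have "\<Delta> i * r_H i \<le> \<Delta> i * 1" using \<Delta>[OF i] by (intro mult_left_mono) auto
  moreover have "5 * r_mx i \<le> \<Delta> i * r_H i" using H_terms(2)[OF i] \<Delta>[OF i] by (simp add: field_simps)
  ultimately have mx: "r_mx i \<le> \<Delta> i / 5" by simp
  let ?X = "\<Sum>t<l i. a i t * (r_p (cl i t) - p (cl i t))"
  let ?e = "2 * (r_lam i)\<^sup>2 * (w_V l cl a r_p i - w_V l cl a p i)"
  have act: "r_w (base m i) * exp (r_lam i * ?X + ?e) \<le> r_W i"
    "r_w (base m i) * exp (- r_lam i * ?X + ?e) \<le> r_W (i + m)"
    using walk_facts(1)[of r_T] i good unfolding st walk_ok_def by (auto simp: row_dev_def)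
  have pos: "0 < r_W i" "0 < r_W (i + m)" using r_W_pos i by auto
  have dev: "\<sigma> * ?X < \<Delta> i / 2"
    if "r_w (base m i) * exp (\<sigma> * r_lam i * ?X + ?e) < 1" "\<sigma> = 1 \<or> \<sigma> = -1" for \<sigma>
    by (rule active_dev[where l = l and cl = cl and a = a and lam = r_lam and ?p0.0 = p and ?W0.0 = "\<lambda>r. r_w (base m r)" and \<Delta> = \<Delta>, OF walk_assms, where p = r_p]) (use r_p i that in auto)
  have X: "\<bar>?X\<bar> < \<Delta> i / 2" using dev[of 1] dev[of "-1"] act pos good by simp
  have "\<bar>\<Sum>t<l i. a i t * (r_p (cl i t) - ?q (cl i t))\<bar> \<le> (\<Sum>t<l i. \<bar>a i t * (r_p (cl i t) - ?q (cl i t))\<bar>)"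
    by (rule sum_abs)
  also have "\<dots> \<le> (\<Sum>t<l i. r_mx i * (1 / real n))"
  proof (rule sum_mono)
    fix t assume "t \<in> {..<l i}"
    then have t: "t < l i" by simp
    show "\<bar>a i t * (r_p (cl i t) - ?q (cl i t))\<bar> \<le> r_mx i * (1 / real n)"
      unfolding abs_mult using r_nonneg(3,4)[OF i] a[OF i t] final_round[OF cl_n[OF i t]] t
      by (intro mult_mono) auto
  qed
  also have "\<dots> = real (l i) * (1 / real n) * r_mx i" by simp
  also have "\<dots> \<le> 1 * r_mx i"
    using l_n[OF i] nm r_nonneg(3)[OF i] by (intro mult_right_mono) auto
  also have "\<dots> \<le> \<Delta> i / 2" using mx \<Delta>[OF i] by simp
  finally have R: "\<bar>\<Sum>t<l i. a i t * (r_p (cl i t) - ?q (cl i t))\<bar> \<le> \<Delta> i / 2" .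
  have "(\<Sum>t<l i. a i t * (p (cl i t) - ?q (cl i t))) =
    (\<Sum>t<l i. a i t * (r_p (cl i t) - ?q (cl i t))) - ?X"
    unfolding sum_subtractf[symmetric] by (intro sum.cong) (simp_all add: algebra_simps)
  then show ?thesis using R X by linarith
qed

lemma exp_neg_L: "exp (- (real r_L / 32)) \<le> 1 / (8 * real m)"
proof -
  have "n + m + 1 < 2 ^ r_G" unfolding r_G_def by (rule bitlen_less)
  then have "8 * m \<le> 2 ^ (r_G + 3)" by (simp add: power_add)
  then have "real (8 * m) \<le> real (2 ^ (r_G + 3))" by (simp only: of_nat_le_iff)
  then have 1: "8 * real m \<le> 2 ^ (r_G + 3)" by simp
  have "2 \<le> exp (1::real)" using exp_ge_add_one_self[of 1] by simp
  then have "2 ^ (r_G + 3) \<le> exp (1::real) ^ (r_G + 3)" by (rule power_mono) simp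
  also have "\<dots> = exp (real (r_G + 3))" unfolding exp_of_nat_mult[symmetric] by simp
  also have "\<dots> \<le> exp (real r_L / 32)" by (simp add: r_L_def)
  finally have "8 * real m \<le> exp (real r_L / 32)" using 1 by linarith
  then have "inverse (exp (real r_L / 32)) \<le> inverse (8 * real m)" using nm by (intro le_imp_inverse_le) auto
  then show ?thesis unfolding exp_minus by (simp only: inverse_eq_divide)
qed

text \<open>One of the four summands of \<open>r_H i\<close> is at least a quarter of the sum, so
  \<open>r_h i\<close> is at least 1/32 of the corresponding quotient: 4 times 8 for the variance,
  smaller factors otherwise. As \<open>r_w i \<le> exp (- (r_h i / 8))\<close>, this gives 256 = 32
  * 8. If the logarithmic summand dominates, the weight is at most \<open>1 / (8 m)\<close>.\<close>

lemma w_small: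
  assumes i: "i < m"
  shows "r_w i \<le> 1 / (8 * real m) \<or>
    0 < r_Q i \<and> r_w i \<le> exp (- ((\<Delta> i)\<^sup>2 / r_Q i / 256)) \<or>
    0 < r_mx i \<and> r_w i \<le> exp (- (\<Delta> i / r_mx i / 256)) \<or>
    0 < r_M i \<and> r_w i \<le> exp (- (\<Delta> i * real k / r_M i / 256))"
proof -
  note D = \<Delta>[OF i] and nn = r_nonneg(1-3)[OF i]
  have H: "0 < r_H i" by (rule r_H_pos[OF i])
  have L: "0 < real r_L" using r_L_pos by simp
  have w: "r_w i \<le> exp (- (y / 256))" if "y / 32 \<le> r_h i" for y
    using order_trans[OF w_bounds(2)[OF i], of "exp (- (y / 256))"] that by simp
  have h: "1 / (4 * x) \<le> r_h i" if "r_H i \<le> 4 * x" for x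
    unfolding r_h_def using that H by (intro divide_left_mono) auto
  consider "r_H i \<le> 4 * (8 * r_Q i / (\<Delta> i * \<Delta> i))" | "r_H i \<le> 4 * (5 * r_mx i / \<Delta> i)"
    | "r_H i \<le> 4 * (r_M i / (real k * \<Delta> i))" | "r_H i \<le> 4 * (1 / real r_L)"
    unfolding r_H_def by linarith
  then show ?thesis
  proof cases
    case 1
    then have "r_Q i \<noteq> 0" using H by auto
    then have Q: "0 < r_Q i" using nn by simp
    have "(\<Delta> i)\<^sup>2 / r_Q i / 32 = 1 / (4 * (8 * r_Q i / (\<Delta> i * \<Delta> i)))" by (simp add: power2_eq_square)
    then show ?thesis using Q w[of "(\<Delta> i)\<^sup>2 / r_Q i"] h[OF 1] by simp
  next
    case 2
    then have "r_mx i \<noteq> 0" using H by auto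
    then have Q: "0 < r_mx i" using nn by simp
    have "\<Delta> i / r_mx i / 32 \<le> \<Delta> i / r_mx i / 20" using D Q by (intro divide_left_mono) auto
    also have "\<dots> = 1 / (4 * (5 * r_mx i / \<Delta> i))" by simp
    finally show ?thesis using Q w[of "\<Delta> i / r_mx i"] h[OF 2] by simp
  next
    case 3
    then have "r_M i \<noteq> 0" using H by auto
    then have Q: "0 < r_M i" using nn by simp
    have "\<Delta> i * real k / r_M i / 32 \<le> \<Delta> i * real k / r_M i / 4" using D Q by (intro divide_left_mono) auto
    also have "\<dots> = 1 / (4 * (r_M i / (real k * \<Delta> i)))" by (simp add: mult.commute)
    finally show ?thesis using Q w[of "\<Delta> i * real k / r_M i"] h[OF 3] by simp
  next
    case 4
    have "real r_L / 4 \<le> r_h i" using h[OF 4] by simp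
    then have "r_w i \<le> exp (- (real r_L / 32))"
      using order_trans[OF w_bounds(2)[OF i], of "exp (- (real r_L / 32))"] by simp
    then show ?thesis using exp_neg_L by linarith
  qed
qed

end

section \<open>Concentration bounds and sparse rows\<close>

lemma ln2_ge_half: "1 / 2 \<le> ln (2::real)"
  using ln_le_minus_one[of "1 / 2 :: real"] by (simp add: ln_div)

text \<open>The real bound \<open>x\<close> excludes the value infinity, on which
  \<open>exp_neg\<close> is 0.\<close>

lemma exp_neg_ge:
  assumes "0 \<le> y" "y \<le> ereal x" "0 \<le> \<alpha>"
  shows "exp (- (\<alpha> * x)) \<le> exp_neg (ereal \<alpha> * y)"
proof -
  obtain z where z: "y = ereal z" "z \<le> x" using assms(1,2) by (cases y) auto
  then have "\<alpha> * z \<le> \<alpha> * x" using assms by (intro mult_left_mono) auto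
  then show ?thesis by (simp add: z exp_neg_def)
qed

text \<open>The logarithm in \<open>alpha\<close> is at least \<open>ln 2\<close>, hence at least
  1/2, so the constant 512 gives \<open>alpha \<le> 1 / 256\<close>, which matches the 256 in the
  bounds on the weights. The prefactor \<open>1 / alpha\<close> is then at least 256 and pays for
  the 4.\<close>

lemma prob_bad_ge:
  assumes A: "A \<in> carrier_mat m n" and i: "i < m" and A0: "\<And>j. j < n \<Longrightarrow> 0 \<le> A $$ (i, j)"
    and p: "\<And>j. j < n \<Longrightarrow> 0 \<le> p $ j" and D: "0 < \<Delta> $ i" and x: "0 \<le> x"
    and y: "ereal ((\<Delta> $ i)\<^sup>2) / ereal (\<Sum>j<n. p $ j * (A $$ (i, j))\<^sup>2) \<le> ereal x \<or>
      ereal (\<Delta> $ i) / ereal (Max (insert 0 ((\<lambda>j. A $$ (i, j)) ` {..<n}))) \<le> ereal x \<or>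
      ereal (\<Delta> $ i * real k) / ereal (\<Sum>j<n. p $ j * A $$ (i, j)) \<le> ereal x"
  shows "4 * exp (- (x / 256)) \<le> prob_bad 512 k A p \<Delta> i"
proof -
  have dim: "dim_col A = n" using A by simp
  let ?mu = "\<Sum>j<n. p $ j * A $$ (i, j)"
  let ?mx = "Max (insert 0 ((\<lambda>j. A $$ (i, j)) ` {..<n}))"
  let ?Q = "\<Sum>j<n. p $ j * (A $$ (i, j))\<^sup>2"
  let ?S = "{ereal ((\<Delta> $ i)\<^sup>2) / ereal ?Q, ereal (\<Delta> $ i) / ereal ?mx, ereal (\<Delta> $ i * real k) / ereal ?mu}"
  let ?\<alpha> = "alpha 512 A p \<Delta> i"
  have mu: "0 \<le> ?mu" "0 \<le> ?Q" using A0 p by (auto intro!: sum_nonneg)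
  have mx: "0 \<le> ?mx" by (intro Max_ge) auto
  have S0: "0 \<le> Min ?S" using mu mx D by (auto intro!: zero_le_divide_ereal)
  have fin: "finite ?S" "?S \<noteq> {}" by simp_all
  have "\<exists>e\<in>?S. e \<le> ereal x" using y by blast
  then have S1: "Min ?S \<le> ereal x" using Min_le_iff[OF fin] by blast
  have "0 \<le> ?mu / \<Delta> $ i" using mu D by simp
  then have "ln 2 \<le> ln (?mu / \<Delta> $ i + 2)" by simp
  then have ln: "1 / 2 \<le> ln (?mu / \<Delta> $ i + 2)" using ln2_ge_half by linarith
  define u where "u = ln (?mu / \<Delta> $ i + 2)"
  have u: "1 / 2 \<le> u" using ln by (simp only: u_def)
  have al: "?\<alpha> = inverse (512 * u)" by (simp only: alpha_def dim u_def)
  have al0: "0 \<le> ?\<alpha>" "?\<alpha> \<le> 1 / 256" "4 \<le> 1 / ?\<alpha>"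
    using u unfolding al by (simp_all add: field_simps)
  have "?\<alpha> * x \<le> x / 256" using mult_right_mono[OF al0(2) x] by simp
  then have "exp (- (x / 256)) \<le> exp (- (?\<alpha> * x))" by simp
  from order_trans[OF this exp_neg_ge[OF S0 S1 al0(1)]]
  have "exp (- (x / 256)) \<le> exp_neg (ereal ?\<alpha> * Min ?S)" .
  then have "4 * exp (- (x / 256)) \<le> 1 / ?\<alpha> * exp_neg (ereal ?\<alpha> * Min ?S)"
    by (rule mult_mono[OF al0(3)]) (use al0(1) in \<open>simp_all only: exp_ge_zero zero_le_divide_1_iff\<close>)
  then show ?thesis unfolding prob_bad_def dim .
qed

lemma prob_bad_nonneg:
  assumes "A \<in> carrier_mat m n" and "i < m" "\<And>j. j < n \<Longrightarrow> 0 \<le> A $$ (i, j)"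
    and p: "\<And>j. j < n \<Longrightarrow> 0 \<le> p $ j" and D: "0 < \<Delta> $ i"
  shows "0 \<le> prob_bad 512 k A p \<Delta> i"
proof -
  have "0 \<le> (\<Sum>j<n. p $ j * A $$ (i, j)) / \<Delta> $ i" using assms by (auto intro!: sum_nonneg divide_nonneg_pos)
  then have "0 \<le> ln ((\<Sum>j<n. p $ j * A $$ (i, j)) / \<Delta> $ i + 2)" by simp
  then have "0 \<le> alpha 512 A p \<Delta> i" using assms(1) by (simp add: alpha_def)
  then have al: "0 \<le> 1 / alpha 512 A p \<Delta> i" by simp
  have en: "0 \<le> exp_neg x" for x by (simp add: exp_neg_def)
  show ?thesis unfolding prob_bad_def by (rule mult_nonneg_nonneg[OF al en])
qed

section \<open>Sparse rows as sorted lists of nonzero columns\<close>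

definition nz :: "real mat \<Rightarrow> nat \<Rightarrow> nat list" where
  "nz A i = filter (\<lambda>j. A $$ (i, j) \<noteq> 0) [0..<dim_col A]"

abbreviation "nz_len A i \<equiv> length (nz A i)"
abbreviation "nz_col A i t \<equiv> nz A i ! t"
abbreviation "nz_val A i t \<equiv> A $$ (i, nz A i ! t)"

lemma nz_set: "set (nz A i) = {j. j < dim_col A \<and> A $$ (i, j) \<noteq> 0}"
  by (auto simp: nz_def)

lemma nz_distinct: "distinct (nz A i)"
  by (simp add: nz_def)

lemma nz_col_less: "t < nz_len A i \<Longrightarrow> nz_col A i t < dim_col A"
  using nth_mem[of t "nz A i"] by (simp add: nz_set)

lemma nz_sorted: "t < t' \<Longrightarrow> t' < nz_len A i \<Longrightarrow> nz_col A i t < nz_col A i t'"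
proof -
  have "sorted_wrt (<) (nz A i)" unfolding nz_def by (intro sorted_wrt_filter) simp
  then show "t < t' \<Longrightarrow> t' < nz_len A i \<Longrightarrow> nz_col A i t < nz_col A i t'" by (rule sorted_wrt_nth_less)
qed

lemma nz_len_le: "nz_len A i \<le> dim_col A"
  unfolding nz_def using length_filter_le[of _ "[0..<dim_col A]"] by simp

lemma sum_nz:
  fixes f :: "nat \<Rightarrow> real"
  assumes "\<And>j. j < dim_col A \<Longrightarrow> A $$ (i, j) = 0 \<Longrightarrow> f j = 0"
  shows "(\<Sum>t<nz_len A i. f (nz_col A i t)) = (\<Sum>j<dim_col A. f j)"
proof -
  have "(\<Sum>t<nz_len A i. f (nz_col A i t)) = sum f (set (nz A i))"
    using sum.reindex_bij_betw[OF bij_betw_nth[OF nz_distinct refl refl], of f A i] by simp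
  also have "\<dots> = (\<Sum>j<dim_col A. f j)"
    by (rule sum.mono_neutral_left) (use assms in \<open>auto simp: nz_set\<close>)
  finally show ?thesis .
qed

lemma nnz_eq: "nnz A = (\<Sum>i<dim_row A. nz_len A i)"
proof -
  have "{(i, j). i < dim_row A \<and> j < dim_col A \<and> A $$ (i, j) \<noteq> 0} = (SIGMA i:{..<dim_row A}. set (nz A i))"
    by (auto simp: nz_set)
  then show ?thesis unfolding nnz_def by (simp add: distinct_card nz_distinct)
qed

lemma enc_sparse_mat_eq: "enc_sparse_mat A = enc_mat (dim_row A) (nz_len A) (nz_col A) (nz_val A)"
proof -
  have map: "map f xs = map (\<lambda>t. f (xs ! t)) [0..<length xs]" for f :: "nat \<Rightarrow> val" and xs
    by (rule nth_equalityI) simp_all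
  show ?thesis unfolding enc_sparse_mat_def tab_def nz_def[symmetric]
    by (subst map) simp
qed

lemma enc_vec_eq: "enc_vec x = rv (dim_vec x) (\<lambda>j. x $ j)"
  by (simp add: enc_vec_def tab_def list_of_vec_map)

section \<open>The program on degenerate and on proper inputs\<close>

lemma cost_round_zero:
  "cost (A # rv n p # rv m \<Delta> # VNat 0 # env) round_e (vpair (rv n (\<lambda>_. 0)) (tab m (\<lambda>_. VNat 1)))
     (20 * (n + m + 1)) 50"
proof -
  have 1: "cost (A # rv n p # rv m \<Delta> # VNat 0 # env) (nless x3 (Lit 1)) (VNat 1) 3 3"
    by (rule cost_flat') simp_all
  show ?thesis unfolding round_e_def
    by (rule cost_mono[OF cost_Cond_true[OF 1 _ cost_trivial]]) simp_all
qed

lemma cost_round_empty: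
  assumes "0 < k" "n = 0 \<or> m = 0"
  shows "cost (A # rv n p # rv m \<Delta> # VNat k # env) round_e (vpair (rv n (\<lambda>_. 0)) (tab m (\<lambda>_. VNat 0)))
     (30 * (n + m + 1)) 60"
proof -
  let ?e = "A # rv n p # rv m \<Delta> # VNat k # env"
  have 1: "cost ?e (nless x3 (Lit 1)) (VNat 0) 3 3"
    by (rule cost_flat') (use assms in simp_all)
  have 2: "cost ?e (Cond (len x1) (len x2) (Lit 0)) (VNat 0) 7 7"
    by (rule cost_flat') (use assms in auto)
  have 3: "cost ?e (Cond (Cond (len x1) (len x2) (Lit 0)) walk_e (trivial_e 0))
    (vpair (rv n (\<lambda>_. 0)) (tab m (\<lambda>_. VNat 0))) (7 + 10 * (n + m + 1) + 1) (7 + 20 + 1)"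
    by (rule cost_Cond_false[OF 2 cost_trivial])
  show ?thesis unfolding round_e_def
    by (rule cost_mono[OF cost_Cond_false[OF 1 3]]) simp_all
qed

lemma (in rounding) cost_round:
  "cost (enc_mat m l cl a # rv n p # rv m \<Delta> # VNat k # env) round_e
    (vpair (rv n (\<lambda>j. if r_p j < 1 then 0 else 1)) (tab m (\<lambda>i. VNat (if r_W i + r_W (i + m) < 1 then 0 else 1))))
    (100000 * (row_size m l + n + 1) * ((r_G + 1) * (r_T + 1) + r_L) + 20)
    (100000 * (r_G + 2) * ((r_G + 1) * (r_T + 1) + r_L) + 20)"
proof -
  let ?e = "enc_mat m l cl a # rv n p # rv m \<Delta> # VNat k # env"
  have 1: "cost ?e (nless x3 (Lit 1)) (VNat 0) 3 3"
    by (rule cost_flat') (use nm in simp_all)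
  have 2: "cost ?e (Cond (len x1) (len x2) (Lit 0)) (VNat m) 7 7"
    by (rule cost_flat') (use nm in auto)
  show ?thesis unfolding round_e_def
    by (rule cost_mono[OF cost_Cond_false[OF 1 cost_Cond_true[OF 2 _ cost_walk]]]) (use nm in simp_all)
qed

text \<open>\<open>r_L\<close> is logarithmic and \<open>r_K\<close> is of order
  \<open>1 + k\<close> times a logarithm. The number of steps carries the square of the latter and
  one more logarithm, and the levels of the sign selection contribute the fourth.\<close>

lemma (in rounding) size_bounds:
  defines "\<Lambda> \<equiv> 1 + ln (real (n + m + 1))" and "X \<equiv> real ((r_G + 1) * (r_T + 1) + r_L)"
  shows "real r_G \<le> 2 * \<Lambda>" "1 \<le> \<Lambda>" "X \<le> 10 ^ 10 * (1 + real k)\<^sup>2 * \<Lambda> ^ 4"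
proof -
  let ?u = "1 + real k"
  show L1: "1 \<le> \<Lambda>" unfolding \<Lambda>_def by (simp add: ln_ge_zero)
  have "2 ^ r_G \<le> 2 * (n + m + 1)" unfolding r_G_def by (rule bitlen_le) simp
  then have "real (2 ^ r_G) \<le> real (2 * (n + m + 1))" by (simp only: of_nat_le_iff)
  then have "2 ^ r_G \<le> 2 * real (n + m + 1)" by (simp only: of_nat_power of_nat_mult of_nat_numeral)
  then have "ln (2 ^ r_G) \<le> ln (2 * real (n + m + 1))" by (intro ln_mono) auto
  also have "\<dots> = ln 2 + ln (real (n + m + 1))" by (rule ln_mult_pos) auto
  finally have "real r_G * ln 2 \<le> ln 2 + ln (real (n + m + 1))" by (simp add: ln_realpow)
  moreover have "ln (real (n + m + 1)) * 1 \<le> ln (real (n + m + 1)) * (2 * ln 2)"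
    using ln2_ge_half by (intro mult_left_mono) (auto simp: ln_ge_zero)
  moreover have "2 * \<Lambda> * ln 2 = 2 * ln 2 + ln (real (n + m + 1)) * (2 * ln 2)"
    by (simp add: \<Lambda>_def algebra_simps)
  ultimately have "real r_G * ln 2 \<le> 2 * \<Lambda> * ln 2" using ln2_ge_half by linarith
  then show G: "real r_G \<le> 2 * \<Lambda>" by (rule mult_right_le_imp_le) simp
  have u1: "1 \<le> ?u" by simp
  have uL: "\<Lambda> \<le> ?u * \<Lambda>" using mult_right_mono[OF u1, of \<Lambda>] L1 by simp
  have L: "real r_L \<le> 1280 * \<Lambda>" using G L1 by (simp add: r_L_def)
  have "real k * 1 \<le> real k * \<Lambda>" using L1 by (intro mult_left_mono) auto
  then have "real r_K \<le> 2560 * (?u * \<Lambda>)" using L L1 by (simp add: r_K_def algebra_simps)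
  then have KK: "real r_K * real r_K \<le> (2560 * (?u * \<Lambda>)) * (2560 * (?u * \<Lambda>))" by (intro mult_mono) (use L1 in auto)
  have B: "real (3 * r_G + 4) \<le> 10 * \<Lambda>" using G L1 by simp
  have "32 * (real r_K * real r_K) * real (3 * r_G + 4) \<le>
    32 * ((2560 * (?u * \<Lambda>)) * (2560 * (?u * \<Lambda>))) * (10 * \<Lambda>)"
    by (rule mult_mono[OF mult_left_mono[OF KK] B]) (use L1 in auto)
  moreover have "real r_T = 32 * (real r_K * real r_K) * real (3 * r_G + 4)"
    by (simp only: r_T_def of_nat_mult of_nat_numeral)
  moreover have "32 * ((2560 * (?u * \<Lambda>)) * (2560 * (?u * \<Lambda>))) * (10 * \<Lambda>) = 2097152000 * (?u\<^sup>2 * \<Lambda> ^ 3)"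
    by (simp add: power2_eq_square power3_eq_cube)
  ultimately have T: "real r_T \<le> 2097152000 * (?u\<^sup>2 * \<Lambda> ^ 3)" by (simp only:)
  have L4: "\<Lambda> ^ 4 = \<Lambda> * \<Lambda> ^ 3" by (simp add: power_numeral_reduce)
  have p1: "1 \<le> ?u\<^sup>2 * \<Lambda> ^ 3" using mult_mono[OF one_le_power[OF u1, of 2] one_le_power[OF L1, of 3]] by simp
  have "real (r_G + 1) * real (r_T + 1) \<le> (3 * \<Lambda>) * (2097152001 * (?u\<^sup>2 * \<Lambda> ^ 3))"
    using G L1 T p1 by (intro mult_mono) auto
  also have "\<dots> = 6291456003 * (?u\<^sup>2 * \<Lambda> ^ 4)" unfolding L4 by simp
  finally have 1: "real (r_G + 1) * real (r_T + 1) \<le> 6291456003 * (?u\<^sup>2 * \<Lambda> ^ 4)" .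
  have "\<Lambda> * 1 \<le> \<Lambda> * (?u\<^sup>2 * \<Lambda> ^ 3)" using p1 L1 by (intro mult_left_mono) auto
  also have "\<dots> = ?u\<^sup>2 * \<Lambda> ^ 4" unfolding L4 by (simp only: mult_ac)
  finally have 2: "\<Lambda> \<le> ?u\<^sup>2 * \<Lambda> ^ 4" by simp
  have "X = real (r_G + 1) * real (r_T + 1) + real r_L" by (simp only: X_def of_nat_add of_nat_mult)
  also have "\<dots> \<le> 10 ^ 10 * (?u\<^sup>2 * \<Lambda> ^ 4)" using 1 2 L by simp
  finally show "X \<le> 10 ^ 10 * ?u\<^sup>2 * \<Lambda> ^ 4" by (simp only: mult.assoc)
qed

section \<open>Guarantees and resource bounds for a matrix\<close>

locale matrix_rounding =
  fixes n m k :: nat and A :: "real mat" and p \<Delta> :: "real vec"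
  assumes A: "A \<in> carrier_mat m n" and A0: "\<And>i j. i < m \<Longrightarrow> j < n \<Longrightarrow> 0 \<le> A $$ (i, j)"
    and p: "p \<in> carrier_vec n" and p01: "\<And>j. j < n \<Longrightarrow> p $ j \<in> {0..1}"
    and \<Delta>: "\<Delta> \<in> carrier_vec m" and \<Delta>0: "\<And>i. i < m \<Longrightarrow> 0 < \<Delta> $ i"
    and pos: "0 < n" "0 < m" "0 < k"
begin

lemma dims: "dim_col A = n" "dim_row A = m" "dim_vec p = n" "dim_vec \<Delta> = m"
  using A p \<Delta> by auto

sublocale rounding n m k "nz_len A" "nz_col A" "nz_val A" "\<lambda>j. p $ j" "\<lambda>i. \<Delta> $ i"
proof
  fix i t assume "i < m" "t < nz_len A i"
  then show "nz_col A i t < n" "0 \<le> nz_val A i t" using nz_col_less[of t A i] A0 dims by auto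
next
  show "nz_len A i \<le> n" for i using nz_len_le[of A i] dims by simp
qed (use nz_sorted \<Delta>0 p01 pos in auto)

text \<open>Each of the three exponential bounds is at most a quarter of \<open>prob_bad\<close>.
  The terms \<open>1 / (8 m)\<close> sum to 1/8; doubled for the two tails and joined by the 1/4 of
  the column potentials, they add only 1/2 to the count of bad rows.\<close>

lemma w_prob:
  assumes i: "i < m"
  shows "r_w i \<le> 1 / (8 * real m) + prob_bad 512 k A p \<Delta> i / 4"
proof -
  have p0: "0 \<le> p $ j" if "j < n" for j using p01[OF that] by simp
  note pg = prob_bad_ge[OF A i A0[OF i] p0 \<Delta>0[OF i], of _ k]
  have P0: "0 \<le> prob_bad 512 k A p \<Delta> i"
    by (rule prob_bad_nonneg[OF A i A0[OF i] p0 \<Delta>0[OF i]])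
  have Q: "(\<Sum>j<n. p $ j * (A $$ (i, j))\<^sup>2) = r_Q i"
    unfolding r_Q_def using sum_nz[of A i "\<lambda>j. p $ j * (A $$ (i, j) * A $$ (i, j))"] dims
    by (simp add: power2_eq_square)
  have M: "(\<Sum>j<n. p $ j * A $$ (i, j)) = r_M i"
    unfolding r_M_def using sum_nz[of A i "\<lambda>j. p $ j * A $$ (i, j)"] dims by simp
  let ?mx = "Max (insert 0 ((\<lambda>j. A $$ (i, j)) ` {..<n}))"
  \<comment> \<open>One direction is enough: a larger maximum makes the quotient in
    \<open>prob_bad\<close> smaller.\<close>
  have mx: "r_mx i \<le> ?mx"
  proof (cases "nz_len A i = 0")
    case True
    then show ?thesis by (simp add: r_mx_def Max_ge)
  next
    case False
    have "r_mx i = Max (nz_val A i ` {..<nz_len A i})" using False by (simp add: r_mx_def)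
    also have "\<dots> \<le> ?mx"
    proof (rule Max_mono)
      show "nz_val A i ` {..<nz_len A i} \<subseteq> insert 0 ((\<lambda>j. A $$ (i, j)) ` {..<n})"
        using nz_col_less[of _ A i] dims by auto
    qed (use False in auto)
    finally show ?thesis .
  qed
  have D: "0 < \<Delta> $ i" by (rule \<Delta>0[OF i])
  have big: "0 < r_Q i \<and> r_w i \<le> exp (- ((\<Delta> $ i)\<^sup>2 / r_Q i / 256)) \<or>
    0 < r_mx i \<and> r_w i \<le> exp (- (\<Delta> $ i / r_mx i / 256)) \<or>
    0 < r_M i \<and> r_w i \<le> exp (- (\<Delta> $ i * real k / r_M i / 256)) \<Longrightarrow>
    4 * r_w i \<le> prob_bad 512 k A p \<Delta> i"
  proof (elim disjE conjE)
    assume q: "0 < r_Q i" "r_w i \<le> exp (- ((\<Delta> $ i)\<^sup>2 / r_Q i / 256))"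
    have "ereal ((\<Delta> $ i)\<^sup>2) / ereal (r_Q i) \<le> ereal ((\<Delta> $ i)\<^sup>2 / r_Q i)" using q by simp
    moreover have "0 \<le> (\<Delta> $ i)\<^sup>2 / r_Q i" using q by simp
    ultimately have "4 * exp (- ((\<Delta> $ i)\<^sup>2 / r_Q i / 256)) \<le> prob_bad 512 k A p \<Delta> i"
      using pg[of "(\<Delta> $ i)\<^sup>2 / r_Q i"] unfolding Q by (simp only: simp_thms)
    then show ?thesis using q(2) by linarith
  next
    assume q: "0 < r_mx i" "r_w i \<le> exp (- (\<Delta> $ i / r_mx i / 256))"
    have "\<Delta> $ i / ?mx \<le> \<Delta> $ i / r_mx i" using q mx D by (intro divide_left_mono) auto
    moreover have "?mx \<noteq> 0" using q mx by linarith
    ultimately have "ereal (\<Delta> $ i) / ereal ?mx \<le> ereal (\<Delta> $ i / r_mx i)" by simp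
    then have "4 * exp (- (\<Delta> $ i / r_mx i / 256)) \<le> prob_bad 512 k A p \<Delta> i"
      using pg[of "\<Delta> $ i / r_mx i"] q(1) D by (simp only: divide_nonneg_pos less_imp_le simp_thms)
    then show ?thesis using q(2) by linarith
  next
    assume q: "0 < r_M i" "r_w i \<le> exp (- (\<Delta> $ i * real k / r_M i / 256))"
    have "ereal (\<Delta> $ i * real k) / ereal (r_M i) \<le> ereal (\<Delta> $ i * real k / r_M i)" using q by simp
    moreover have "0 \<le> \<Delta> $ i * real k / r_M i" using D q by simp
    ultimately have "4 * exp (- (\<Delta> $ i * real k / r_M i / 256)) \<le> prob_bad 512 k A p \<Delta> i"
      using pg[of "\<Delta> $ i * real k / r_M i"] unfolding M by (simp only: simp_thms)
    then show ?thesis using q(2) by linarith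
  qed
  have "0 \<le> 1 / (8 * real m)" by simp
  then show ?thesis using w_small[OF i] big P0 by argo
qed

definition "bad = {i. i < m \<and> 1 \<le> r_W i + r_W (i + m)}"

lemma card_bad_prob: "real (card bad) \<le> (\<Sum>i<m. prob_bad 512 k A p \<Delta> i)"
proof -
  let ?S = "\<Sum>i<m. prob_bad 512 k A p \<Delta> i"
  have p0: "0 \<le> p $ j" if "j < n" for j using p01[OF that] by simp
  have S0: "0 \<le> ?S"
    by (intro sum_nonneg, rule prob_bad_nonneg[OF A _ _ p0]) (use A0 \<Delta>0 in auto)
  have "(\<Sum>i<m. r_w i) \<le> (\<Sum>i<m. 1 / (8 * real m) + prob_bad 512 k A p \<Delta> i / 4)"
    by (intro sum_mono w_prob) simp
  also have "\<dots> = 1 / 8 + ?S / 4" using pos by (simp add: sum.distrib sum_divide_distrib)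
  finally have "(\<Sum>i<m. r_w i) \<le> 1 / 8 + ?S / 4" .
  \<comment> \<open>The additive term is absorbed because the left-hand side is an integer.\<close>
  then have le: "real (card bad) \<le> ?S / 2 + 1 / 2" using card_bad unfolding bad_def by linarith
  show ?thesis
  proof (cases "?S < 1")
    case True
    then have "card bad = 0" using le by linarith
    then show ?thesis using S0 by simp
  next
    case False
    then show ?thesis using le by linarith
  qed
qed

definition "q_vec = vec n (\<lambda>j. if r_p j < 1 then 0 else 1 :: real)"

lemma good_row_mat:
  assumes i: "i < m" "i \<notin> bad"
  shows "\<bar>\<Sum>j<n. A $$ (i, j) * (p $ j - q_vec $ j)\<bar> \<le> \<Delta> $ i"
proof -
  let ?q = "\<lambda>j. if r_p j < 1 then 0 else 1 :: real"
  have "(\<Sum>j<n. A $$ (i, j) * (p $ j - q_vec $ j)) = (\<Sum>j<n. A $$ (i, j) * (p $ j - ?q j))"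
    by (intro sum.cong) (auto simp: q_vec_def)
  also have "\<dots> = (\<Sum>t<nz_len A i. nz_val A i t * (p $ nz_col A i t - ?q (nz_col A i t)))"
    using sum_nz[of A i "\<lambda>j. A $$ (i, j) * (p $ j - ?q j)"] dims by simp
  finally show ?thesis using good_row[OF i(1)] i by (simp add: bad_def)
qed

lemma row_size_eq: "row_size m (nz_len A) = nnz A + m"
  unfolding row_size_def sum.distrib nnz_eq dims by simp

lemma cost_round_mat:
  "cost [enc_sparse_mat A, enc_vec p, enc_vec \<Delta>, VNat k] round_e (vpair (enc_vec q_vec) (enc_set m bad))
    (100000 * (nnz A + m + n + 1) * ((r_G + 1) * (r_T + 1) + r_L) + 20)
    (100000 * (r_G + 2) * ((r_G + 1) * (r_T + 1) + r_L) + 20)"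
proof -
  have 1: "enc_vec q_vec = rv n (\<lambda>j. if r_p j < 1 then 0 else 1)"
    unfolding enc_vec_eq by (auto simp: q_vec_def intro!: tab_cong)
  have 2: "enc_set m bad = tab m (\<lambda>i. VNat (if r_W i + r_W (i + m) < 1 then 0 else 1))"
    unfolding enc_set_def tab_def[symmetric] by (auto simp: bad_def intro!: tab_cong)
  show ?thesis using cost_round[of "[]"] unfolding 1 2 row_size_eq
    by (simp only: enc_sparse_mat_eq enc_vec_eq dims)
qed

lemma work_bound:
  "real (100000 * (nnz A + m + n + 1) * ((r_G + 1) * (r_T + 1) + r_L) + 20) \<le>
    10 ^ 18 * real (Max {nnz A, n, m, 1}) * (1 + ln (real (n + m + 1))) ^ 7 * (1 + real k) ^ 7"
proof -
  let ?\<Lambda> = "1 + ln (real (n + m + 1))" and ?u = "1 + real k" and ?M = "Max {nnz A, n, m, 1}"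
  let ?X = "(r_G + 1) * (r_T + 1) + r_L"
  note b = size_bounds
  have M: "nnz A \<le> ?M" "m \<le> ?M" "n \<le> ?M" "1 \<le> ?M" by (intro Max_ge; simp)+
  then have "nnz A + m + n + 1 \<le> 4 * ?M" by linarith
  then have N: "real (nnz A + m + n + 1) \<le> 4 * real ?M" by linarith
  have uL: "?u\<^sup>2 * ?\<Lambda> ^ 4 \<le> ?\<Lambda> ^ 7 * ?u ^ 7"
    using mult_mono[OF power_increasing[of 2 7 ?u] power_increasing[of 4 7 ?\<Lambda>]] b(2) by (simp add: mult.commute)
  have X: "real ?X \<le> 10 ^ 10 * (?\<Lambda> ^ 7 * ?u ^ 7)" using b(3) uL by simp
  have one: "1 * 1 \<le> ?\<Lambda> ^ 7 * ?u ^ 7" using b(2) by (intro mult_mono one_le_power) auto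
  define Y where "Y = real ?M * (?\<Lambda> ^ 7 * ?u ^ 7)"
  have "real (nnz A + m + n + 1) * real ?X \<le> (4 * real ?M) * (10 ^ 10 * (?\<Lambda> ^ 7 * ?u ^ 7))"
    using N X by (intro mult_mono) auto
  also have "\<dots> = 40000000000 * Y" by (simp add: Y_def)
  finally have XY: "real (nnz A + m + n + 1) * real ?X \<le> 40000000000 * Y" .
  have "1 * 1 \<le> Y" unfolding Y_def using one M(4) by (intro mult_mono) auto
  then have "100000 * (real (nnz A + m + n + 1) * real ?X) + 20 \<le> 1000000000000000000 * Y"
    using XY by linarith
  moreover have "real (100000 * (nnz A + m + n + 1) * ?X + 20) = 100000 * (real (nnz A + m + n + 1) * real ?X) + 20"
    by (simp only: of_nat_add of_nat_mult of_nat_numeral mult.assoc)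
  moreover have "1000000000000000000 * Y = 10 ^ 18 * real ?M * ?\<Lambda> ^ 7 * ?u ^ 7" by (simp add: Y_def)
  ultimately show ?thesis by (simp only:)
qed

text \<open>Up to constants there are two factors \<open>1 + k\<close>, four logarithms from the
  steps and levels, and one logarithm for the sums within a level; together they give the exponent
  7. For positive \<open>n\<close> and \<open>m\<close>,
  \<open>n + m + 1 \<le> 2 * (n * m + 1)\<close>, which turns logarithms of the sum into logarithms
  of the product.\<close>

lemma depth_bound:
  "real (100000 * (r_G + 2) * ((r_G + 1) * (r_T + 1) + r_L) + 20) \<le>
    10 ^ 18 * (1 + ln (real (n * m + 1)) + real k) ^ 7"
proof -
  let ?\<Lambda> = "1 + ln (real (n + m + 1))" and ?u = "1 + real k" and ?\<mu> = "1 + ln (real (n * m + 1)) + real k"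
  let ?X = "(r_G + 1) * (r_T + 1) + r_L"
  note b = size_bounds
  have ln0: "0 \<le> ln (real (n * m + 1))" by simp
  have nm1: "0 < real (n * m + 1)" "0 < real (n + m + 1)" "0 < real (2 * (n * m + 1))"
    by (simp_all only: of_nat_0_less_iff) simp_all
  have u: "?u \<le> ?\<mu>" "1 \<le> ?\<mu>" using ln0 by auto
  have "n + m + 1 \<le> 2 * (n * m + 1)"
  proof -
    obtain n' m' where "n = Suc n'" "m = Suc m'" using pos by (metis gr0_conv_Suc)
    then show ?thesis by simp
  qed
  then have "real (n + m + 1) \<le> real (2 * (n * m + 1))" by (simp only: of_nat_le_iff)
  then have "ln (real (n + m + 1)) \<le> ln (real (2 * (n * m + 1)))" by (rule ln_mono[OF _ nm1(2)])
  also have "\<dots> = ln (2 * real (n * m + 1))" by (simp only: of_nat_mult of_nat_numeral)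
  also have "\<dots> = ln 2 + ln (real (n * m + 1))" by (rule ln_mult_pos[OF _ nm1(1)]) simp
  finally have l: "ln (real (n + m + 1)) \<le> ln 2 + ln (real (n * m + 1))" .
  have "ln (2::real) \<le> 1" using ln_le_minus_one[of 2] by simp
  then have "1 + y \<le> 2 * (1 + x + real k)" if "y \<le> ln 2 + x" "0 \<le> x" for x y using that by simp
  from this[OF l ln0] have L: "?\<Lambda> \<le> 2 * ?\<mu>" .
  have L0: "0 \<le> ?\<Lambda>" using b(2) by linarith
  have "real ?X \<le> 10 ^ 10 * (?u\<^sup>2 * ?\<Lambda> ^ 4)" using b(3) by (simp only: mult.assoc)
  also have "\<dots> \<le> 10 ^ 10 * (?\<mu>\<^sup>2 * (2 * ?\<mu>) ^ 4)"
    using u L L0 by (intro mult_left_mono mult_mono power_mono) auto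
  also have "10 ^ 10 * (x\<^sup>2 * (2 * x) ^ 4) = 16 * 10 ^ 10 * (x\<^sup>2 * x ^ 4)" for x :: real
    by (simp add: power_mult_distrib)
  finally have X: "real ?X \<le> 16 * 10 ^ 10 * (?\<mu>\<^sup>2 * ?\<mu> ^ 4)" .
  have "x + 2 \<le> 6 * z" if "x \<le> 2 * y" "y \<le> 2 * z" "1 \<le> z" for x y z :: real using that by linarith
  from this[OF b(1) L u(2)] have G: "real (r_G + 2) \<le> 6 * ?\<mu>" by (simp only: of_nat_add of_nat_numeral)
  have "real (r_G + 2) * real ?X \<le> 6 * ?\<mu> * (16 * 10 ^ 10 * (?\<mu>\<^sup>2 * ?\<mu> ^ 4))"
    using G X u by (intro mult_mono) auto
  also have "6 * x * (16 * 10 ^ 10 * (x\<^sup>2 * x ^ 4)) = 96 * 10 ^ 10 * x ^ 7" for x :: real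
    by (simp add: eval_nat_numeral)
  finally have "real (r_G + 2) * real ?X \<le> 96 * 10 ^ 10 * ?\<mu> ^ 7" .
  moreover have "1 \<le> ?\<mu> ^ 7" using u by (intro one_le_power)
  moreover have "real (100000 * (r_G + 2) * ?X + 20) = 100000 * (real (r_G + 2) * real ?X) + 20"
    by (simp only: of_nat_add of_nat_mult of_nat_numeral mult.assoc)
  moreover have "100000 * x + 20 \<le> 10 ^ 18 * y" if "x \<le> 96 * 10 ^ 10 * y" "1 \<le> y" for x y :: real
    using that by simp
  ultimately show ?thesis by (simp only:)
qed

end

theorem theorem4:
  "\<exists>(c::real) > 0. \<exists>(algorithm::expr) (C::real) (D::nat).
     \<forall>(n::nat) (m::nat) (k::nat) (A::real mat) (p::real vec) (\<Delta>::real vec).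
       A \<in> carrier_mat m n \<longrightarrow> (\<forall>i<m. \<forall>j<n. 0 \<le> A $$ (i, j)) \<longrightarrow>
       p \<in> carrier_vec n \<longrightarrow> (\<forall>j<n. p $ j \<in> {0..1}) \<longrightarrow>
       \<Delta> \<in> carrier_vec m \<longrightarrow> (\<forall>i<m. 0 < \<Delta> $ i) \<longrightarrow>
       (\<exists>(q::real vec) (I_bad::nat set) (work::nat) (depth::nat).
          evals [enc_sparse_mat A, enc_vec p, enc_vec \<Delta>, VNat k] algorithm
            (VVec [enc_vec q, enc_set m I_bad]) work depth \<and>
          real work \<le> C * real (Max {nnz A, n, m, 1}) * (1 + ln (real (n + m + 1))) ^ D
                        * (1 + real k) ^ D \<and>
          real depth \<le> C * (1 + ln (real (n * m + 1)) + real k) ^ D \<and>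
          q \<in> carrier_vec n \<and> (\<forall>j<n. q $ j \<in> {0, 1}) \<and>
          I_bad \<subseteq> {..<m} \<and>
          real (card I_bad) \<le> (\<Sum>i<m. prob_bad c k A p \<Delta> i) \<and>
          (\<forall>i \<in> {..<m} - I_bad. \<bar>\<Sum>j<n. A $$ (i, j) * (p $ j - q $ j)\<bar> \<le> \<Delta> $ i))"
\<comment> \<open>The 512 is twice the 256 of the weight bounds, since the logarithm in
  \<open>alpha\<close> is bounded below by 1/2; the exponent 7 is the one arising for the
  depth.\<close>
proof (rule exI[of _ 512], intro conjI, simp, rule exI[of _ round_e], rule exI[of _ "10 ^ 18"],
    rule exI[of _ 7], intro allI impI)
  fix n m k :: nat and A :: "real mat" and p \<Delta> :: "real vec"
  assume A: "A \<in> carrier_mat m n" and A0: "\<forall>i<m. \<forall>j<n. 0 \<le> A $$ (i, j)"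
    and p: "p \<in> carrier_vec n" and p01: "\<forall>j<n. p $ j \<in> {0..1}"
    and D: "\<Delta> \<in> carrier_vec m" and D0: "\<forall>i<m. 0 < \<Delta> $ i"
  let ?W = "10 ^ 18 * real (Max {nnz A, n, m, 1}) * (1 + ln (real (n + m + 1))) ^ 7 * (1 + real k) ^ 7"
  let ?D = "10 ^ 18 * (1 + ln (real (n * m + 1)) + real k) ^ 7"
  let ?env = "[enc_sparse_mat A, enc_vec p, enc_vec \<Delta>, VNat k]"
  let ?goal = "\<exists>(q::real vec) (I_bad::nat set) (work::nat) (depth::nat).
          evals ?env round_e (VVec [enc_vec q, enc_set m I_bad]) work depth \<and>
          real work \<le> ?W \<and> real depth \<le> ?D \<and>
          q \<in> carrier_vec n \<and> (\<forall>j<n. q $ j \<in> {0, 1}) \<and> I_bad \<subseteq> {..<m} \<and>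
          real (card I_bad) \<le> (\<Sum>i<m. prob_bad 512 k A p \<Delta> i) \<and>
          (\<forall>i \<in> {..<m} - I_bad. \<bar>\<Sum>j<n. A $$ (i, j) * (p $ j - q $ j)\<bar> \<le> \<Delta> $ i)"
  have fin: ?goal
    if c: "cost ?env round_e (vpair (enc_vec q) (enc_set m I)) w d"
      and b: "real w \<le> ?W" "real d \<le> ?D" and q: "q \<in> carrier_vec n" "\<forall>j<n. q $ j \<in> {0, 1}"
      and I: "I \<subseteq> {..<m}" "real (card I) \<le> (\<Sum>i<m. prob_bad 512 k A p \<Delta> i)"
      and g: "\<forall>i \<in> {..<m} - I. \<bar>\<Sum>j<n. A $$ (i, j) * (p $ j - q $ j)\<bar> \<le> \<Delta> $ i"
    for q I w d
  proof -
    obtain w' d' where e: "evals ?env round_e (vpair (enc_vec q) (enc_set m I)) w' d'" "w' \<le> w" "d' \<le> d"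
      using c unfolding cost_def by blast
    have "real w' \<le> ?W" "real d' \<le> ?D" using b e(2,3) by (meson of_nat_le_iff order_trans)+
    then show ?thesis using e(1) q I g by blast
  qed
  have p0: "0 \<le> p $ j" if "j < n" for j using p01 that by simp
  have enc: "enc_vec p = rv n (\<lambda>j. p $ j)" "enc_vec \<Delta> = rv m (\<lambda>i. \<Delta> $ i)"
    using p D by (simp_all add: enc_vec_eq)
  have q0: "enc_vec (0\<^sub>v n) = rv n (\<lambda>_. 0)" unfolding enc_vec_eq by (auto intro!: tab_cong)
  have W: "real (30 * (n + m + 1)) \<le> ?W"
  proof -
    let ?M = "Max {nnz A, n, m, 1}"
    have M: "m \<le> ?M" "n \<le> ?M" "1 \<le> ?M" by (intro Max_ge; simp)+
    then have "n + m + 1 \<le> 3 * ?M" by linarith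
    then have "real (30 * (n + m + 1)) \<le> real (90 * ?M)" using mult_le_mono2[of "n + m + 1" "3 * ?M" 30]
      by (simp only: of_nat_le_iff mult.assoc[symmetric]) simp
    also have "\<dots> = 90 * real ?M * 1 * 1" by simp
    also have "\<dots> \<le> ?W" by (intro mult_mono one_le_power) (auto simp: ln_ge_zero)
    finally show ?thesis .
  qed
  have Dp: "real 60 \<le> ?D"
  proof -
    have "1 \<le> (1 + ln (real (n * m + 1)) + real k) ^ 7" by (intro one_le_power) (simp add: add_nonneg_nonneg)
    then have "60 * 1 \<le> 10 ^ 18 * (1 + ln (real (n * m + 1)) + real k) ^ 7" by (rule mult_mono[rotated]) simp_all
    then show ?thesis by simp
  qed
  show ?goal
  proof (cases "k = 0")
    case True
    show ?thesis
    proof (rule fin)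
      have s: "enc_set m {..<m} = tab m (\<lambda>_. VNat 1)"
        unfolding enc_set_def tab_def[symmetric] by (auto intro!: tab_cong)
      show "cost ?env round_e (vpair (enc_vec (0\<^sub>v n)) (enc_set m {..<m})) (20 * (n + m + 1)) 50"
        unfolding enc q0 s True by (rule cost_round_zero)
      \<comment> \<open>For \<open>k = 0\<close> the third quotient is 0, also when its denominator
        vanishes, because 0 / 0 is 0 in the extended reals. Hence every \<open>prob_bad\<close> is
        at least 4, and all rows may be declared bad.\<close>
      have "4 * exp (- (0 / 256)) \<le> prob_bad 512 k A p \<Delta> i" if i: "i < m" for i
        by (rule prob_bad_ge[OF A i _ p0]) (use A0 D0 i True in \<open>auto simp flip: zero_ereal_def\<close>)
      then have "(\<Sum>i<m. 1) \<le> (\<Sum>i<m. prob_bad 512 k A p \<Delta> i)" by (intro sum_mono) force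
      then show "real (card {..<m}) \<le> (\<Sum>i<m. prob_bad 512 k A p \<Delta> i)" by simp
    qed (use W Dp in auto)
  next
    case k: False
    show ?thesis
    proof (cases "n = 0 \<or> m = 0")
      case True
      show ?thesis
      proof (rule fin)
        have s: "enc_set m {} = tab m (\<lambda>_. VNat 0)"
          unfolding enc_set_def tab_def[symmetric] by simp
        show "cost ?env round_e (vpair (enc_vec (0\<^sub>v n)) (enc_set m {})) (30 * (n + m + 1)) 60"
          unfolding enc q0 s by (rule cost_round_empty[OF _ True]) (use k in simp)
        show "real (card {}) \<le> (\<Sum>i<m. prob_bad 512 k A p \<Delta> i)"
          by (simp, intro sum_nonneg, rule prob_bad_nonneg[OF A _ _ p0]) (use A0 D0 in auto)
      qed (use W Dp True D0 in auto)
    next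
      case False
      interpret matrix_rounding n m k A p \<Delta>
        by standard (use A A0 p p01 D D0 k False in auto)
      show ?thesis
        by (rule fin[OF cost_round_mat work_bound depth_bound])
          (use card_bad_prob good_row_mat in \<open>auto simp: q_vec_def bad_def\<close>)
    qed
  qed
qed

end
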